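(* Let $d \geq 2$, $\tilde L > 0$, $r \geq 64$, and $\mathcal{M} = \mathbb{H}^d$. Define $\hat\epsilon = \frac{1}{2^{10} r}$, $\epsilon = \frac{1}{2^{18} \zeta_r \log^2(\zeta_r)}$, $\epsilon' = \frac{1}{2^{18} \log^2(\zeta_r)}$ and $L = \frac{\tilde L}{2^{10} \log^2(r)}$, where $\zeta_r = \frac{r}{\tanh(r)}$. Let $\mathcal{A}$ be any deterministic first-order algorithm on $\mathcal{M}$. Then there is a $C^\infty$ function $\tilde f \in \mathcal{F}_{r, \tilde L/2, 0, \tilde L}^d$ with unique minimizer $x^*$ such that running $\mathcal{A}$ on $\tilde f$ yields iterates $x_0, x_1, \ldots$ satisfying $$\tilde f(x_k) - \tilde f(x^* ) \geq 2 \hat{\epsilon} L r^2 \geq \epsilon' \cdot \frac{\tilde L}{2} r \geq \epsilon \cdot \frac{1}{2} \tilde L r^2$$ for all $k = 0, 1, \ldots, T-1$, where $T = \left\lfloor \frac{\zeta_r}{50 \log(64 \zeta_r)} \right\rfloor$.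
   Context: $\mathbb{H}^d$ is $d$-dimensional hyperbolic space of constant sectional curvature $-1$, with a fixed reference point $x_{\mathrm{ref}} \in \mathbb{H}^d$; $\mathrm{dist}$ is Riemannian distance, $B(x,r) = \{y : \mathrm{dist}(x,y)\le r\}$, $\mathrm{T}\mathcal{M}$ the tangent bundle, $\exp_x$ the exponential map, $\log_x$ its inverse, and $P_{x\to y}$ parallel transport along the geodesic from $x$ to $y$. A set is g-convex if it contains the geodesic segment between any two of its points. A function $f$ is $\mu$-strongly g-convex on a g-convex set $D$ if $f(\gamma(t)) \le (1-t)f(x)+tf(y)-\frac{\mu}{2}t(1-t)\mathrm{dist}(x,y)^2$ for all $x,y\in D$, $t \in [0,1]$, with $\gamma:[0,1]\to \mathcal{M}$ the geodesic with $\gamma(0)=x,\gamma(1)=y$; g-convex means $\mu=0$. A differentiable $f$ is $L$-smooth in $D$ if $\|\nabla f(x)-P_{y\to x}\nabla f(y)\|\le L\,\mathrm{dist}(x,y)$ for all $x,y\in D$. $f$ is $M$-Lipschitz if $|f(x)-f(y)|\le M\,\mathrm{dist}(x,y)$. A subgradient of $f$ at $x$ is $g\in \mathrm{T}_x\mathcal{M}$ with $f(y)\ge f(x)+\langle g,\log_x(y)\rangle$ for all $y$; $\partial f(x)$ is the set of subgradients. $\mathcal{F}^d_{r,M,0,L}$ is the class of functions $f:\mathbb{H}^d\to\mathbb{R}$ that are globally $M$-Lipschitz, globally g-convex, globally $L$-smooth, and have a global minimizer in $B(x_{\mathrm{ref}},r)$. A deterministic first-order algorithm $\mathcal{A}$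 on $\mathcal{M}$ is a sequence of functions $\mathcal{A}_k:(\mathbb{R}\times \mathrm{T}\mathcal{M})^k\to\mathcal{M}$, $k\ge 0$ ($\mathcal{A}_0$ is just an initial point $x_0$). Running $\mathcal{A}$ on $f$ produces $x_k=\mathcal{A}_k\big((f(x_\ell),(x_\ell,g_\ell))_{\ell=0}^{k-1}\big)$, where $g_\ell\in\partial f(x_\ell)$ is returned by an oracle associated to $f$ (for differentiable $f$, $g_\ell=\nabla f(x_\ell)$). *)

theory Defs
  imports "HOL-Analysis.Analysis"
begin

section \<open>The hyperboloid model of hyperbolic space\<close>

text \<open>
  For a Euclidean space \<open>'a\<close> of dimension \<open>d\<close>, hyperbolic space of dimension \<open>d\<close> and constant
  curvature \<open>-1\<close> is the upper sheet of the hyperboloid in the Minkowski space \<open>'a \<times> real\<close> (the last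
  coordinate is the time coordinate), with the Riemannian metric that the Minkowski form induces
  on its tangent spaces.
\<close>

definition mink :: "'a::euclidean_space \<times> real \<Rightarrow> 'a \<times> real \<Rightarrow> real" where
  "mink p q = fst p \<bullet> fst q - snd p * snd q"

definition hyp :: "('a::euclidean_space \<times> real) set" where
  "hyp = {p. mink p p = -1 \<and> snd p > 0}"

definition tangent :: "'a::euclidean_space \<times> real \<Rightarrow> ('a \<times> real) set" where
  "tangent p = {v. mink p v = 0}"

definition hnorm :: "'a::euclidean_space \<times> real \<Rightarrow> real" where
  "hnorm v = sqrt (mink v v)"

subsection \<open>Distance, geodesics, exponential map, parallel transport\<close>

text \<open>
  Only \<open>C\<^sup>1\<close> curves are admitted: the library's piecewise \<open>C\<^sup>1\<close> curves may have an unbounded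
  derivative near a break point, in which case the length integral can be undefined.
\<close>

definition C1_curves :: "'a::euclidean_space \<times> real \<Rightarrow> 'a \<times> real \<Rightarrow> (real \<Rightarrow> 'a \<times> real) set" where
  "C1_curves x y =
     {c. c C1_differentiable_on {0..1} \<and> c ` {0..1} \<subseteq> hyp \<and> c 0 = x \<and> c 1 = y}"

definition curve_length :: "(real \<Rightarrow> 'a::euclidean_space \<times> real) \<Rightarrow> real" where
  "curve_length c = integral {0..1} (\<lambda>t. hnorm (vector_derivative c (at t)))"

definition hdist :: "'a::euclidean_space \<times> real \<Rightarrow> 'a \<times> real \<Rightarrow> real" where
  "hdist x y = (INF c \<in> C1_curves x y. curve_length c)"

text \<open>
  The covariant derivative of a vector field along a curve in the hyperboloid is the projection of
  its derivative in the ambient Minkowski space to the tangent space.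
\<close>

definition tproj :: "'a::euclidean_space \<times> real \<Rightarrow> 'a \<times> real \<Rightarrow> 'a \<times> real" where
  "tproj p u = u + mink p u *\<^sub>R p"

definition parallel_along ::
  "(real \<Rightarrow> 'a::euclidean_space \<times> real) \<Rightarrow> (real \<Rightarrow> 'a \<times> real) \<Rightarrow> bool" where
  "parallel_along c V \<longleftrightarrow> (\<forall>t. V t \<in> tangent (c t) \<and>
     (\<exists>D. (V has_vector_derivative D) (at t) \<and> tproj (c t) D = 0))"

definition geodesic_from ::
  "'a::euclidean_space \<times> real \<Rightarrow> 'a \<times> real \<Rightarrow> (real \<Rightarrow> 'a \<times> real) \<Rightarrow> bool" where
  "geodesic_from x v c \<longleftrightarrow> range c \<subseteq> hyp \<and>
     (\<exists>V. (\<forall>t. (c has_vector_derivative V t) (at t)) \<and> parallel_along c V \<and> c 0 = x \<and> V 0 = v)"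

definition hexp :: "'a::euclidean_space \<times> real \<Rightarrow> 'a \<times> real \<Rightarrow> 'a \<times> real" where
  "hexp x v = (THE p. \<exists>c. geodesic_from x v c \<and> c 1 = p)"

definition hlog :: "'a::euclidean_space \<times> real \<Rightarrow> 'a \<times> real \<Rightarrow> 'a \<times> real" where
  "hlog x y = the_inv_into (tangent x) (hexp x) y"

definition geodesic :: "'a::euclidean_space \<times> real \<Rightarrow> 'a \<times> real \<Rightarrow> real \<Rightarrow> 'a \<times> real" where
  "geodesic x y t = hexp x (t *\<^sub>R hlog x y)"

definition ptransport ::
  "'a::euclidean_space \<times> real \<Rightarrow> 'a \<times> real \<Rightarrow> 'a \<times> real \<Rightarrow> 'a \<times> real" where
  "ptransport x y v =
     (THE w. \<exists>V. parallel_along (geodesic x y) V \<and> V 0 = v \<and> V 1 = w)"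

subsection \<open>Functions on hyperbolic space\<close>

text \<open>
  Functions on hyperbolic space are functions on the ambient space of which only the values on
  \<^const>\<open>hyp\<close> matter.  In the definition of the gradient, the derivative is taken within \<^const>\<open>hyp\<close>,
  so only its restriction to the tangent space is determined; the gradient is the tangent vector
  that represents this restriction.
\<close>

definition has_hgrad ::
  "('a::euclidean_space \<times> real \<Rightarrow> real) \<Rightarrow> 'a \<times> real \<Rightarrow> 'a \<times> real \<Rightarrow> bool" where
  "has_hgrad f g x \<longleftrightarrow> g \<in> tangent x \<and> (f has_derivative (\<lambda>v. mink g v)) (at x within hyp)"

definition hgrad :: "('a::euclidean_space \<times> real \<Rightarrow> real) \<Rightarrow> 'a \<times> real \<Rightarrow> 'a \<times> real" where
  "hgrad f x = (THE g. has_hgrad f g x)"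

definition gconvex_set :: "('a::euclidean_space \<times> real) set \<Rightarrow> bool" where
  "gconvex_set D \<longleftrightarrow> D \<subseteq> hyp \<and> (\<forall>x\<in>D. \<forall>y\<in>D. \<forall>t\<in>{0..1}. geodesic x y t \<in> D)"

definition strongly_gconvex_on ::
  "real \<Rightarrow> ('a::euclidean_space \<times> real) set \<Rightarrow> ('a \<times> real \<Rightarrow> real) \<Rightarrow> bool" where
  "strongly_gconvex_on \<mu> D f \<longleftrightarrow> gconvex_set D \<and>
     (\<forall>x\<in>D. \<forall>y\<in>D. \<forall>t\<in>{0..1}.
        f (geodesic x y t) \<le> (1 - t) * f x + t * f y - \<mu> / 2 * t * (1 - t) * (hdist x y)\<^sup>2)"

definition gsmooth_on ::
  "real \<Rightarrow> ('a::euclidean_space \<times> real) set \<Rightarrow> ('a \<times> real \<Rightarrow> real) \<Rightarrow> bool" where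
  "gsmooth_on L D f \<longleftrightarrow> (\<forall>x\<in>D. \<exists>g. has_hgrad f g x) \<and>
     (\<forall>x\<in>D. \<forall>y\<in>D. hnorm (hgrad f x - ptransport y x (hgrad f y)) \<le> L * hdist x y)"

definition glipschitz_on ::
  "real \<Rightarrow> ('a::euclidean_space \<times> real) set \<Rightarrow> ('a \<times> real \<Rightarrow> real) \<Rightarrow> bool" where
  "glipschitz_on M D f \<longleftrightarrow> (\<forall>x\<in>D. \<forall>y\<in>D. \<bar>f x - f y\<bar> \<le> M * hdist x y)"

definition is_minimizer :: "('a::euclidean_space \<times> real \<Rightarrow> real) \<Rightarrow> 'a \<times> real \<Rightarrow> bool" where
  "is_minimizer f x \<longleftrightarrow> x \<in> hyp \<and> (\<forall>y\<in>hyp. f x \<le> f y)"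

definition hball :: "'a::euclidean_space \<times> real \<Rightarrow> real \<Rightarrow> ('a \<times> real) set" where
  "hball x r = {y \<in> hyp. hdist x y \<le> r}"

text \<open>The class \<open>\<F>\<^sub>r\<^sub>,\<^sub>M\<^sub>,\<^sub>0\<^sub>,\<^sub>L\<close>, for the reference point \<open>xref\<close>.\<close>

definition fclass0 ::
  "'a::euclidean_space \<times> real \<Rightarrow> real \<Rightarrow> real \<Rightarrow> real \<Rightarrow> ('a \<times> real \<Rightarrow> real) set" where
  "fclass0 xref r M L = {f. glipschitz_on M hyp f \<and> strongly_gconvex_on 0 hyp f \<and>
     gsmooth_on L hyp f \<and> (\<exists>x \<in> hball xref r. is_minimizer f x)}"

text \<open>
  \<open>C\<^sup>\<infinity>\<close> functions: the hyperboloid is the graph of \<open>u \<mapsto> sqrt (1 + \<parallel>u\<parallel>\<^sup>2)\<close>, and projecting the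
  graph to \<open>'a\<close> is a global chart of it.
\<close>

primrec C_k :: "nat \<Rightarrow> ('a::euclidean_space \<Rightarrow> real) \<Rightarrow> bool" where
  "C_k 0 h \<longleftrightarrow> continuous_on UNIV h"
| "C_k (Suc k) h \<longleftrightarrow> (\<forall>u. h differentiable (at u)) \<and>
     (\<forall>v. C_k k (\<lambda>u. frechet_derivative h (at u) v))"

definition graph_chart :: "'a::euclidean_space \<Rightarrow> 'a \<times> real" where
  "graph_chart u = (u, sqrt (1 + (norm u)\<^sup>2))"

definition C_infinity :: "('a::euclidean_space \<times> real \<Rightarrow> real) \<Rightarrow> bool" where
  "C_infinity f \<longleftrightarrow> (\<forall>k. C_k k (f \<circ> graph_chart))"

subsection \<open>Deterministic first-order algorithms\<close>

definition tangent_bundle :: "(('a::euclidean_space \<times> real) \<times> ('a \<times> real)) set" where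
  "tangent_bundle = (SIGMA x : hyp. tangent x)"

text \<open>
  An algorithm is one function on finite histories; its restriction to the histories of length \<open>k\<close>
  is the map \<open>\<A>\<^sub>k\<close>, and its value at the empty history is the initial point.
\<close>

type_synonym 'a history = "(real \<times> (('a \<times> real) \<times> ('a \<times> real))) list"

definition first_order_algorithm :: "('a::euclidean_space history \<Rightarrow> 'a \<times> real) \<Rightarrow> bool" where
  "first_order_algorithm A \<longleftrightarrow> (\<forall>h. set h \<subseteq> UNIV \<times> tangent_bundle \<longrightarrow> A h \<in> hyp)"

primrec run_history ::
  "('a::euclidean_space history \<Rightarrow> 'a \<times> real) \<Rightarrow> ('a \<times> real \<Rightarrow> real) \<Rightarrow> nat \<Rightarrow> 'a history" where
  "run_history A f 0 = []"
| "run_history A f (Suc k) = run_history A f k @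
     [let x = A (run_history A f k) in (f x, (x, hgrad f x))]"

definition iterate ::
  "('a::euclidean_space history \<Rightarrow> 'a \<times> real) \<Rightarrow> ('a \<times> real \<Rightarrow> real) \<Rightarrow> nat \<Rightarrow> 'a \<times> real" where
  "iterate A f k = A (run_history A f k)"

definition zeta :: "real \<Rightarrow> real" where
  "zeta r = r / tanh r"

section \<open>Closed formulas\<close>

text \<open>
  The definite descriptions and the infimum in the definitions above are well defined and have the
  usual closed forms on the hyperboloid: see \<open>hexp_eq_hgeo\<close>, \<open>hexp_bij_betw\<close>, \<open>hlog_eq\<close>,
  \<open>geodesic_endpoints\<close>, \<open>hdist_eq_arcosh\<close>, \<open>hdist_eq_hnorm_hlog\<close>, \<open>ptransport_eq\<close> and \<open>hgrad_eq\<close>.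
\<close>

lemma bounded_bilinear_mink: "bounded_bilinear mink"
proof -
  have "bilinear mink"
    unfolding bilinear_def
    by (intro conjI allI linearI)
       (simp_all add: mink_def inner_add_left inner_add_right distrib_left distrib_right right_diff_distrib)
  then show ?thesis by (simp add: bilinear_conv_bounded_bilinear)
qed

interpretation mink: bounded_bilinear mink
  by (rule bounded_bilinear_mink)

lemma mink_commute: "mink p q = mink q p"
  by (simp add: mink_def inner_commute mult.commute)

lemmas mink_simps = mink.add_left mink.add_right mink.diff_left mink.diff_right
  mink.scaleR_left mink.scaleR_right mink.minus_left mink.minus_right

lemma mink_self: "mink p p = (norm (fst p))\<^sup>2 - (snd p)\<^sup>2"
  by (simp add: mink_def power2_norm_eq_inner power2_eq_square[of "snd p"])

lemma tangent_mink_nonneg: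
  assumes "x \<in> hyp" "v \<in> tangent x"
  shows "mink v v \<ge> 0" "mink v v = 0 \<longleftrightarrow> v = 0"
proof -
  obtain u s where x: "x = (u, s)" by (cases x)
  obtain a t where v: "v = (a, t)" by (cases v)
  have s: "s\<^sup>2 = 1 + (norm u)\<^sup>2" "s > 0"
    using assms(1) by (auto simp: hyp_def mink_self x)
  have "u \<bullet> a = s * t"
    using assms(2) by (simp add: tangent_def mink_def x v)
  then have "(s * t)\<^sup>2 \<le> (norm u * norm a)\<^sup>2"
    by (metis Cauchy_Schwarz_ineq2 abs_ge_zero power2_abs power_mono)
  then have "s\<^sup>2 * t\<^sup>2 \<le> (s\<^sup>2 - 1) * (norm a)\<^sup>2"
    by (simp add: s power_mult_distrib)
  then have *: "(norm a)\<^sup>2 \<le> s\<^sup>2 * mink v v"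
    by (simp add: v mink_self algebra_simps)
  then have "0 \<le> s\<^sup>2 * mink v v"
    by (meson order_trans zero_le_power2)
  then show "mink v v \<ge> 0"
    using s(2) by (simp add: zero_le_mult_iff)
  have "v = 0" if "mink v v = 0"
  proof -
    have "a = 0" using * that by simp
    then show ?thesis using that by (simp add: v mink_def zero_prod_def)
  qed
  then show "mink v v = 0 \<longleftrightarrow> v = 0"
    by (auto simp: mink.zero_left)
qed

lemma hnorm_eq_0: "x \<in> hyp \<Longrightarrow> v \<in> tangent x \<Longrightarrow> hnorm v = 0 \<longleftrightarrow> v = 0"
  by (simp add: hnorm_def tangent_mink_nonneg)

lemma hnorm_square: "x \<in> hyp \<Longrightarrow> v \<in> tangent x \<Longrightarrow> (hnorm v)\<^sup>2 = mink v v"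
  by (simp add: hnorm_def tangent_mink_nonneg)

lemma hnorm_nonneg: "x \<in> hyp \<Longrightarrow> v \<in> tangent x \<Longrightarrow> hnorm v \<ge> 0"
  by (simp add: hnorm_def tangent_mink_nonneg)

lemma hnorm_scaleR: "hnorm (a *\<^sub>R v) = \<bar>a\<bar> * hnorm v"
proof -
  have "mink (a *\<^sub>R v) (a *\<^sub>R v) = a\<^sup>2 * mink v v"
    by (simp add: mink_simps power2_eq_square)
  then show ?thesis by (simp add: hnorm_def real_sqrt_mult)
qed

lemma tangent_scaleR: "v \<in> tangent x \<Longrightarrow> a *\<^sub>R v \<in> tangent x"
  by (simp add: tangent_def mink_simps)

lemma tangent_add: "v \<in> tangent x \<Longrightarrow> w \<in> tangent x \<Longrightarrow> v + w \<in> tangent x"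
  by (simp add: tangent_def mink_simps)

lemma tangent_diff: "v \<in> tangent x \<Longrightarrow> w \<in> tangent x \<Longrightarrow> v - w \<in> tangent x"
  by (simp add: tangent_def mink_simps)

lemma zero_in_tangent: "0 \<in> tangent x"
  by (simp add: tangent_def mink.zero_right)

lemma tproj_in_tangent: "x \<in> hyp \<Longrightarrow> tproj x u \<in> tangent x"
  by (simp add: tproj_def tangent_def hyp_def mink_simps)

lemma mink_hyp_le:
  assumes "x \<in> hyp" "y \<in> hyp"
  shows "mink x y \<le> -1" "mink x y = -1 \<longleftrightarrow> x = y"
proof -
  have xx: "mink x x = -1" "mink y y = -1" using assms by (auto simp: hyp_def)
  define w where "w = tproj x y"
  have w: "w \<in> tangent x" using assms tproj_in_tangent by (simp add: w_def)
  have ww: "mink w w = (mink x y)\<^sup>2 - 1"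
    by (simp add: w_def tproj_def mink_simps xx mink_commute[of y x] power2_eq_square)
  obtain u s where x: "x = (u, s)" by (cases x)
  obtain a t where y: "y = (a, t)" by (cases y)
  have s: "s\<^sup>2 = 1 + (norm u)\<^sup>2" "s > 0" "t\<^sup>2 = 1 + (norm a)\<^sup>2" "t > 0"
    using assms by (auto simp: hyp_def mink_self x y)
  have "norm u < s" "norm a < t"
    using s power2_less_imp_less[of "norm u" s] power2_less_imp_less[of "norm a" t] by auto
  then have "norm u * norm a < s * t"
    by (intro mult_strict_mono) (auto simp: s)
  moreover have "u \<bullet> a \<le> norm u * norm a" by (rule norm_cauchy_schwarz)
  ultimately have neg: "mink x y < 0" by (simp add: mink_def x y)
  have "(mink x y)\<^sup>2 \<ge> 1" using tangent_mink_nonneg(1)[OF assms(1) w] ww by simp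
  then have "\<bar>mink x y\<bar> \<ge> 1" using abs_le_square_iff[of 1 "mink x y"] by simp
  with neg show "mink x y \<le> -1" by simp
  show "mink x y = -1 \<longleftrightarrow> x = y"
  proof
    assume m: "mink x y = -1"
    then have "w = 0" using tangent_mink_nonneg(2)[OF assms(1) w] ww by simp
    then show "x = y" using m by (simp add: w_def tproj_def)
  qed (simp add: xx)
qed

lemma tangent_cauchy_schwarz:
  assumes "x \<in> hyp" "v \<in> tangent x" "w \<in> tangent x"
  shows "\<bar>mink v w\<bar> \<le> hnorm v * hnorm w"
proof (cases "w = 0")
  case True
  then show ?thesis by (simp add: mink.zero_right hnorm_def)
next
  case False
  then have pos: "mink w w > 0"
    using tangent_mink_nonneg[OF assms(1,3)] by linarith
  define z where "z = mink w w *\<^sub>R v - mink v w *\<^sub>R w"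
  have "z \<in> tangent x" unfolding z_def using assms by (intro tangent_diff tangent_scaleR)
  then have "mink z z \<ge> 0" using assms(1) tangent_mink_nonneg by blast
  moreover have "mink z z = mink w w * (mink v v * mink w w - (mink v w)\<^sup>2)"
    by (simp add: z_def mink_simps mink_commute[of w v] power2_eq_square algebra_simps)
  ultimately have "(mink v w)\<^sup>2 \<le> mink v v * mink w w"
    using pos by (simp add: zero_le_mult_iff)
  then have "sqrt ((mink v w)\<^sup>2) \<le> sqrt (mink v v * mink w w)"
    by (rule real_sqrt_le_mono)
  then show ?thesis by (simp add: hnorm_def real_sqrt_mult)
qed

definition hgeo :: "'a::euclidean_space \<times> real \<Rightarrow> 'a \<times> real \<Rightarrow> real \<Rightarrow> 'a \<times> real" where
  "hgeo x v t = cosh (t * hnorm v) *\<^sub>R x + 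
     (if hnorm v = 0 then 0 else (sinh (t * hnorm v) / hnorm v) *\<^sub>R v)"

definition hgeo' :: "'a::euclidean_space \<times> real \<Rightarrow> 'a \<times> real \<Rightarrow> real \<Rightarrow> 'a \<times> real" where
  "hgeo' x v t = (hnorm v * sinh (t * hnorm v)) *\<^sub>R x + cosh (t * hnorm v) *\<^sub>R v"

lemma hgeo_deriv:
  assumes "x \<in> hyp" "v \<in> tangent x"
  shows "(hgeo x v has_vector_derivative hgeo' x v t) (at t within S)"
    and "(hgeo' x v has_vector_derivative (mink v v) *\<^sub>R hgeo x v t) (at t within S)"
proof -
  define k where "k = hnorm v"
  have c: "((\<lambda>t. cosh (t * k)) has_field_derivative k * sinh (t * k)) (at t within S)"
    by (auto intro!: derivative_eq_intros)
  have s: "((\<lambda>t. sinh (t * k)) has_field_derivative k * cosh (t * k)) (at t within S)"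
    by (auto intro!: derivative_eq_intros)
  have s2: "((\<lambda>t. sinh (t * k) / k) has_field_derivative cosh (t * k)) (at t within S)" if "k \<noteq> 0"
    using DERIV_cdivide[OF s, of k] that by simp
  have s3: "((\<lambda>t. k * sinh (t * k)) has_field_derivative k * (k * cosh (t * k))) (at t within S)"
    by (rule DERIV_cmult[OF s])
  have kk: "mink v v = k * k" using hnorm_square[OF assms] by (simp add: k_def power2_eq_square)
  have z: "k = 0 \<longleftrightarrow> v = 0" using hnorm_eq_0[OF assms] by (simp add: k_def)
  show "(hgeo x v has_vector_derivative hgeo' x v t) (at t within S)"
  proof (cases "k = 0")
    case True
    then have "hgeo x v = (\<lambda>t. x)" "hgeo' x v t = 0"
      using z by (auto simp: hgeo_def hgeo'_def k_def)
    then show ?thesis by simp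
  next
    case False
    have *: "hgeo x v = (\<lambda>t. cosh (t * k) *\<^sub>R x + (sinh (t * k) / k) *\<^sub>R v)"
      using False by (auto simp: hgeo_def k_def)
    show ?thesis unfolding * hgeo'_def k_def[symmetric]
      by (rule derivative_eq_intros c s2[OF False] refl | simp)+
  qed
  have *: "hgeo' x v = (\<lambda>t. (k * sinh (t * k)) *\<^sub>R x + cosh (t * k) *\<^sub>R v)"
    by (auto simp: hgeo'_def k_def)
  have **: "mink v v *\<^sub>R hgeo x v t = (k * (k * cosh (t * k))) *\<^sub>R x + (k * sinh (t * k)) *\<^sub>R v"
    using z by (cases "k = 0") (auto simp: hgeo_def kk mink.zero_left k_def[symmetric] scaleR_add_right mult.commute mult.left_commute)
  show "(hgeo' x v has_vector_derivative (mink v v) *\<^sub>R hgeo x v t) (at t within S)"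
    unfolding * **
    by (rule derivative_eq_intros c s3 refl | simp)+
qed

lemma hgeo_0: "hgeo x v 0 = x" "hgeo' x v 0 = v"
  by (auto simp: hgeo_def hgeo'_def)

lemma hgeo_mink:
  assumes "x \<in> hyp" "v \<in> tangent x"
  shows "mink (hgeo x v t) (hgeo x v t) = -1" "mink (hgeo x v t) (hgeo' x v t) = 0"
    "mink (hgeo' x v t) (hgeo' x v t) = mink v v" "mink x (hgeo x v t) = - cosh (t * hnorm v)"
proof -
  have b: "mink x x = -1" "mink x v = 0" "mink v x = 0"
    using assms by (auto simp: hyp_def tangent_def mink_commute)
  have h: "mink v v = (hnorm v)\<^sup>2" using hnorm_square[OF assms] by simp
  have cs: "cosh (t * hnorm v) * cosh (t * hnorm v) = sinh (t * hnorm v) * sinh (t * hnorm v) + 1"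
    using cosh_square_eq[of "t * hnorm v"] by (simp add: power2_eq_square)
  show "mink (hgeo x v t) (hgeo x v t) = -1"
    by (simp add: hgeo_def mink_simps b h power2_eq_square mink.zero_left mink.zero_right cs)
  show "mink (hgeo x v t) (hgeo' x v t) = 0"
    by (simp add: hgeo_def hgeo'_def mink_simps b h power2_eq_square mink.zero_left mink.zero_right)
  show "mink x (hgeo x v t) = - cosh (t * hnorm v)"
    by (simp add: hgeo_def mink_simps b mink.zero_left mink.zero_right)
  have "mink (hgeo' x v t) (hgeo' x v t)
      = (hnorm v)\<^sup>2 * (cosh (t * hnorm v) * cosh (t * hnorm v) - sinh (t * hnorm v) * sinh (t * hnorm v))"
    by (simp add: hgeo'_def mink_simps b h power2_eq_square algebra_simps)
  then show "mink (hgeo' x v t) (hgeo' x v t) = mink v v" by (simp add: cs h)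
qed

lemma hgeo_in_hyp:
  assumes "x \<in> hyp" "v \<in> tangent x"
  shows "hgeo x v t \<in> hyp"
proof -
  obtain a \<tau> where v: "hgeo x v t = (a, \<tau>)" by (cases "hgeo x v t")
  obtain u s where x: "x = (u, s)" by (cases x)
  have s: "s\<^sup>2 = 1 + (norm u)\<^sup>2" "s > 0"
    using assms(1) by (auto simp: hyp_def mink_self x)
  have t: "\<tau>\<^sup>2 = 1 + (norm a)\<^sup>2"
    using hgeo_mink(1)[OF assms, of t] by (auto simp: v mink_self)
  have m: "u \<bullet> a - s * \<tau> < 0"
  proof -
    have "mink x (hgeo x v t) < 0" using hgeo_mink(4)[OF assms, of t] by simp
    then show ?thesis unfolding v by (simp add: x mink_def)
  qed
  have "\<tau> > 0"
  proof (rule ccontr)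
    assume "\<not> \<tau> > 0"
    have "norm u < s" using s power2_less_imp_less[of "norm u" s] by auto
    moreover have "norm a < - \<tau>" using t \<open>\<not> \<tau> > 0\<close> power2_less_imp_less[of "norm a" "- \<tau>"] by auto
    ultimately have "norm u * norm a \<le> s * - \<tau>" by (intro mult_mono) (use s in auto)
    moreover have "- (u \<bullet> a) \<le> norm u * norm a"
      using Cauchy_Schwarz_ineq2[of u a] by linarith
    ultimately show False using m by simp
  qed
  then show ?thesis using hgeo_mink(1)[OF assms, of t] by (simp add: hyp_def v)
qed

lemma constant_if_zero_deriv:
  fixes f :: "real \<Rightarrow> 'b::real_normed_vector"
  assumes "\<And>t. (f has_vector_derivative 0) (at t)"
  shows "f t = f 0"
proof (rule has_vector_derivative_zero_constant[OF convex_UNIV])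
  show "(f has_vector_derivative 0) (at t)" for t by (rule assms)
next
  fix c assume "\<And>x. x \<in> UNIV \<Longrightarrow> f x = c"
  then show ?thesis by simp
qed

lemma linear_ode_zero:
  fixes p :: "real \<Rightarrow> 'b::real_normed_vector"
  assumes "\<And>t. (p has_vector_derivative a *\<^sub>R p t) (at t)" "p 0 = 0"
  shows "p t = 0"
proof -
  have "((\<lambda>t. exp (- a * t) *\<^sub>R p t) has_vector_derivative 0) (at t)" for t
  proof -
    have "((\<lambda>t. exp (- a * t)) has_field_derivative - a * exp (- a * t)) (at t)"
      by (auto intro!: derivative_eq_intros)
    from has_vector_derivative_scaleR[OF this assms(1)] show ?thesis by (simp add: mult.commute)
  qed
  from constant_if_zero_deriv[OF this, of t] show ?thesis by (simp add: assms(2))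
qed

lemma geodesic_from_hgeo:
  assumes "x \<in> hyp" "v \<in> tangent x"
  shows "geodesic_from x v (hgeo x v)"
  unfolding geodesic_from_def parallel_along_def
proof (intro conjI exI[of _ "hgeo' x v"] allI)
  show "range (hgeo x v) \<subseteq> hyp" using hgeo_in_hyp[OF assms] by auto
  fix t
  show "hgeo' x v t \<in> tangent (hgeo x v t)" using hgeo_mink[OF assms] by (simp add: tangent_def)
  show "\<exists>D. (hgeo' x v has_vector_derivative D) (at t) \<and> tproj (hgeo x v t) D = 0"
    by (rule exI[of _ "mink v v *\<^sub>R hgeo x v t"])
       (simp add: hgeo_deriv(2)[OF assms] tproj_def mink_simps hgeo_mink[OF assms])
qed (simp_all add: hgeo_0 hgeo_deriv(1)[OF assms])

lemma geodesic_from_unique: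
  assumes "x \<in> hyp" "v \<in> tangent x" "geodesic_from x v c"
  shows "c = hgeo x v"
proof -
  obtain V where r: "range c \<subseteq> hyp" and V: "\<And>t. (c has_vector_derivative V t) (at t)"
    and p: "parallel_along c V" and i: "c 0 = x" "V 0 = v"
    using assms(3) by (auto simp: geodesic_from_def)
  obtain D where D: "\<And>t. (V has_vector_derivative D t) (at t)" "\<And>t. tproj (c t) (D t) = 0"
    and tan: "\<And>t. mink (c t) (V t) = 0"
  proof -
    have "\<forall>t. \<exists>D. (V has_vector_derivative D) (at t) \<and> tproj (c t) D = 0"
      using p by (simp add: parallel_along_def)
    then obtain D where "\<forall>t. (V has_vector_derivative D t) (at t) \<and> tproj (c t) (D t) = 0"
      by (rule choice[THEN exE])
    moreover have "\<And>t. mink (c t) (V t) = 0" using p by (simp add: parallel_along_def tangent_def)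
    ultimately show ?thesis using that by blast
  qed
  have cV: "mink (c t) (D t) + mink (V t) (V t) = 0" for t
  proof -
    have "((\<lambda>t. mink (c t) (V t)) has_vector_derivative mink (c t) (D t) + mink (V t) (V t)) (at t)"
      by (rule mink.has_vector_derivative[OF V D(1)])
    moreover have "((\<lambda>t. mink (c t) (V t)) has_vector_derivative 0) (at t)"
      by (simp add: tan)
    ultimately show ?thesis by (rule vector_derivative_unique_at)
  qed
  have Dt: "D t = mink (V t) (V t) *\<^sub>R c t" for t
  proof -
    have "D t = - (mink (c t) (D t) *\<^sub>R c t)"
      using D(2)[of t] by (simp add: tproj_def eq_neg_iff_add_eq_0)
    moreover have "mink (c t) (D t) = - mink (V t) (V t)" using cV[of t] by simp
    ultimately show ?thesis by simp
  qed
  have V2': "((\<lambda>t. mink (V t) (V t)) has_vector_derivative 0) (at t)" for t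
    using mink.has_vector_derivative[OF D(1) D(1), of t] tan[of t]
    by (simp add: Dt mink_simps mink_commute[of _ "c t"])
  have k: "mink (V t) (V t) = (hnorm v)\<^sup>2" "mink v v = (hnorm v)\<^sup>2" for t
    using constant_if_zero_deriv[OF V2', of t] i(2) hnorm_square[OF assms(1,2)] by simp_all
  define k where "k = hnorm v"
  define w where "w = (\<lambda>t. c t - hgeo x v t)"
  define u where "u = (\<lambda>t. V t - hgeo' x v t)"
  have w': "(w has_vector_derivative u t) (at t)" for t
    unfolding w_def u_def by (intro has_vector_derivative_diff V hgeo_deriv assms)
  have u': "(u has_vector_derivative k\<^sup>2 *\<^sub>R w t) (at t)" for t
    using has_vector_derivative_diff[OF D(1)[of t] hgeo_deriv(2)[OF assms(1,2), where t = t and S = UNIV]]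
    by (simp add: u_def w_def Dt k k_def scaleR_diff_right)
  have "u t + k *\<^sub>R w t = 0" for t
  proof (rule linear_ode_zero)
    show "u 0 + k *\<^sub>R w 0 = 0" by (simp add: u_def w_def i hgeo_0)
    show "((\<lambda>t. u t + k *\<^sub>R w t) has_vector_derivative k *\<^sub>R (u t + k *\<^sub>R w t)) (at t)" for t
      using has_vector_derivative_add[OF u'
          has_vector_derivative_scaleR[OF DERIV_const[of k] w']]
      by (simp add: power2_eq_square scaleR_add_right add.commute)
  qed
  then have "u t = (- k) *\<^sub>R w t" for t
    by (simp add: eq_neg_iff_add_eq_0)
  then have "(w has_vector_derivative (- k) *\<^sub>R w t) (at t)" for t
    using w'[of t] by simp
  then have "w t = 0" for t
    by (rule linear_ode_zero) (simp add: w_def i hgeo_0)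
  then show ?thesis by (auto simp: w_def)
qed

lemma hexp_eq_hgeo:
  assumes "x \<in> hyp" "v \<in> tangent x"
  shows "hexp x v = hgeo x v 1"
  unfolding hexp_def
proof (rule the_equality)
  show "\<exists>c. geodesic_from x v c \<and> c 1 = hgeo x v 1"
    using geodesic_from_hgeo[OF assms] by blast
next
  fix p assume "\<exists>c. geodesic_from x v c \<and> c 1 = p"
  then obtain c where "geodesic_from x v c" "c 1 = p" by blast
  then show "p = hgeo x v 1" using geodesic_from_unique[OF assms] by simp
qed

lemma hnorm_zero [simp]: "hnorm 0 = 0"
  by (simp add: hnorm_def mink.zero_left)

lemma hgeo_scaleR: "hgeo x (a *\<^sub>R v) t = hgeo x v (a * t)"
proof (cases "a = 0 \<or> hnorm v = 0")
  case True
  then show ?thesis by (auto simp: hgeo_def hnorm_scaleR)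
next
  case False
  define q where "q = a * t * hnorm v"
  have "cosh (t * (\<bar>a\<bar> * hnorm v)) = cosh q"
    "sinh (t * (\<bar>a\<bar> * hnorm v)) / (\<bar>a\<bar> * hnorm v) * a = sinh q / hnorm v"
  proof -
    have q: "t * (\<bar>a\<bar> * hnorm v) = (if a < 0 then - q else q)"
      by (simp add: q_def)
    show "cosh (t * (\<bar>a\<bar> * hnorm v)) = cosh q" unfolding q by simp
    show "sinh (t * (\<bar>a\<bar> * hnorm v)) / (\<bar>a\<bar> * hnorm v) * a = sinh q / hnorm v"
      unfolding q using False by (cases "a < 0") (simp_all add: field_simps)
  qed
  then show ?thesis using False by (simp add: hgeo_def hnorm_scaleR q_def[symmetric])
qed

definition hlogf :: "'a::euclidean_space \<times> real \<Rightarrow> 'a \<times> real \<Rightarrow> 'a \<times> real" where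
  "hlogf x y = (let \<delta> = arcosh (- mink x y) in (\<delta> / sinh \<delta>) *\<^sub>R tproj x y)"

lemma hlogf:
  assumes "x \<in> hyp" "y \<in> hyp"
  shows "hlogf x y \<in> tangent x" "hnorm (hlogf x y) = arcosh (- mink x y)" "hexp x (hlogf x y) = y"
proof -
  define m where "m = - mink x y"
  define \<delta> where "\<delta> = arcosh m"
  define w where "w = tproj x y"
  have m: "m \<ge> 1" using mink_hyp_le(1)[OF assms] by (simp add: m_def)
  have d: "cosh \<delta> = m" "\<delta> \<ge> 0" using m by (simp_all add: \<delta>_def)
  have xx: "mink x x = -1" "mink y y = -1" using assms by (auto simp: hyp_def)
  have w: "w \<in> tangent x" using assms tproj_in_tangent by (simp add: w_def)
  have ww: "mink w w = m\<^sup>2 - 1"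
    by (simp add: w_def m_def tproj_def mink_simps xx mink_commute[of y x] power2_eq_square)
  have nw: "hnorm w = sinh \<delta>"
    using ww m by (simp add: hnorm_def \<delta>_def sinh_arcosh_real)
  have y: "y = w + m *\<^sub>R x" by (simp add: w_def tproj_def m_def)
  have e: "hlogf x y = (\<delta> / sinh \<delta>) *\<^sub>R w"
    by (simp add: hlogf_def Let_def w_def \<delta>_def m_def)
  show t: "hlogf x y \<in> tangent x" unfolding e by (rule tangent_scaleR[OF w])
  have n: "hnorm (hlogf x y) = \<delta>"
    using d(2) by (cases "\<delta> = 0") (simp_all add: e hnorm_scaleR nw mink.zero_left hnorm_def[of 0])
  then show "hnorm (hlogf x y) = arcosh (- mink x y)" by (simp add: \<delta>_def m_def)
  show "hexp x (hlogf x y) = y"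
  proof (cases "\<delta> = 0")
    case True
    then have "w = 0" using hnorm_eq_0[OF assms(1) w] nw by simp
    then have "x = y" using True d y by simp
    moreover have "hexp x (hlogf x y) = x"
      using True by (simp add: hexp_eq_hgeo[OF assms(1) t] hgeo_def n)
    ultimately show ?thesis by simp
  next
    case False
    then have "hexp x (hlogf x y) = cosh \<delta> *\<^sub>R x + (sinh \<delta> / \<delta>) *\<^sub>R hlogf x y"
      by (simp add: hexp_eq_hgeo[OF assms(1) t] hgeo_def n)
    also have "\<dots> = m *\<^sub>R x + w" using False by (simp add: e d)
    also have "\<dots> = y" using y by simp
    finally show ?thesis .
  qed
qed

lemma hlogf_hexp:
  assumes "x \<in> hyp" "v \<in> tangent x"
  shows "hlogf x (hexp x v) = v"
proof -
  define k where "k = hnorm v"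
  have k: "k \<ge> 0" using hnorm_nonneg[OF assms] by (simp add: k_def)
  have z: "k = 0 \<longleftrightarrow> v = 0" using hnorm_eq_0[OF assms] by (simp add: k_def)
  have b: "mink x (hgeo x v 1) = - cosh k" using hgeo_mink(4)[OF assms, of 1] by (simp add: k_def)
  have "hlogf x (hexp x v) = (k / sinh k) *\<^sub>R (hgeo x v 1 - cosh k *\<^sub>R x)"
    by (simp add: hlogf_def hexp_eq_hgeo[OF assms] b arcosh_cosh_real k tproj_def Let_def)
  also have "\<dots> = v" using z by (simp add: hgeo_def k_def)
  finally show ?thesis .
qed

lemma hexp_in_hyp: "x \<in> hyp \<Longrightarrow> v \<in> tangent x \<Longrightarrow> hexp x v \<in> hyp"
  by (simp add: hexp_eq_hgeo hgeo_in_hyp)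

lemma hexp_bij_betw: "x \<in> hyp \<Longrightarrow> bij_betw (hexp x) (tangent x) hyp"
  by (rule bij_betw_byWitness[where f' = "hlogf x"])
     (simp_all add: hlogf_hexp hlogf hexp_in_hyp image_subset_iff)

lemma hlog_eq:
  assumes "x \<in> hyp" "y \<in> hyp"
  shows "hlog x y = hlogf x y"
  unfolding hlog_def
proof (rule the_inv_into_f_eq)
  show "inj_on (hexp x) (tangent x)" using hexp_bij_betw[OF assms(1)] by (simp add: bij_betw_def)
qed (rule hlogf[OF assms])+

lemma geodesic_eq_hgeo:
  assumes "x \<in> hyp" "y \<in> hyp"
  shows "geodesic x y = hgeo x (hlog x y)"
  using assms by (auto simp: geodesic_def fun_eq_iff hexp_eq_hgeo hlog_eq hlogf tangent_scaleR hgeo_scaleR)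

lemma geodesic_endpoints:
  assumes "x \<in> hyp" "y \<in> hyp"
  shows "geodesic_from x (hlog x y) (geodesic x y)" "geodesic x y 0 = x" "geodesic x y 1 = y"
proof -
  show "geodesic_from x (hlog x y) (geodesic x y)"
    using assms by (simp add: geodesic_eq_hgeo hlog_eq hlogf geodesic_from_hgeo)
  show "geodesic x y 0 = x" using assms by (simp add: geodesic_eq_hgeo hgeo_0)
  show "geodesic x y 1 = y" using assms by (simp add: geodesic_def hlog_eq hlogf)
qed

lemma gconvex_set_hyp: "gconvex_set hyp"
  by (auto simp: gconvex_set_def geodesic_eq_hgeo hgeo_in_hyp hlog_eq hlogf)

lemma continuous_on_mink:
  "continuous_on S f \<Longrightarrow> continuous_on S g \<Longrightarrow> continuous_on S (\<lambda>t. mink (f t) (g t))"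
  by (rule mink.continuous_on)

lemma curve_length_ge:
  assumes x: "x \<in> hyp" and y: "y \<in> hyp" and c: "c \<in> C1_curves x y"
  shows "arcosh (- mink x y) \<le> curve_length c"
proof -
  obtain D where D: "\<And>t. t \<in> {0..1} \<Longrightarrow> (c has_vector_derivative D t) (at t)"
    and contD: "continuous_on {0..1} D"
    and inh: "\<And>t. t \<in> {0..1} \<Longrightarrow> c t \<in> hyp" and c01: "c 0 = x" "c 1 = y"
    using c unfolding C1_curves_def C1_differentiable_on_def by blast
  define n where "n = (\<lambda>t. hnorm (D t))"
  define h where "h = (\<lambda>t. - mink x (c t))"
  have D': "(c has_vector_derivative D t) (at t within {0..1})" if "t \<in> {0..1}" for t
    using D[OF that] by (rule has_vector_derivative_at_within)
  have tan: "D t \<in> tangent (c t)" if t: "t \<in> {0..1}" for t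
  proof -
    have "((\<lambda>t. mink (c t) (c t)) has_vector_derivative mink (c t) (D t) + mink (D t) (c t))
        (at t within {0..1})"
      by (rule mink.has_vector_derivative[OF D'[OF t] D'[OF t]])
    moreover have "((\<lambda>t. mink (c t) (c t)) has_vector_derivative 0) (at t within {0..1})"
      by (rule has_vector_derivative_transform[where f = "\<lambda>_. - 1"])
         (use t inh in \<open>auto simp: hyp_def\<close>)
    moreover have "at t within {0..1} \<noteq> bot"
      using t by (simp add: trivial_limit_within islimpt_Icc)
    ultimately have "mink (c t) (D t) + mink (D t) (c t) = 0"
      using vector_derivative_unique_within by blast
    then show ?thesis by (simp add: tangent_def mink_commute[of "D t"])
  qed
  have h1: "h t \<ge> 1" if "t \<in> {0..1}" for t
    using mink_hyp_le(1)[OF x inh[OF that]] by (simp add: h_def)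
  have h': "(h has_real_derivative - mink x (D t)) (at t within {0..1})" if t: "t \<in> {0..1}" for t
    unfolding has_real_derivative_iff_has_vector_derivative h_def
    by (intro has_vector_derivative_minus bounded_linear.has_vector_derivative[OF mink.bounded_linear_right] D'[OF t])
  have bound: "\<bar>mink x (D t)\<bar> \<le> sqrt ((h t)\<^sup>2 - 1) * n t" if t: "t \<in> {0..1}" for t
  proof -
    define w where "w = tproj (c t) x"
    have w: "w \<in> tangent (c t)" using inh[OF t] by (simp add: w_def tproj_in_tangent)
    have 1: "mink (c t) (c t) = -1" "mink x x = -1" "mink (c t) (D t) = 0"
      using inh[OF t] x tan[OF t] by (auto simp: hyp_def tangent_def)
    have "mink w (D t) = mink x (D t)" by (simp add: w_def tproj_def mink_simps 1)
    moreover have "mink w w = (h t)\<^sup>2 - 1"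
      by (simp add: w_def tproj_def mink_simps 1 h_def mink_commute[of "c t" x] power2_eq_square)
    ultimately show ?thesis
      using tangent_cauchy_schwarz[OF inh[OF t] w tan[OF t]] by (simp add: n_def hnorm_def[of w])
  qed
  have "continuous_on {0..1} n"
    unfolding n_def hnorm_def by (intro continuous_on_real_sqrt continuous_on_mink contD)
  then have ni: "n integrable_on {0..1}" by (rule integrable_continuous_interval)
  have len: "curve_length c = integral {0..1} n"
    unfolding curve_length_def
    by (rule integral_cong) (use vector_derivative_at[OF D] in \<open>simp add: n_def\<close>)
  have npos: "n t \<ge> 0" if "t \<in> {0..1}" for t
    using hnorm_nonneg[OF inh[OF that] tan[OF that]] by (simp add: n_def)
  have ineq: "arcosh (h 1 + e) - arcosh (h 0 + e) \<le> integral {0..1} n" if e: "e > 0" for e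
  proof -
    define F' where "F' = (\<lambda>t. - mink x (D t) / sqrt ((h t + e)\<^sup>2 - 1))"
    have pos: "sqrt ((h t + e)\<^sup>2 - 1) > 0" if "t \<in> {0..1}" for t
    proof -
      have "1\<^sup>2 < (h t + e)\<^sup>2" by (rule power_strict_mono) (use h1[OF that] e in auto)
      then show ?thesis by simp
    qed
    have "((\<lambda>t. arcosh (h t + e)) has_vector_derivative F' t) (at t within {0..1})" if t: "t \<in> {0..1}" for t
    proof -
      have "((\<lambda>t. h t + e) has_real_derivative - mink x (D t)) (at t within {0..1})"
        using DERIV_add[OF h'[OF t] DERIV_const[of e]] by simp
      moreover have "(arcosh has_real_derivative 1 / sqrt ((h t + e)\<^sup>2 - 1)) (at (h t + e))"
        by (rule arcosh_real_has_field_derivative) (use h1[OF t] e in simp)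
      ultimately have "((\<lambda>t. arcosh (h t + e)) has_real_derivative
          1 / sqrt ((h t + e)\<^sup>2 - 1) * - mink x (D t)) (at t within {0..1})"
        by (rule DERIV_chain2[rotated])
      then show ?thesis by (simp add: has_real_derivative_iff_has_vector_derivative F'_def)
    qed
    then have "(F' has_integral arcosh (h 1 + e) - arcosh (h 0 + e)) {0..1}"
      by (intro fundamental_theorem_of_calculus) auto
    then show ?thesis
    proof (rule has_integral_le[OF _ integrable_integral[OF ni]])
      fix t :: real assume t: "t \<in> {0..1}"
      have "(h t)\<^sup>2 \<le> (h t + e)\<^sup>2" by (rule power_mono) (use h1[OF t] e in auto)
      then have "sqrt ((h t)\<^sup>2 - 1) * n t \<le> sqrt ((h t + e)\<^sup>2 - 1) * n t"
        by (intro mult_right_mono npos[OF t]) simp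
      then have "- mink x (D t) \<le> sqrt ((h t + e)\<^sup>2 - 1) * n t"
        using bound[OF t] by linarith
      then show "F' t \<le> n t" unfolding F'_def by (subst pos_divide_le_eq[OF pos[OF t]]) (simp add: mult.commute)
    qed
  qed
  have "continuous_on {0..} (\<lambda>e. arcosh (h 1 + e) - arcosh (h 0 + e))"
    using h1[of 0] h1[of 1] by (intro continuous_intros) auto
  then have "((\<lambda>e. arcosh (h 1 + e) - arcosh (h 0 + e)) \<longlongrightarrow> arcosh (h 1 + 0) - arcosh (h 0 + 0))
      (at 0 within {0..})"
    unfolding continuous_on_def by (rule bspec) simp
  then have "((\<lambda>e. arcosh (h 1 + e) - arcosh (h 0 + e)) \<longlongrightarrow> arcosh (h 1 + 0) - arcosh (h 0 + 0))
      (at_right 0)"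
    by (rule tendsto_within_subset) auto
  then have "arcosh (h 1 + 0) - arcosh (h 0 + 0) \<le> integral {0..1} n"
    by (rule tendsto_upperbound) (use ineq in \<open>auto simp: eventually_at_filter\<close>)
  moreover have "h 0 = 1" using x by (simp add: h_def c01 hyp_def)
  ultimately show ?thesis by (simp add: len h_def c01)
qed

lemma hdist_eq_arcosh:
  assumes "x \<in> hyp" "y \<in> hyp"
  shows "hdist x y = arcosh (- mink x y)"
proof -
  define v where "v = hlog x y"
  have v: "v \<in> tangent x" "hnorm v = arcosh (- mink x y)"
    using assms by (simp_all add: v_def hlog_eq hlogf)
  have d: "(hgeo x v has_vector_derivative hgeo' x v t) (at t)" for t
    using hgeo_deriv(1)[OF assms(1) v(1)] .
  have "continuous_on {0..1} (hgeo' x v)"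
    by (rule continuous_on_vector_derivative) (rule hgeo_deriv(2)[OF assms(1) v(1)])
  then have "hgeo x v C1_differentiable_on {0..1}"
    unfolding C1_differentiable_on_def using d by (intro exI[of _ "hgeo' x v"]) simp
  moreover have "hgeo x v 0 = x" "hgeo x v 1 = y"
    using geodesic_endpoints[OF assms] by (simp_all add: v_def geodesic_eq_hgeo assms)
  ultimately have c: "hgeo x v \<in> C1_curves x y"
    using hgeo_in_hyp[OF assms(1) v(1)] by (simp add: C1_curves_def image_subset_iff)
  have "hnorm (vector_derivative (hgeo x v) (at t)) = hnorm v" for t
    by (simp add: vector_derivative_at[OF d] hnorm_def hgeo_mink(3)[OF assms(1) v(1)])
  then have l: "curve_length (hgeo x v) = arcosh (- mink x y)" by (simp add: curve_length_def v)
  show ?thesis unfolding hdist_def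
  proof (rule antisym)
    have "bdd_below (curve_length ` C1_curves x y)"
      by (rule bdd_belowI2) (rule curve_length_ge[OF assms])
    from cINF_lower[OF this c] show "(INF c\<in>C1_curves x y. curve_length c) \<le> arcosh (- mink x y)"
      by (simp add: l)
    show "arcosh (- mink x y) \<le> (INF c\<in>C1_curves x y. curve_length c)"
      by (rule cINF_greatest) (use c in blast, rule curve_length_ge[OF assms])
  qed
qed

lemma hdist_eq_hnorm_hlog: "x \<in> hyp \<Longrightarrow> y \<in> hyp \<Longrightarrow> hdist x y = hnorm (hlog x y)"
  by (simp add: hdist_eq_arcosh hlog_eq hlogf)

lemma parallel_along_unique:
  assumes "range c \<subseteq> hyp" "parallel_along c V" "parallel_along c W" "V 0 = W 0"
  shows "V t = W t"
proof -
  define U where "U = (\<lambda>t. V t - W t)"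
  have tan: "U t \<in> tangent (c t)" for t
    using assms(2,3) by (simp add: U_def parallel_along_def tangent_diff)
  have "((\<lambda>t. mink (U t) (U t)) has_vector_derivative 0) (at t)" for t
  proof -
    obtain D E where D: "(V has_vector_derivative D) (at t)" "tproj (c t) D = 0"
      and E: "(W has_vector_derivative E) (at t)" "tproj (c t) E = 0"
      using assms(2,3) unfolding parallel_along_def by blast
    have d: "(U has_vector_derivative D - E) (at t)"
      unfolding U_def by (rule has_vector_derivative_diff[OF D(1) E(1)])
    define a where "a = mink (c t) E - mink (c t) D"
    have "D - E = tproj (c t) D - tproj (c t) E + a *\<^sub>R c t"
      by (simp add: tproj_def scaleR_diff_left a_def)
    then have "D - E = a *\<^sub>R c t"
      using D(2) E(2) by simp
    then show ?thesis
      using mink.has_vector_derivative[OF d d] tan[of t]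
      by (simp add: mink_simps tangent_def mink_commute[of _ "c t"])
  qed
  from constant_if_zero_deriv[OF this, of t] have "mink (U t) (U t) = 0"
    using assms(4) by (simp add: U_def mink.zero_left)
  then have "U t = 0" using tangent_mink_nonneg(2)[OF _ tan[of t]] assms(1) by blast
  then show ?thesis by (simp add: U_def)
qed

lemma ptransport_eq:
  assumes "x \<in> hyp" "y \<in> hyp" "v \<in> tangent x"
  shows "ptransport x y v = v + (mink y v / (1 - mink x y)) *\<^sub>R (x + y)"
proof -
  define u where "u = hlog x y"
  have u: "u \<in> tangent x" using assms by (simp add: u_def hlog_eq hlogf)
  define k where "k = hnorm u"
  have g: "geodesic x y = hgeo x u" using assms by (simp add: geodesic_eq_hgeo u_def)
  have y: "y = hgeo x u 1" using geodesic_endpoints(3)[OF assms(1,2)] by (simp add: g)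
  have xv: "mink x v = 0" "mink x u = 0" using assms(3) u by (auto simp: tangent_def)
  have kk: "mink u u = k\<^sup>2" using hnorm_square[OF assms(1) u] by (simp add: k_def)
  have z: "k = 0 \<longleftrightarrow> u = 0" using hnorm_eq_0[OF assms(1) u] by (simp add: k_def)
  define b where "b = mink u v"
  define V where "V = (\<lambda>t. v + (b / k\<^sup>2) *\<^sub>R (hgeo' x u t - u))"
  have "parallel_along (hgeo x u) V"
    unfolding parallel_along_def
  proof (intro allI conjI exI[of _ "b *\<^sub>R hgeo x u _"])
    fix t
    have 1: "mink (hgeo x u t) v = (if k = 0 then 0 else sinh (t * k) / k * b)"
      by (simp add: hgeo_def k_def[symmetric] mink_simps xv b_def mink.zero_left)
    have 2: "mink (hgeo x u t) u = k * sinh (t * k)"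
      using z by (cases "k = 0")
        (simp_all add: hgeo_def k_def[symmetric] mink_simps xv kk mink.zero_left mink.zero_right power2_eq_square)
    show "V t \<in> tangent (hgeo x u t)"
      by (cases "k = 0")
        (simp_all add: V_def tangent_def mink_simps 1 2 hgeo_mink(2)[OF assms(1) u] power2_eq_square)
    have "(V has_vector_derivative 0 + (b / k\<^sup>2) *\<^sub>R (mink u u *\<^sub>R hgeo x u t - 0)) (at t)"
      unfolding V_def
      by (intro has_vector_derivative_add has_vector_derivative_const has_vector_derivative_diff
            bounded_linear.has_vector_derivative[OF bounded_linear_scaleR_right]
            hgeo_deriv(2)[OF assms(1) u])
    moreover have "b = b / k\<^sup>2 * mink u u"
      using z by (cases "k = 0") (simp_all add: kk b_def mink.zero_left)
    ultimately show "(V has_vector_derivative b *\<^sub>R hgeo x u t) (at t)" by simp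
    show "tproj (hgeo x u t) (b *\<^sub>R hgeo x u t) = 0"
      by (simp add: tproj_def mink_simps hgeo_mink(1)[OF assms(1) u])
  qed
  moreover have "V 0 = v" by (simp add: V_def hgeo_0)
  moreover have "range (hgeo x u) \<subseteq> hyp" using hgeo_in_hyp[OF assms(1) u] by auto
  ultimately have "ptransport x y v = V 1"
  proof -
    assume p: "parallel_along (hgeo x u) V" "V 0 = v" "range (hgeo x u) \<subseteq> hyp"
    show "ptransport x y v = V 1"
      unfolding ptransport_def g
    proof (rule the_equality)
      show "\<exists>W. parallel_along (hgeo x u) W \<and> W 0 = v \<and> W 1 = V 1" using p by blast
    next
      fix w assume "\<exists>W. parallel_along (hgeo x u) W \<and> W 0 = v \<and> W 1 = w"
      then obtain W where W: "parallel_along (hgeo x u) W" "W 0 = v" "W 1 = w" by blast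
      show "w = V 1" using parallel_along_unique[OF p(3) W(1) p(1), of 1] W p by simp
    qed
  qed
  also have "V 1 = v + (mink y v / (1 - mink x y)) *\<^sub>R (x + y)"
  proof (cases "k = 0")
    case True
    then have "y = x" using y z by (simp add: hgeo_def mink.zero_left hnorm_def)
    then show ?thesis using True by (simp add: V_def xv)
  next
    case False
    define s ch where "s = sinh k" and "ch = cosh k"
    have "ch > 0" by (simp add: ch_def)
    then have ch: "1 + ch \<noteq> 0" by simp
    have sq: "s * s = (ch - 1) * (1 + ch)"
      using cosh_square_eq[of k] by (simp add: s_def ch_def power2_eq_square algebra_simps)
    have y': "y = ch *\<^sub>R x + (s / k) *\<^sub>R u"
      using False by (simp add: y hgeo_def k_def[symmetric] s_def ch_def)
    have m: "mink y v = s / k * b" "1 - mink x y = 1 + ch"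
      using assms(1) by (simp_all add: y' mink_simps xv b_def hyp_def)
    have "(mink y v / (1 - mink x y)) *\<^sub>R (x + y)
        = ((s / k * b) / (1 + ch) * (1 + ch)) *\<^sub>R x + ((s / k * b) / (1 + ch) * (s / k)) *\<^sub>R u"
      unfolding m by (simp add: y' scaleR_add_right scaleR_add_left distrib_left)
    also have "(s / k * b) / (1 + ch) * (1 + ch) = b / k\<^sup>2 * (k * s)"
      using False ch by (simp add: power2_eq_square)
    also have "(s / k * b) / (1 + ch) * (s / k) = (b / k\<^sup>2) * (s * s / (1 + ch))"
      by (simp add: power2_eq_square mult_ac)
    also have "s * s / (1 + ch) = ch - 1" using ch by (simp add: sq)
    finally show ?thesis
      by (simp add: V_def hgeo'_def k_def[symmetric] s_def[symmetric] ch_def[symmetric]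
          scaleR_add_right scaleR_diff_right scaleR_diff_left right_diff_distrib)
  qed
  finally show ?thesis .
qed

lemma has_hgrad_unique:
  assumes "x \<in> hyp" "has_hgrad f g x" "has_hgrad f g' x"
  shows "g = g'"
proof -
  have tan: "g \<in> tangent x" "g' \<in> tangent x" using assms by (auto simp: has_hgrad_def)
  define v where "v = g - g'"
  have v: "v \<in> tangent x" using tan by (simp add: v_def tangent_diff)
  have *: "((f \<circ> hgeo x v) has_vector_derivative mink e v) (at 0)" if "has_hgrad f e x" for e
  proof -
    have "(f has_derivative mink e) (at (hgeo x v 0) within range (hgeo x v))"
      using that hgeo_in_hyp[OF assms(1) v]
      by (auto simp: has_hgrad_def hgeo_0 intro: has_derivative_subset)
    from has_derivative_in_compose[OF hgeo_deriv(1)[OF assms(1) v, of 0 UNIV,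
        unfolded has_vector_derivative_def hgeo_0] this]
    have "((\<lambda>t. f (hgeo x v t)) has_derivative (\<lambda>t. mink e (t *\<^sub>R v))) (at 0)" .
    then show ?thesis by (simp add: has_vector_derivative_def mink_simps o_def)
  qed
  have "mink g v = mink g' v"
    using vector_derivative_unique_at[OF *[OF assms(2)] *[OF assms(3)]] .
  then have "mink v v = 0" by (simp add: v_def mink_simps)
  then have "v = 0" using tangent_mink_nonneg(2)[OF assms(1) v] by simp
  then show ?thesis by (simp add: v_def)
qed

lemma hgrad_eq: "x \<in> hyp \<Longrightarrow> has_hgrad f g x \<Longrightarrow> hgrad f x = g"
  unfolding hgrad_def by (rule the_equality) (auto dest: has_hgrad_unique)

end

theory Submission
  imports Defs
begin

text \<open>
  The hidden minimizer is one of the points \<open>pt s\<close>, \<open>s \<in> [0, 1]\<close>, of a horocycle at depth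
  about \<open>R = r / 2\<close> below \<open>xref\<close>.  The potential of \<open>s\<close> is a multiple of \<open>phi + 8 nu s\<close>, where \<open>nu s\<close> behaves
  like the distance to \<open>pt s\<close> and \<open>phi\<close> is a radial function, independent of \<open>s\<close>, with small but
  positive Hessian everywhere.

  Seen from a query \<open>x\<close> with horizontal coordinate \<open>foot x\<close>, two points \<open>pt s\<close> and \<open>pt t\<close> look alike up to a
  factor \<open>|s - t| / |s - foot x|\<close>.  So the adversary answers each query by shrinking the interval of
  candidates by a factor \<open>\<kappa>\<close>, polynomially small in \<open>r\<close>, away from \<open>foot x\<close>, and it answers according to one
  parameter \<open>s\<^sub>k\<close> of the new interval.  A function that is consistent with all the answers is obtained by
  blending: \<open>chi p\<close> has value \<open>1\<close> and gradient \<open>0\<close> at \<open>p\<close>, so \<open>chi p \<cdot> nu s\<^sub>k + (1 - chi p) \<cdot> h\<close> has the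
  first-order data of \<open>nu s\<^sub>k\<close> at \<open>p\<close>, for every \<open>h\<close>.  The blended functions differ from \<open>nu s\<close> by
  \<open>C\<^sup>2\<close>-small terms, which the Hessian of \<open>phi\<close> absorbs.  After \<open>T\<close> queries the interval still has
  length \<open>\<kappa> ^ T \<ge> exp (- R / 2)\<close>, and this keeps all queries at distance about \<open>R / 2\<close> from the minimizer.
\<close>

section \<open>Smooth functions in the graph chart\<close>

text \<open>The obstacle is that the function must be Lipschitz on the whole space: along a ray its
  second derivative has to be integrable, so no uniform convexity is available to absorb the
  blending errors. The radial Hessian of \<open>phi\<close> is of order \<open>E / R\<close>, where
  \<open>E\<close> behaves like \<open>exp (- dist / R)\<close>: this is integrable along rays, and
  still only polynomially small in \<open>r\<close> at distances of order \<open>R\<close>. Hence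
  every error must be shown to be proportional to \<open>E\<close>, and then a polynomially small
  factor suffices. This is why \<kappa> is a power of \<open>1 / r\<close>: each query costs about
  \<open>ln r\<close> in the logarithm of the interval length, a total loss of \<open>R / 2\<close>
  is affordable, and \<open>T\<close> of order \<open>r / ln r\<close> results. The minimizer is
  never computed; \<open>pt s\<close> serves only as a competitor. Up to additive constants, 256
  times the potential is at most \<open>3 * R\<close> at \<open>pt s\<close>, at least
  \<open>5 * R\<close> at the queries, and at least \<open>4 * R\<close> beyond distance
  \<open>2 * R = r\<close> from \<open>xref\<close>, which confines a minimizer to the required
  ball.\<close>

lemma C_k_SucI:
  assumes "\<And>u. (h has_derivative D u) (at u)" "\<And>v. C_k k (\<lambda>u. D u v)"
  shows "C_k (Suc k) h"
proof -
  have "frechet_derivative h (at u) = D u" for u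
    using frechet_derivative_at[OF assms(1)] by simp
  then show ?thesis
    using assms by (auto simp: differentiable_def)
qed

lemma C_k_SucE:
  assumes "C_k (Suc k) h"
  obtains D where "\<And>u. (h has_derivative D u) (at u)" "\<And>v. C_k k (\<lambda>u. D u v)"
proof
  show "(h has_derivative frechet_derivative h (at u)) (at u)" for u
    using assms by (simp add: frechet_derivative_works[symmetric])
  show "C_k k (\<lambda>u. frechet_derivative h (at u) v)" for v
    using assms by simp
qed

lemma C_k_continuous: "C_k k h \<Longrightarrow> continuous_on UNIV h"
  by (cases k) (auto simp: continuous_on_eq_continuous_at differentiable_imp_continuous_within)

lemma C_k_SucD: "C_k (Suc k) h \<Longrightarrow> C_k k h"
proof (induction k arbitrary: h)
  case 0
  then show ?case by (simp add: C_k_continuous[of "Suc 0"])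
next
  case (Suc k)
  from Suc.prems obtain D where "\<And>u. (h has_derivative D u) (at u)" "\<And>v. C_k (Suc k) (\<lambda>u. D u v)"
    by (rule C_k_SucE) blast
  with Suc.IH show ?case by (blast intro: C_k_SucI)
qed

lemma C_k_const: "C_k k (\<lambda>u. c)"
  by (induction k arbitrary: c) (auto intro: C_k_SucI)

lemma C_k_bounded_linear:
  assumes "bounded_linear h"
  shows "C_k k h"
proof (cases k)
  case 0
  then show ?thesis
    using assms by (simp add: linear_continuous_on)
next
  case (Suc n)
  show ?thesis
    unfolding Suc by (rule C_k_SucI[OF bounded_linear_imp_has_derivative[OF assms]]) (rule C_k_const)
qed

lemma C_k_add: "C_k k g \<Longrightarrow> C_k k h \<Longrightarrow> C_k k (\<lambda>u. g u + h u)"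
proof (induction k arbitrary: g h)
  case 0
  then show ?case by (auto intro: continuous_intros)
next
  case (Suc k)
  obtain D where D: "\<And>u. (g has_derivative D u) (at u)" "\<And>v. C_k k (\<lambda>u. D u v)"
    using Suc.prems(1) by (rule C_k_SucE) blast
  obtain E where E: "\<And>u. (h has_derivative E u) (at u)" "\<And>v. C_k k (\<lambda>u. E u v)"
    using Suc.prems(2) by (rule C_k_SucE) blast
  show ?case
    by (rule C_k_SucI[OF has_derivative_add[OF D(1) E(1)]]) (intro Suc.IH D E)
qed

lemma C_k_mult: "C_k k g \<Longrightarrow> C_k k h \<Longrightarrow> C_k k (\<lambda>u. g u * h u)"
proof (induction k arbitrary: g h)
  case 0
  then show ?case by (auto intro: continuous_intros)
next
  case (Suc k)
  obtain D where D: "\<And>u. (g has_derivative D u) (at u)" "\<And>v. C_k k (\<lambda>u. D u v)"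
    using Suc.prems(1) by (rule C_k_SucE) blast
  obtain E where E: "\<And>u. (h has_derivative E u) (at u)" "\<And>v. C_k k (\<lambda>u. E u v)"
    using Suc.prems(2) by (rule C_k_SucE) blast
  show ?case
    by (rule C_k_SucI[OF has_derivative_mult[OF D(1) E(1)]])
       (intro C_k_add Suc.IH D E C_k_SucD[OF Suc.prems(1)] C_k_SucD[OF Suc.prems(2)])
qed

text \<open>The inductions below close because the derivative is written in terms of the function itself.\<close>

lemma C_k_inverse: "C_k k h \<Longrightarrow> (\<And>u. h u > 0) \<Longrightarrow> C_k k (\<lambda>u. inverse (h u))"
proof (induction k arbitrary: h)
  case 0
  have "h u \<noteq> 0" for u using 0(2)[of u] by simp
  then show ?case using 0(1) by (auto intro!: continuous_intros)
next
  case (Suc k)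
  obtain D where D: "\<And>u. (h has_derivative D u) (at u)" "\<And>v. C_k k (\<lambda>u. D u v)"
    using Suc.prems(1) by (rule C_k_SucE) blast
  have i: "C_k k (\<lambda>u. inverse (h u))"
    using Suc.IH[OF C_k_SucD[OF Suc.prems(1)] Suc.prems(2)] .
  have "((\<lambda>u. inverse (h u)) has_derivative (\<lambda>v. (- 1) * (inverse (h u) * D u v * inverse (h u)))) (at u)" for u
    using Deriv.has_derivative_inverse[OF less_imp_neq[OF Suc.prems(2), THEN not_sym] D(1)] by simp
  then show ?case
    by (rule C_k_SucI) (intro C_k_mult C_k_const i D)
qed

lemma C_k_ln: "C_k k h \<Longrightarrow> (\<And>u. h u > 0) \<Longrightarrow> C_k k (\<lambda>u. ln (h u))"
proof (cases k)
  case 0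
  assume "C_k k h" and pos: "\<And>u. h u > 0"
  have "h u \<noteq> 0" for u using pos[of u] by simp
  then show ?thesis using 0 \<open>C_k k h\<close> by (auto intro!: continuous_intros)
next
  case (Suc n)
  assume h: "C_k k h" and pos: "\<And>u. h u > 0"
  obtain D where D: "\<And>u. (h has_derivative D u) (at u)" "\<And>v. C_k n (\<lambda>u. D u v)"
    using h[unfolded Suc] by (rule C_k_SucE) blast
  have i: "C_k n (\<lambda>u. inverse (h u))"
    using C_k_inverse[OF C_k_SucD[OF h[unfolded Suc]] pos] .
  have "((\<lambda>u. ln (h u)) has_derivative (\<lambda>v. D u v * inverse (h u))) (at u)" for u
    using has_derivative_ln[OF pos D(1)] .
  then show ?thesis
    unfolding Suc by (rule C_k_SucI) (intro C_k_mult i D)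
qed

lemma C_k_powr: "C_k k h \<Longrightarrow> (\<And>u. h u > 0) \<Longrightarrow> C_k k (\<lambda>u. h u powr a)"
proof (induction k arbitrary: h)
  case 0
  have "h u \<noteq> 0" for u using 0(2)[of u] by simp
  then show ?case using 0(1) by (auto intro!: continuous_intros)
next
  case (Suc k)
  obtain D where D: "\<And>u. (h has_derivative D u) (at u)" "\<And>v. C_k k (\<lambda>u. D u v)"
    using Suc.prems(1) by (rule C_k_SucE) blast
  have i: "C_k k (\<lambda>u. inverse (h u))"
    using C_k_inverse[OF C_k_SucD[OF Suc.prems(1)] Suc.prems(2)] .
  have p: "C_k k (\<lambda>u. h u powr a)"
    using Suc.IH[OF C_k_SucD[OF Suc.prems(1)] Suc.prems(2)] .
  have "((\<lambda>u. h u powr a) has_derivative (\<lambda>v. h u powr a * (a * (inverse (h u) * D u v)))) (at u)" for u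
    using has_derivative_powr[OF D(1)[of u] has_derivative_const[of a] Suc.prems(2)[of u]]
    by (simp add: field_simps)
  then show ?case
    by (rule C_k_SucI) (intro C_k_mult C_k_const i p D)
qed

lemma C_k_inner_self: "C_k k (\<lambda>u. u \<bullet> u)"
proof (cases k)
  case 0
  then show ?thesis by (auto intro: continuous_intros)
next
  case (Suc n)
  have "((\<lambda>u. u \<bullet> u) has_derivative (\<lambda>v. u \<bullet> (2 *\<^sub>R v))) (at u)" for u :: 'a
    by (auto intro!: derivative_eq_intros simp: inner_commute)
  then show ?thesis
    unfolding Suc by (rule C_k_SucI) (intro C_k_bounded_linear bounded_linear_inner_left)
qed

lemma graph_chart_in_hyp: "graph_chart u \<in> hyp"
  by (simp add: graph_chart_def hyp_def mink_self add_pos_nonneg)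

lemma C_infinity_const: "C_infinity (\<lambda>x. c)"
  by (simp add: C_infinity_def o_def C_k_const)

lemma C_infinity_add: "C_infinity f \<Longrightarrow> C_infinity g \<Longrightarrow> C_infinity (\<lambda>x. f x + g x)"
  by (simp add: C_infinity_def o_def C_k_add)

lemma C_infinity_mult: "C_infinity f \<Longrightarrow> C_infinity g \<Longrightarrow> C_infinity (\<lambda>x. f x * g x)"
  by (simp add: C_infinity_def o_def C_k_mult)

lemma C_infinity_minus: "C_infinity f \<Longrightarrow> C_infinity (\<lambda>x. - f x)"
  using C_infinity_mult[OF C_infinity_const[of "- 1"]] by simp

lemma C_infinity_diff: "C_infinity f \<Longrightarrow> C_infinity g \<Longrightarrow> C_infinity (\<lambda>x. f x - g x)"
  using C_infinity_add[OF _ C_infinity_minus] by simp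

lemma C_infinity_inverse:
  "C_infinity f \<Longrightarrow> (\<And>x. x \<in> hyp \<Longrightarrow> f x > 0) \<Longrightarrow> C_infinity (\<lambda>x. inverse (f x))"
  by (simp add: C_infinity_def o_def C_k_inverse graph_chart_in_hyp)

lemma C_infinity_ln:
  "C_infinity f \<Longrightarrow> (\<And>x. x \<in> hyp \<Longrightarrow> f x > 0) \<Longrightarrow> C_infinity (\<lambda>x. ln (f x))"
  by (simp add: C_infinity_def o_def C_k_ln graph_chart_in_hyp)

lemma C_infinity_powr:
  "C_infinity f \<Longrightarrow> (\<And>x. x \<in> hyp \<Longrightarrow> f x > 0) \<Longrightarrow> C_infinity (\<lambda>x. f x powr a)"
  by (simp add: C_infinity_def o_def C_k_powr graph_chart_in_hyp)

text \<open>In the chart the time coordinate is \<open>(1 + u \<bullet> u) powr (1 / 2)\<close>. All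
  functions of the construction arise from these linear ones by sums, products, inverses, logarithms
  and real powers.\<close>

lemma C_infinity_mink: "C_infinity (\<lambda>x. mink x q)"
  unfolding C_infinity_def
proof
  fix k
  have pos: "1 + u \<bullet> u > 0" for u :: 'a by (simp add: add_pos_nonneg)
  have "C_k k (\<lambda>u :: 'a. (u \<bullet> fst q) + (- snd q) * (1 + u \<bullet> u) powr (1 / 2))"
    by (intro C_k_add C_k_mult C_k_const C_k_powr C_k_inner_self pos C_k_bounded_linear
        bounded_linear_inner_left)
  moreover have "(1 + u \<bullet> u) powr (1 / 2) = sqrt (1 + (norm u)\<^sup>2)" for u :: 'a
    using pos[of u] by (simp add: powr_half_sqrt power2_norm_eq_inner)
  ultimately show "C_k k ((\<lambda>x. mink x q) \<circ> graph_chart)"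
    by (simp add: o_def graph_chart_def mink_def mult.commute)
qed

section \<open>Covariant Hessians\<close>

text \<open>
  \<open>H x\<close> is the covariant Hessian of \<open>f\<close>: the condition \<open>V' = \<langle>c', V\<rangle> c\<close> says that \<open>V\<close> is parallel
  along \<open>c\<close> at time \<open>t\<close>.
\<close>

definition has_hhess ::
  "('a::euclidean_space \<times> real \<Rightarrow> real) \<Rightarrow> ('a \<times> real \<Rightarrow> 'a \<times> real) \<Rightarrow>
    ('a \<times> real \<Rightarrow> 'a \<times> real \<Rightarrow> 'a \<times> real \<Rightarrow> real) \<Rightarrow> bool" where
  "has_hhess f G H \<longleftrightarrow> (\<forall>x\<in>hyp. has_hgrad f (G x) x) \<and>
     (\<forall>c V u t. (\<forall>s. c s \<in> hyp) \<longrightarrow> (\<forall>s. V s \<in> tangent (c s)) \<longrightarrow>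
        (c has_vector_derivative u) (at t) \<longrightarrow>
        (V has_vector_derivative mink u (V t) *\<^sub>R c t) (at t) \<longrightarrow>
        ((\<lambda>s. mink (G (c s)) (V s)) has_real_derivative H (c t) u (V t)) (at t))"

lemma has_hhessI:
  assumes "\<And>x. x \<in> hyp \<Longrightarrow> has_hgrad f (G x) x"
    and "\<And>c V u t. (\<And>s. c s \<in> hyp) \<Longrightarrow> (\<And>s. V s \<in> tangent (c s)) \<Longrightarrow>
        (c has_vector_derivative u) (at t) \<Longrightarrow>
        (V has_vector_derivative mink u (V t) *\<^sub>R c t) (at t) \<Longrightarrow>
        ((\<lambda>s. mink (G (c s)) (V s)) has_real_derivative H (c t) u (V t)) (at t)"
  shows "has_hhess f G H"
  using assms unfolding has_hhess_def by blast

lemma has_hhess_grad: "has_hhess f G H \<Longrightarrow> x \<in> hyp \<Longrightarrow> has_hgrad f (G x) x"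
  by (simp add: has_hhess_def)

lemma has_hhess_tangent: "has_hhess f G H \<Longrightarrow> x \<in> hyp \<Longrightarrow> G x \<in> tangent x"
  by (simp add: has_hhess_def has_hgrad_def)

lemma has_hhess_deriv:
  assumes "has_hhess f G H" "\<And>s. c s \<in> hyp" "\<And>s. V s \<in> tangent (c s)"
    "(c has_vector_derivative u) (at t)" "(V has_vector_derivative mink u (V t) *\<^sub>R c t) (at t)"
  shows "((\<lambda>s. mink (G (c s)) (V s)) has_real_derivative H (c t) u (V t)) (at t)"
  using assms unfolding has_hhess_def by blast

lemma has_hgrad_curve:
  assumes "has_hgrad f g (c t)" "\<And>s. c s \<in> hyp" "(c has_vector_derivative u) (at t)"
  shows "((\<lambda>s. f (c s)) has_real_derivative mink g u) (at t)"
proof -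
  have "(f has_derivative mink g) (at (c t) within range c)"
    using assms(1,2) by (auto simp: has_hgrad_def intro: has_derivative_subset)
  from has_derivative_in_compose[OF assms(3)[unfolded has_vector_derivative_def] this]
  have "((\<lambda>s. f (c s)) has_derivative (\<lambda>s. mink g (s *\<^sub>R u))) (at t)" .
  then show ?thesis
    by (simp add: has_field_derivative_def mink_simps mult.commute[of _ "mink g u"])
qed

lemma has_hgrad_compose:
  assumes "has_hgrad f g x" "(\<psi> has_real_derivative d) (at (f x))"
  shows "has_hgrad (\<lambda>x. \<psi> (f x)) (d *\<^sub>R g) x"
proof -
  have "((\<lambda>x. \<psi> (f x)) has_derivative (\<lambda>v. mink g v * d)) (at x within hyp)"
    using has_derivative_compose[of f "mink g" x hyp \<psi> "(*) d"] assms
    by (simp add: has_hgrad_def has_field_derivative_def mult.commute[of d])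
  then show ?thesis
    using assms(1) by (simp add: has_hgrad_def tangent_scaleR mink_simps mult.commute[of d])
qed

lemma has_hgrad_add:
  "has_hgrad f g x \<Longrightarrow> has_hgrad f' g' x \<Longrightarrow> has_hgrad (\<lambda>x. f x + f' x) (g + g') x"
  using has_derivative_add[of f "mink g" "at x within hyp" f' "mink g'"]
  by (simp add: has_hgrad_def tangent_add mink_simps)

lemma has_hgrad_mult:
  "has_hgrad f g x \<Longrightarrow> has_hgrad f' g' x \<Longrightarrow> has_hgrad (\<lambda>x. f x * f' x) (f x *\<^sub>R g' + f' x *\<^sub>R g) x"
  using has_derivative_mult[of f "mink g" x hyp f' "mink g'"]
  by (simp add: has_hgrad_def tangent_add tangent_scaleR mink_simps mult.commute[of "f' x"])

lemma has_hhess_const: "has_hhess (\<lambda>x. k) (\<lambda>x. 0) (\<lambda>x u w. 0)"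
  by (rule has_hhessI) (auto simp: has_hgrad_def zero_in_tangent mink.zero_left)

text \<open>The ambient Minkowski gradient \<open>- q\<close> of \<open>- mink x q\<close>,
  projected to the tangent space. For \<open>q\<close> in \<open>hyp\<close> that function is the
  hyperbolic cosine of the distance to \<open>q\<close>.\<close>

definition lin_grad :: "'a::euclidean_space \<times> real \<Rightarrow> 'a \<times> real \<Rightarrow> 'a \<times> real" where
  "lin_grad q x = - tproj x q"

lemma mink_lin_grad: "u \<in> tangent x \<Longrightarrow> mink (lin_grad q x) u = - mink q u"
  by (simp add: lin_grad_def tproj_def mink_simps tangent_def)

text \<open>On tangent fields the gradient acts as the constant form \<open>- mink q\<close>, so
  only the derivative of the parallel field contributes, and this is a multiple of the base point.
  Hence the Hessian is the function times the metric; all Hessians below are derived from this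
  one.\<close>

lemma has_hhess_linear:
  "has_hhess (\<lambda>x. - mink x q) (lin_grad q) (\<lambda>x u w. - mink x q * mink u w)"
proof (rule has_hhessI)
  fix x :: "'a \<times> real" assume x: "x \<in> hyp"
  have "((\<lambda>x. - mink x q) has_derivative (\<lambda>v. - mink v q)) (at x within hyp)"
    by (intro has_derivative_minus mink.FDERIV[OF has_derivative_ident has_derivative_const, simplified mink.zero_right add_0_left])
  have eq: "mink (lin_grad q x) v = - mink v q + (- mink x q) * mink x v" for v
    by (simp add: lin_grad_def tproj_def mink_simps mink_commute[of q])
  have sq: "((\<lambda>y. mink y y) has_derivative (\<lambda>v. 2 * mink x v)) (at x within hyp)"
    using mink.FDERIV[OF has_derivative_ident has_derivative_ident, of x hyp]
    by (simp add: mink_commute[of _ x])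
  \<comment> \<open>\<open>mink y y + 1\<close> vanishes on \<open>hyp\<close>. Subtracting this
    multiple of it leaves the function unchanged there and makes its ambient derivative
    representable by a tangent vector.\<close>
  have "((\<lambda>y. - mink y q - mink x q / 2 * (mink y y + 1)) has_derivative
      (\<lambda>v. - mink v q + (- mink x q) * mink x v)) (at x within hyp)"
    by (rule derivative_eq_intros \<open>((\<lambda>x. - mink x q) has_derivative (\<lambda>v. - mink v q)) (at x within hyp)\<close> sq refl | simp)+
  then have "((\<lambda>y. - mink y q) has_derivative mink (lin_grad q x)) (at x within hyp)"
    unfolding eq[abs_def] by (rule has_derivative_transform[OF x, rotated]) (simp add: hyp_def)
  then show "has_hgrad (\<lambda>x. - mink x q) (lin_grad q x) x"
    using tproj_in_tangent[OF x, of q] tangent_scaleR[of "tproj x q" x "-1"] by (simp add: has_hgrad_def lin_grad_def)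
next
  fix c V :: "real \<Rightarrow> 'a \<times> real" and u t
  assume V: "\<And>s. V s \<in> tangent (c s)"
    and d: "(V has_vector_derivative mink u (V t) *\<^sub>R c t) (at t)"
  have "((\<lambda>s. - mink q (V s)) has_vector_derivative - (mink q (mink u (V t) *\<^sub>R c t))) (at t)"
    by (intro has_vector_derivative_minus bounded_linear.has_vector_derivative[OF mink.bounded_linear_right] d)
  then show "((\<lambda>s. mink (lin_grad q (c s)) (V s)) has_real_derivative - mink (c t) q * mink u (V t)) (at t)"
    using V by (simp add: mink_lin_grad has_real_derivative_iff_has_vector_derivative mink_simps
        mink_commute[of q] mult.commute)
qed

lemma has_hhess_compose:
  assumes f: "has_hhess f G H"
    and \<psi>: "\<And>x. x \<in> hyp \<Longrightarrow> (\<psi> has_real_derivative \<psi>' (f x)) (at (f x))"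
    and \<psi>': "\<And>x. x \<in> hyp \<Longrightarrow> (\<psi>' has_real_derivative \<psi>'' (f x)) (at (f x))"
  shows "has_hhess (\<lambda>x. \<psi> (f x)) (\<lambda>x. \<psi>' (f x) *\<^sub>R G x)
    (\<lambda>x u w. \<psi>' (f x) * H x u w + \<psi>'' (f x) * (mink (G x) u * mink (G x) w))"
proof (rule has_hhessI)
  fix x :: "'a \<times> real" assume "x \<in> hyp"
  then show "has_hgrad (\<lambda>x. \<psi> (f x)) (\<psi>' (f x) *\<^sub>R G x) x"
    by (intro has_hgrad_compose has_hhess_grad[OF f] \<psi>)
next
  fix c V :: "real \<Rightarrow> 'a \<times> real" and u t
  assume c: "\<And>s. c s \<in> hyp" and V: "\<And>s. V s \<in> tangent (c s)"
    and d: "(c has_vector_derivative u) (at t)" "(V has_vector_derivative mink u (V t) *\<^sub>R c t) (at t)"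
  have 1: "((\<lambda>s. \<psi>' (f (c s))) has_real_derivative \<psi>'' (f (c t)) * mink (G (c t)) u) (at t)"
    by (rule DERIV_chain2[OF \<psi>'[OF c] has_hgrad_curve[OF has_hhess_grad[OF f c] c d(1)]])
  show "((\<lambda>s. mink (\<psi>' (f (c s)) *\<^sub>R G (c s)) (V s)) has_real_derivative
      \<psi>' (f (c t)) * H (c t) u (V t) + \<psi>'' (f (c t)) * (mink (G (c t)) u * mink (G (c t)) (V t))) (at t)"
    using DERIV_mult[OF 1 has_hhess_deriv[OF f c V d]] by (simp add: mink_simps mult_ac add.commute)
qed

lemma has_hhess_add:
  assumes f: "has_hhess f G H" and f': "has_hhess f' G' H'"
  shows "has_hhess (\<lambda>x. f x + f' x) (\<lambda>x. G x + G' x) (\<lambda>x u w. H x u w + H' x u w)"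
proof (rule has_hhessI)
  fix x :: "'a \<times> real" assume "x \<in> hyp"
  then show "has_hgrad (\<lambda>x. f x + f' x) (G x + G' x) x"
    by (intro has_hgrad_add has_hhess_grad[OF f] has_hhess_grad[OF f'])
next
  fix c V :: "real \<Rightarrow> 'a \<times> real" and u t
  assume c: "\<And>s. c s \<in> hyp" and V: "\<And>s. V s \<in> tangent (c s)"
    and d: "(c has_vector_derivative u) (at t)" "(V has_vector_derivative mink u (V t) *\<^sub>R c t) (at t)"
  show "((\<lambda>s. mink (G (c s) + G' (c s)) (V s)) has_real_derivative H (c t) u (V t) + H' (c t) u (V t)) (at t)"
    using DERIV_add[OF has_hhess_deriv[OF f c V d] has_hhess_deriv[OF f' c V d]] by (simp add: mink_simps)
qed

lemma has_hhess_mult: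
  assumes f: "has_hhess f G H" and f': "has_hhess f' G' H'"
  shows "has_hhess (\<lambda>x. f x * f' x) (\<lambda>x. f x *\<^sub>R G' x + f' x *\<^sub>R G x)
    (\<lambda>x u w. f x * H' x u w + f' x * H x u w + mink (G x) u * mink (G' x) w + mink (G' x) u * mink (G x) w)"
proof (rule has_hhessI)
  fix x :: "'a \<times> real" assume "x \<in> hyp"
  then show "has_hgrad (\<lambda>x. f x * f' x) (f x *\<^sub>R G' x + f' x *\<^sub>R G x) x"
    by (intro has_hgrad_mult has_hhess_grad[OF f] has_hhess_grad[OF f'])
next
  fix c V :: "real \<Rightarrow> 'a \<times> real" and u t
  assume c: "\<And>s. c s \<in> hyp" and V: "\<And>s. V s \<in> tangent (c s)"
    and d: "(c has_vector_derivative u) (at t)" "(V has_vector_derivative mink u (V t) *\<^sub>R c t) (at t)"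
  note D = has_hgrad_curve[OF has_hhess_grad[OF f c] c d(1)] has_hgrad_curve[OF has_hhess_grad[OF f' c] c d(1)]
    has_hhess_deriv[OF f c V d] has_hhess_deriv[OF f' c V d]
  show "((\<lambda>s. mink (f (c s) *\<^sub>R G' (c s) + f' (c s) *\<^sub>R G (c s)) (V s)) has_real_derivative
      f (c t) * H' (c t) u (V t) + f' (c t) * H (c t) u (V t) + mink (G (c t)) u * mink (G' (c t)) (V t)
      + mink (G' (c t)) u * mink (G (c t)) (V t)) (at t)"
    using DERIV_add[OF DERIV_mult[OF D(1,4)] DERIV_mult[OF D(2,3)]] by (simp add: mink_simps algebra_simps)
qed

lemma has_hhess_cmult:
  "has_hhess f G H \<Longrightarrow> has_hhess (\<lambda>x. k * f x) (\<lambda>x. k *\<^sub>R G x) (\<lambda>x u w. k * H x u w)"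
  using has_hhess_mult[OF has_hhess_const[of k]] by (simp add: mink.zero_left)

lemma has_hhess_diff:
  assumes "has_hhess f G H" "has_hhess f' G' H'"
  shows "has_hhess (\<lambda>x. f x - f' x) (\<lambda>x. G x - G' x) (\<lambda>x u w. H x u w - H' x u w)"
  using has_hhess_add[OF assms(1) has_hhess_cmult[OF assms(2), of "-1"]] by simp

subsection \<open>Second-order criteria for the function class\<close>

lemma hyp_connecting_geodesic:
  assumes "x \<in> hyp" "y \<in> hyp"
  obtains v where "v \<in> tangent x" "geodesic x y = hgeo x v" "hgeo x v 0 = x" "hgeo x v 1 = y"
    "hnorm v = hdist x y"
proof
  show "hlog x y \<in> tangent x" using assms by (simp add: hlog_eq hlogf)
  show "geodesic x y = hgeo x (hlog x y)" using assms by (rule geodesic_eq_hgeo)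
  then show "hgeo x (hlog x y) 0 = x" "hgeo x (hlog x y) 1 = y"
    using geodesic_endpoints(2,3)[OF assms] by simp_all
  show "hnorm (hlog x y) = hdist x y" using hdist_eq_hnorm_hlog[OF assms] by simp
qed

lemma hnorm_hgeo': "x \<in> hyp \<Longrightarrow> v \<in> tangent x \<Longrightarrow> hnorm (hgeo' x v t) = hnorm v"
  by (simp add: hnorm_def hgeo_mink(3))

lemma hgeo'_tangent: "x \<in> hyp \<Longrightarrow> v \<in> tangent x \<Longrightarrow> hgeo' x v t \<in> tangent (hgeo x v t)"
  by (simp add: tangent_def hgeo_mink(2))

lemma has_hhess_geodesic:
  assumes f: "has_hhess f G H" and x: "x \<in> hyp" "v \<in> tangent x"
  shows "((\<lambda>s. f (hgeo x v s)) has_real_derivative mink (G (hgeo x v t)) (hgeo' x v t)) (at t)"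
    and "((\<lambda>s. mink (G (hgeo x v s)) (hgeo' x v s)) has_real_derivative
      H (hgeo x v t) (hgeo' x v t) (hgeo' x v t)) (at t)"
proof -
  show "((\<lambda>s. f (hgeo x v s)) has_real_derivative mink (G (hgeo x v t)) (hgeo' x v t)) (at t)"
    by (intro has_hgrad_curve has_hhess_grad[OF f] hgeo_in_hyp x hgeo_deriv)
  show "((\<lambda>s. mink (G (hgeo x v s)) (hgeo' x v s)) has_real_derivative
      H (hgeo x v t) (hgeo' x v t) (hgeo' x v t)) (at t)"
    by (rule has_hhess_deriv[OF f]) (simp_all add: x hgeo_in_hyp hgeo'_tangent hgeo_deriv hgeo_mink(3))
qed

lemma glipschitz_on_if_grad_bound:
  assumes f: "has_hhess f G H" and M: "\<And>x u. x \<in> hyp \<Longrightarrow> u \<in> tangent x \<Longrightarrow> \<bar>mink (G x) u\<bar> \<le> M * hnorm u"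
  shows "glipschitz_on M hyp f"
  unfolding glipschitz_on_def
proof (intro ballI)
  fix x y :: "'a \<times> real" assume xy: "x \<in> hyp" "y \<in> hyp"
  obtain v where v: "v \<in> tangent x" "hgeo x v 0 = x" "hgeo x v 1 = y" "hnorm v = hdist x y"
    using hyp_connecting_geodesic[OF xy] by metis
  obtain t where "f (hgeo x v 1) - f (hgeo x v 0) = (1 - 0) * mink (G (hgeo x v t)) (hgeo' x v t)"
    using MVT2[of 0 1, OF _ has_hhess_geodesic(1)[OF f xy(1) v(1)]] by auto
  then have "\<bar>f x - f y\<bar> = \<bar>mink (G (hgeo x v t)) (hgeo' x v t)\<bar>"
    using v by simp
  also have "\<dots> \<le> M * hnorm (hgeo' x v t)"
    by (intro M hgeo_in_hyp hgeo'_tangent xy v)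
  finally show "\<bar>f x - f y\<bar> \<le> M * hdist x y"
    by (simp add: hnorm_hgeo' xy v)
qed

lemma strongly_gconvex_on_if_hess_nonneg:
  assumes f: "has_hhess f G H" and pos: "\<And>x u. x \<in> hyp \<Longrightarrow> u \<in> tangent x \<Longrightarrow> H x u u \<ge> 0"
  shows "strongly_gconvex_on 0 hyp f"
  unfolding strongly_gconvex_on_def
proof (intro conjI ballI gconvex_set_hyp)
  fix x y :: "'a \<times> real" and t :: real assume xy: "x \<in> hyp" "y \<in> hyp" and t: "t \<in> {0..1}"
  obtain v where v: "v \<in> tangent x" "geodesic x y = hgeo x v" "hgeo x v 0 = x" "hgeo x v 1 = y"
    using hyp_connecting_geodesic[OF xy] by metis
  have "convex_on UNIV (\<lambda>s. f (hgeo x v s))"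
    by (rule f''_ge0_imp_convex[OF _ has_hhess_geodesic(1)[OF f xy(1) v(1)] has_hhess_geodesic(2)[OF f xy(1) v(1)]])
       (simp_all add: pos hgeo_in_hyp hgeo'_tangent xy v)
  from convex_onD[OF this, of t 0 1]
  show "f (geodesic x y t) \<le> (1 - t) * f x + t * f y - 0 / 2 * t * (1 - t) * (hdist x y)\<^sup>2"
    using t v by simp
qed

text \<open>On a geodesic joining two minimizers the first derivative vanishes at both ends, so the
  second derivative vanishes somewhere in between.\<close>

lemma unique_minimizer_if_hess_pos:
  assumes f: "has_hhess f G H" and pos: "\<And>x u. x \<in> hyp \<Longrightarrow> u \<in> tangent x \<Longrightarrow> u \<noteq> 0 \<Longrightarrow> H x u u > 0"
    and x: "is_minimizer f x" and y: "is_minimizer f y"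
  shows "y = x"
proof (rule ccontr)
  assume "y \<noteq> x"
  have xy: "x \<in> hyp" "y \<in> hyp" using x y by (auto simp: is_minimizer_def)
  obtain v where v: "v \<in> tangent x" "hgeo x v 0 = x" "hgeo x v 1 = y"
    using hyp_connecting_geodesic[OF xy] by metis
  have "v \<noteq> 0" using \<open>y \<noteq> x\<close> v by (auto simp: hgeo_def)
  then have ne: "hgeo' x v t \<noteq> 0" for t
    using hnorm_hgeo'[OF xy(1) v(1), of t] hnorm_eq_0[OF xy(1) v(1)] by auto
  have min: "f (hgeo x v t) \<le> f (hgeo x v s)" if "t \<in> {0, 1}" for s t
    using that v x y hgeo_in_hyp[OF xy(1) v(1), of s] by (auto simp: is_minimizer_def)
  have crit: "mink (G (hgeo x v t)) (hgeo' x v t) = 0" if "t \<in> {0, 1}" for t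
    by (rule DERIV_local_min[OF has_hhess_geodesic(1)[OF f xy(1) v(1)], of 1]) (use min[OF that] in auto)
  obtain t where "mink (G (hgeo x v 1)) (hgeo' x v 1) - mink (G (hgeo x v 0)) (hgeo' x v 0)
      = (1 - 0) * H (hgeo x v t) (hgeo' x v t) (hgeo' x v t)"
    using MVT2[of 0 1, OF _ has_hhess_geodesic(2)[OF f xy(1) v(1)]] by auto
  then have "H (hgeo x v t) (hgeo' x v t) (hgeo' x v t) = 0"
    by (simp add: crit)
  then show False
    using pos[OF hgeo_in_hyp[OF xy(1) v(1)] hgeo'_tangent[OF xy(1) v(1)] ne, of t] by simp
qed

text \<open>Only the component of \<open>w\<close> along \<open>v\<close> turns, following the
  velocity \<open>hgeo'\<close>; the component orthogonal to \<open>v\<close> stays constant in the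
  ambient space.\<close>

lemma parallel_field_exists:
  assumes x: "x \<in> hyp" "v \<in> tangent x" and w: "w \<in> tangent x"
  obtains V where "\<And>t. V t \<in> tangent (hgeo x v t)"
    "\<And>t. (V has_vector_derivative mink (hgeo' x v t) (V t) *\<^sub>R hgeo x v t) (at t)" "V 0 = w"
proof (cases "v = 0")
  case True
  then have "hgeo x v t = x" "hgeo' x v t = 0" for t
    by (simp_all add: hgeo_def hgeo'_def)
  then show ?thesis
    using that[of "\<lambda>_. w"] w by (simp add: mink.zero_left)
next
  case False
  define k where "k = mink v v"
  have k: "k \<noteq> 0" using tangent_mink_nonneg(2)[OF x] False by (simp add: k_def)
  define b where "b = mink v w"
  define V where "V = (\<lambda>t. w + (b / k) *\<^sub>R (hgeo' x v t - v))"
  have xw: "mink x w = 0" "mink x v = 0" using w x by (auto simp: tangent_def)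
  have hv: "hnorm v \<noteq> 0" using hnorm_eq_0[OF x] False by simp
  have kk: "k = hnorm v * hnorm v" using hnorm_square[OF x] by (simp add: k_def power2_eq_square)
  have 1: "mink (hgeo x v t) w = sinh (t * hnorm v) / hnorm v * b"
    "mink (hgeo x v t) v = sinh (t * hnorm v) / hnorm v * k" for t
    using hv by (simp_all add: hgeo_def mink_simps xw b_def k_def)
  have 2: "mink (hgeo' x v t) w = cosh (t * hnorm v) * b"
    "mink (hgeo' x v t) v = cosh (t * hnorm v) * k" for t
    by (simp_all add: hgeo'_def mink_simps xw b_def k_def)
  show ?thesis
  proof (rule that[of V])
    show "V 0 = w" by (simp add: V_def hgeo_0)
    fix t
    show "V t \<in> tangent (hgeo x v t)"
      using k by (simp add: V_def tangent_def mink_simps 1 hgeo_mink(2)[OF x])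
    have "mink (hgeo' x v t) (V t) = b"
      using k by (simp add: V_def mink_simps 2 hgeo_mink(3)[OF x] k_def[symmetric] right_diff_distrib)
    moreover have "(V has_vector_derivative 0 + (b / k) *\<^sub>R (mink v v *\<^sub>R hgeo x v t - 0)) (at t)"
      unfolding V_def
      by (intro has_vector_derivative_add has_vector_derivative_const has_vector_derivative_diff
            bounded_linear.has_vector_derivative[OF bounded_linear_scaleR_right] hgeo_deriv(2)[OF x])
    ultimately show "(V has_vector_derivative mink (hgeo' x v t) (V t) *\<^sub>R hgeo x v t) (at t)"
      using k by (simp add: k_def)
  qed
qed

lemma mink_add_hyp: "x \<in> hyp \<Longrightarrow> mink x (y + x) = - (1 - mink x y)"
  by (simp add: mink_simps hyp_def)

text \<open>The discrepancy \<open>d\<close> of the gradients is tested against itself. Its parallel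
  field \<open>V\<close> has constant norm, and \<open>mink d d\<close> is, up to sign, the
  increment of \<open>mink G V\<close> along the geodesic, which the mean value theorem turns into
  one mixed Hessian value.\<close>

lemma gsmooth_on_if_hess_bound:
  assumes f: "has_hhess f G H"
    and L: "\<And>x u w. x \<in> hyp \<Longrightarrow> u \<in> tangent x \<Longrightarrow> w \<in> tangent x \<Longrightarrow> \<bar>H x u w\<bar> \<le> L * hnorm u * hnorm w"
  shows "gsmooth_on L hyp f"
  unfolding gsmooth_on_def
proof (intro conjI ballI)
  fix x :: "'a \<times> real" assume "x \<in> hyp"
  then show "\<exists>g. has_hgrad f g x" using has_hhess_grad[OF f] by blast
next
  fix x y :: "'a \<times> real" assume xy: "x \<in> hyp" "y \<in> hyp"
  have g: "hgrad f x = G x" "hgrad f y = G y"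
    using xy by (auto intro: hgrad_eq has_hhess_grad[OF f])
  note tG = has_hhess_tangent[OF f xy(1)] has_hhess_tangent[OF f xy(2)]
  define d where "d = G x - ptransport y x (G y)"
  have py: "ptransport y x (G y) = G y + (mink x (G y) / (1 - mink y x)) *\<^sub>R (y + x)"
    by (rule ptransport_eq[OF xy(2,1) tG(2)])
  have "1 - mink x y \<noteq> 0" using mink_hyp_le(1)[OF xy] by simp
  moreover have "g / a * - a = - g" if "a \<noteq> 0" for a g :: real using that by simp
  ultimately have "mink x (ptransport y x (G y)) = 0"
    unfolding py mink.add_right[of x "G y"] mink.scaleR_right mink_add_hyp[OF xy(1)] mink_commute[of y x]
    by (simp only: real_scaleR_def add.right_inverse simp_thms)
  then have td: "d \<in> tangent x"
    unfolding d_def using tG(1) by (intro tangent_diff) (simp_all add: tangent_def)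
  obtain v where v: "v \<in> tangent x" "geodesic x y = hgeo x v" "hgeo x v 0 = x" "hgeo x v 1 = y"
    "hnorm v = hdist x y"
    using hyp_connecting_geodesic[OF xy] by metis
  obtain V where V: "\<And>t. V t \<in> tangent (hgeo x v t)"
    "\<And>t. (V has_vector_derivative mink (hgeo' x v t) (V t) *\<^sub>R hgeo x v t) (at t)" "V 0 = d"
    by (rule parallel_field_exists[OF xy(1) v(1) td]) (rule that)
  have c: "hgeo x v t \<in> hyp" for t by (rule hgeo_in_hyp[OF xy(1) v(1)])
  have par: "parallel_along (hgeo x v) V"
    unfolding parallel_along_def
  proof (intro allI conjI exI)
    show "V t \<in> tangent (hgeo x v t)" for t by (rule V)
    show "(V has_vector_derivative mink (hgeo' x v t) (V t) *\<^sub>R hgeo x v t) (at t)" for t by (rule V)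
    show "tproj (hgeo x v t) (mink (hgeo' x v t) (V t) *\<^sub>R hgeo x v t) = 0" for t
      using c[of t] by (simp add: tproj_def mink_simps hyp_def)
  qed
  have "ptransport x y d = V 1"
    unfolding ptransport_def v(2)
  proof (rule the_equality)
    show "\<exists>W. parallel_along (hgeo x v) W \<and> W 0 = d \<and> W 1 = V 1" using par V(3) by blast
    show "w = V 1" if "\<exists>W. parallel_along (hgeo x v) W \<and> W 0 = d \<and> W 1 = w" for w
      using that parallel_along_unique[of "hgeo x v" _ V 1] par V(3) c by (metis image_subsetI)
  qed
  then have V1: "V 1 = d + (mink y d / (1 - mink x y)) *\<^sub>R (x + y)"
    using ptransport_eq[OF xy td] by simp
  have nV: "hnorm (V t) = hnorm d" for t
  proof -
    have "((\<lambda>t. mink (V t) (V t)) has_vector_derivative 0) (at t)" for t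
      using mink.has_vector_derivative[OF V(2) V(2), of t] V(1)[of t]
      by (simp add: mink_simps tangent_def mink_commute[of _ "hgeo x v t"])
    from constant_if_zero_deriv[OF this, of t] show ?thesis by (simp add: hnorm_def V)
  qed
  have der: "((\<lambda>s. mink (G (hgeo x v s)) (V s)) has_real_derivative H (hgeo x v t) (hgeo' x v t) (V t)) (at t)" for t
    by (rule has_hhess_deriv[OF f c V(1) hgeo_deriv(1)[OF xy(1) v(1)] V(2)])
  obtain t where t: "mink (G (hgeo x v 1)) (V 1) - mink (G (hgeo x v 0)) (V 0)
      = (1 - 0) * H (hgeo x v t) (hgeo' x v t) (V t)"
    using MVT2[of 0 1, OF _ der] by auto
  \<comment> \<open>By the closed formula for transport, moving \<open>G y\<close> to
    \<open>x\<close> and moving \<open>d\<close> to \<open>y\<close> give the same product.\<close>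
  have "mink d d = mink (G x - ptransport y x (G y)) d"
    unfolding d_def ..
  also have "\<dots> = mink (G x) d - mink (G y) d - mink x (G y) / (1 - mink y x) * mink y d"
    using td by (simp add: py mink_simps tangent_def)
  also have "\<dots> = mink (G x) d - mink (G y) (V 1)"
    using tG(2) unfolding V1 tangent_def mink_commute[of y x] mink_commute[of x "G y"]
    by (simp add: mink_simps mink_commute[of "G y" y])
  also have "\<dots> \<le> \<bar>H (hgeo x v t) (hgeo' x v t) (V t)\<bar>"
    using t V(3) v(3,4) by simp
  also have "\<dots> \<le> L * hnorm (hgeo' x v t) * hnorm (V t)"
    by (intro L c V hgeo'_tangent xy v)
  finally have "(hnorm d)\<^sup>2 \<le> L * hdist x y * hnorm d"
    by (simp add: nV hnorm_hgeo' xy v hnorm_square[OF xy(1) td])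
  then have *: "hnorm d = 0 \<or> hnorm d \<le> L * hdist x y"
    using hnorm_nonneg[OF xy(1) td] mult_right_le_imp_le[of "hnorm d" "hnorm d" "L * hdist x y"]
    by (cases "hnorm d = 0") (simp_all add: power2_eq_square)
  \<comment> \<open>The sign of \<open>L\<close> comes from the Hessian bound itself when the
    geodesic is not constant; otherwise the distance is 0.\<close>
  have "0 \<le> L * hnorm v * hnorm v"
    using L[OF xy(1) v(1) v(1)] by linarith
  then have "0 \<le> L * hdist x y"
    using hnorm_nonneg[OF xy(1) v(1)] v(5)
    by (cases "hnorm v = 0") (auto simp: zero_le_mult_iff)
  then show "hnorm (hgrad f x - ptransport y x (hgrad f y)) \<le> L * hdist x y"
    using * unfolding g d_def[symmetric] by auto
qed

section \<open>Hyperbolic estimates\<close>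

subsection \<open>Inequalities on the hyperboloid\<close>

lemma hyp_mink_ge_1: "x \<in> hyp \<Longrightarrow> q \<in> hyp \<Longrightarrow> - mink x q \<ge> 1"
  using mink_hyp_le(1)[of x q] by simp

lemma in_hyp_if_future:
  assumes "mink p p = -1" "x \<in> hyp" "mink p x < 0"
  shows "p \<in> hyp"
proof -
  consider "snd p > 0" | "snd p = 0" | "snd p < 0" by linarith
  then show ?thesis
  proof cases
    case 1
    then show ?thesis using assms(1) by (simp add: hyp_def)
  next
    case 2
    have "mink p p \<ge> 0" using 2 by (simp add: mink_self)
    then show ?thesis using assms(1) by simp
  next
    case 3
    then have "- p \<in> hyp" using assms(1) by (simp add: hyp_def mink_simps)
    then show ?thesis using mink_hyp_le(1)[of "- p" x] assms(2,3) by (simp add: mink_simps)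
  qed
qed

lemma mink_tproj: "u \<in> tangent x \<Longrightarrow> mink (tproj x w) u = mink w u"
  by (simp add: tproj_def mink_simps tangent_def)

lemma mink_tproj_self: "x \<in> hyp \<Longrightarrow> mink (tproj x w) (tproj x w) = mink w w + (mink x w)\<^sup>2"
  by (simp add: tproj_def mink_simps hyp_def power2_eq_square mink_commute[of w x])

text \<open>The tangent projection of \<open>w\<close> at \<open>x\<close> has squared norm
  \<open>m\<^sup>2 + (mink x w)\<^sup>2\<close>. The lemma is meant for
  \<open>w = pt s - pt t\<close>, where it bounds the difference of two gradients.\<close>

lemma spacelike_form_bound:
  assumes "x \<in> hyp" "u \<in> tangent x" "mink w w = m\<^sup>2" "m \<ge> 0"
  shows "\<bar>mink w u\<bar> \<le> (m + \<bar>mink x w\<bar>) * hnorm u"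
proof -
  have t: "tproj x w \<in> tangent x" using assms by (simp add: tproj_in_tangent)
  have "\<bar>mink w u\<bar> \<le> hnorm (tproj x w) * hnorm u"
    using tangent_cauchy_schwarz[OF assms(1) t assms(2)] assms(2) by (simp add: mink_tproj)
  moreover have "hnorm (tproj x w) * hnorm u \<le> (m + \<bar>mink x w\<bar>) * hnorm u"
  proof (rule mult_right_mono)
    show "hnorm (tproj x w) \<le> m + \<bar>mink x w\<bar>"
      unfolding hnorm_def
    proof (rule real_le_lsqrt)
      show "mink (tproj x w) (tproj x w) \<le> (m + \<bar>mink x w\<bar>)\<^sup>2"
      using assms by (simp add: mink_tproj_self power2_sum)
    qed (use assms in auto)
  qed (rule hnorm_nonneg[OF assms(1,2)])
  ultimately show ?thesis by linarith
qed

text \<open>With \<open>- mink x q = cosh d\<close>, the projection of \<open>q\<close> has norm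
  \<open>sinh d\<close>, which is at most \<open>cosh d\<close>.\<close>

lemma hyp_form_bound:
  assumes "x \<in> hyp" "u \<in> tangent x" "q \<in> hyp"
  shows "\<bar>mink q u\<bar> \<le> - mink x q * hnorm u"
proof -
  have t: "tproj x q \<in> tangent x" using assms by (simp add: tproj_in_tangent)
  have "\<bar>mink q u\<bar> \<le> hnorm (tproj x q) * hnorm u"
    using tangent_cauchy_schwarz[OF assms(1) t assms(2)] assms(2) by (simp add: mink_tproj)
  moreover have "hnorm (tproj x q) * hnorm u \<le> - mink x q * hnorm u"
  proof (rule mult_right_mono)
    show "hnorm (tproj x q) \<le> - mink x q"
      unfolding hnorm_def
    proof (rule real_le_lsqrt)
      show "mink (tproj x q) (tproj x q) \<le> (- mink x q)\<^sup>2"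
      using assms by (simp add: mink_tproj_self hyp_def)
    qed (use hyp_mink_ge_1[OF assms(1,3)] in auto)
  qed (rule hnorm_nonneg[OF assms(1,2)])
  ultimately show ?thesis by linarith
qed

lemma hyp_decompose:
  assumes "x \<in> hyp" "p \<in> hyp"
  obtains v where "v \<in> tangent p" "x = (- mink x p) *\<^sub>R p + v" "hnorm v \<le> - mink x p"
proof
  show t: "tproj p x \<in> tangent p" using assms by (simp add: tproj_in_tangent)
  show "x = (- mink x p) *\<^sub>R p + tproj p x" by (simp add: tproj_def mink_commute[of x p])
  show "hnorm (tproj p x) \<le> - mink x p"
    unfolding hnorm_def
  proof (rule real_le_lsqrt)
    show "mink (tproj p x) (tproj p x) \<le> (- mink x p)\<^sup>2"
      using assms by (simp add: mink_tproj_self hyp_def mink_commute[of x p])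
  qed (use hyp_mink_ge_1[OF assms] in auto)
qed

text \<open>In terms of distances, this is \<open>cosh (a + b) \<le> 2 cosh a cosh b\<close>.\<close>

lemma hyp_triangle:
  assumes "x \<in> hyp" "p \<in> hyp" "q \<in> hyp"
  shows "- mink x q \<le> 2 * (- mink x p) * (- mink p q)"
proof -
  obtain v where v: "v \<in> tangent p" "x = (- mink x p) *\<^sub>R p + v" "hnorm v \<le> - mink x p"
    using hyp_decompose[OF assms(1,2)] .
  have "mink x q = (- mink x p) * mink p q + mink q v"
    by (subst v(2)) (simp add: mink_simps mink_commute[of v])
  moreover have "\<bar>mink q v\<bar> \<le> - mink p q * hnorm v"
    by (rule hyp_form_bound) (use assms v in auto)
  moreover have "- mink p q * hnorm v \<le> - mink p q * (- mink x p)"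
    by (rule mult_left_mono[OF v(3)]) (use hyp_mink_ge_1[OF assms(2,3)] in auto)
  ultimately show ?thesis by (simp add: algebra_simps)
qed

text \<open>Splitting \<open>x\<close> into a multiple of \<open>p\<close> and a tangent vector at
  \<open>p\<close> bounds the form at \<open>x\<close> by its value and norm at \<open>p\<close>, at
  the price of one factor \<open>cosh\<close> of the distance. This carries an estimate made at a
  query to the whole space.\<close>

lemma spacelike_transfer:
  assumes "x \<in> hyp" "p \<in> hyp" "mink w w = m\<^sup>2" "m \<ge> 0"
  shows "\<bar>mink x w\<bar> \<le> - mink x p * (2 * \<bar>mink p w\<bar> + m)"
proof -
  obtain v where v: "v \<in> tangent p" "x = (- mink x p) *\<^sub>R p + v" "hnorm v \<le> - mink x p"
    using hyp_decompose[OF assms(1,2)] .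
  have c: "- mink x p \<ge> 0" using hyp_mink_ge_1[OF assms(1,2)] by simp
  have "mink x w = (- mink x p) * mink p w + mink w v"
    by (subst v(2)) (simp add: mink_simps mink_commute[of v])
  then have "\<bar>mink x w\<bar> \<le> \<bar>(- mink x p) * mink p w\<bar> + \<bar>mink w v\<bar>"
    using abs_triangle_ineq by simp
  also have "\<bar>(- mink x p) * mink p w\<bar> = - mink x p * \<bar>mink p w\<bar>"
    using c by (simp add: abs_mult)
  also have "\<bar>mink w v\<bar> \<le> (m + \<bar>mink p w\<bar>) * hnorm v"
    by (rule spacelike_form_bound) (use assms v in auto)
  also have "\<dots> \<le> (m + \<bar>mink p w\<bar>) * (- mink x p)"
    by (rule mult_left_mono[OF v(3)]) (use assms in auto)
  finally show ?thesis by (simp add: algebra_simps)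
qed

subsection \<open>Bounds for linear and bilinear forms on a tangent space\<close>

definition lform :: "'a::euclidean_space \<times> real \<Rightarrow> ('a \<times> real \<Rightarrow> real) \<Rightarrow> real \<Rightarrow> bool" where
  "lform x l c \<longleftrightarrow> (\<forall>u\<in>tangent x. \<bar>l u\<bar> \<le> c * hnorm u)"

definition bform ::
  "'a::euclidean_space \<times> real \<Rightarrow> ('a \<times> real \<Rightarrow> 'a \<times> real \<Rightarrow> real) \<Rightarrow> real \<Rightarrow> bool" where
  "bform x H c \<longleftrightarrow> (\<forall>u\<in>tangent x. \<forall>w\<in>tangent x. \<bar>H u w\<bar> \<le> c * hnorm u * hnorm w)"

lemma lform_mono:
  assumes "x \<in> hyp" "lform x l c" "c \<le> d"
  shows "lform x l d"
  unfolding lform_def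
proof
  fix u assume u: "u \<in> tangent x"
  have "c * hnorm u \<le> d * hnorm u"
    by (intro mult_right_mono hnorm_nonneg[OF assms(1)] u assms(3))
  moreover have "\<bar>l u\<bar> \<le> c * hnorm u"
    using assms(2) u by (simp add: lform_def)
  ultimately show "\<bar>l u\<bar> \<le> d * hnorm u" by linarith
qed

lemma lform_add:
  assumes "lform x l c" "lform x m d"
  shows "lform x (\<lambda>u. l u + m u) (c + d)"
  unfolding lform_def
proof
  fix u assume "u \<in> tangent x"
  then have "\<bar>l u\<bar> \<le> c * hnorm u" "\<bar>m u\<bar> \<le> d * hnorm u"
    using assms by (auto simp: lform_def)
  then show "\<bar>l u + m u\<bar> \<le> (c + d) * hnorm u"
    by (simp add: distrib_right)
qed

lemma lform_scale: "lform x l c \<Longrightarrow> lform x (\<lambda>u. k * l u) (\<bar>k\<bar> * c)"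
  unfolding lform_def by (simp add: abs_mult mult.assoc mult_left_mono)

lemma lform_cong: "lform x l c \<Longrightarrow> (\<And>u. u \<in> tangent x \<Longrightarrow> l' u = l u) \<Longrightarrow> lform x l' c"
  unfolding lform_def by simp

lemma bform_mono:
  assumes "x \<in> hyp" "bform x H c" "c \<le> d"
  shows "bform x H d"
  unfolding bform_def
proof (intro ballI)
  fix u w assume uw: "u \<in> tangent x" "w \<in> tangent x"
  have "c * hnorm u * hnorm w \<le> d * hnorm u * hnorm w"
    by (intro mult_right_mono hnorm_nonneg[OF assms(1)] uw assms(3))
  moreover have "\<bar>H u w\<bar> \<le> c * hnorm u * hnorm w"
    using assms(2) uw by (simp add: bform_def)
  ultimately show "\<bar>H u w\<bar> \<le> d * hnorm u * hnorm w" by linarith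
qed

lemma bform_add: "bform x H c \<Longrightarrow> bform x K d \<Longrightarrow> bform x (\<lambda>u w. H u w + K u w) (c + d)"
  unfolding bform_def
proof (intro ballI)
  fix u w assume "\<forall>u\<in>tangent x. \<forall>w\<in>tangent x. \<bar>H u w\<bar> \<le> c * hnorm u * hnorm w"
    "\<forall>u\<in>tangent x. \<forall>w\<in>tangent x. \<bar>K u w\<bar> \<le> d * hnorm u * hnorm w" "u \<in> tangent x" "w \<in> tangent x"
  then have "\<bar>H u w\<bar> \<le> c * hnorm u * hnorm w" "\<bar>K u w\<bar> \<le> d * hnorm u * hnorm w" by auto
  then show "\<bar>H u w + K u w\<bar> \<le> (c + d) * hnorm u * hnorm w"
    by (simp add: distrib_right)
qed

lemma bform_scale: "bform x H c \<Longrightarrow> bform x (\<lambda>u w. k * H u w) (\<bar>k\<bar> * c)"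
  unfolding bform_def by (simp add: abs_mult mult.assoc mult_left_mono)

lemma bform_prod: "lform x l c \<Longrightarrow> lform x m d \<Longrightarrow> bform x (\<lambda>u w. l u * m w) (c * d)"
  unfolding bform_def
proof (intro ballI)
  fix u w assume "lform x l c" "lform x m d" "u \<in> tangent x" "w \<in> tangent x"
  then have *: "\<bar>l u\<bar> \<le> c * hnorm u" "\<bar>m w\<bar> \<le> d * hnorm w" by (auto simp: lform_def)
  have "\<bar>l u\<bar> * \<bar>m w\<bar> \<le> (c * hnorm u) * (d * hnorm w)"
    by (rule mult_mono) (use * in auto)
  then show "\<bar>l u * m w\<bar> \<le> c * d * hnorm u * hnorm w"
    by (simp add: abs_mult mult_ac)
qed

lemma bform_mink: "x \<in> hyp \<Longrightarrow> bform x mink 1"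
  unfolding bform_def by (simp add: tangent_cauchy_schwarz)

lemma bform_cong:
  "bform x H c \<Longrightarrow> (\<And>u w. u \<in> tangent x \<Longrightarrow> w \<in> tangent x \<Longrightarrow> H' u w = H u w) \<Longrightarrow> bform x H' c"
  unfolding bform_def by simp

lemma lform_lin_grad: "x \<in> hyp \<Longrightarrow> q \<in> hyp \<Longrightarrow> lform x (mink (lin_grad q x)) (- mink x q)"
  unfolding lform_def using hyp_form_bound[of x _ q] by (simp add: mink_lin_grad)

lemma lform_D: "lform x l c \<Longrightarrow> u \<in> tangent x \<Longrightarrow> \<bar>l u\<bar> \<le> c * hnorm u"
  by (simp add: lform_def)

lemma bform_D: "bform x H c \<Longrightarrow> u \<in> tangent x \<Longrightarrow> w \<in> tangent x \<Longrightarrow> \<bar>H u w\<bar> \<le> c * hnorm u * hnorm w"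
  by (simp add: bform_def)

section \<open>Cut-off functions centred at the queries\<close>

text \<open>With \<open>d\<close> the distance to \<open>p\<close>, this is
  \<open>1 / cosh d ^ 2\<close>. The exponent matches the factor \<open>(- mink x p)\<^sup>2\<close>
  by which estimates made at \<open>p\<close> deteriorate at \<open>x\<close>, see
  \<open>A_difference_transfer\<close>.\<close>

definition chi :: "'a::euclidean_space \<times> real \<Rightarrow> 'a \<times> real \<Rightarrow> real" where
  "chi p x = inverse (- mink x p) ^ 2"

definition chi_grad :: "'a::euclidean_space \<times> real \<Rightarrow> 'a \<times> real \<Rightarrow> 'a \<times> real" where
  "chi_grad p x = (- 2 * inverse (- mink x p) ^ 3) *\<^sub>R lin_grad p x"

definition chi_hess ::
  "'a::euclidean_space \<times> real \<Rightarrow> 'a \<times> real \<Rightarrow> 'a \<times> real \<Rightarrow> 'a \<times> real \<Rightarrow> real" where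
  "chi_hess p x u w = - 2 * inverse (- mink x p) ^ 3 * (- mink x p * mink u w) +
     6 * inverse (- mink x p) ^ 4 * (mink (lin_grad p x) u * mink (lin_grad p x) w)"

lemma has_hhess_chi:
  assumes "p \<in> hyp"
  shows "has_hhess (chi p) (chi_grad p) (chi_hess p)"
proof -
  have i: "(inverse has_real_derivative - (inverse t ^ 2)) (at t)" if "t \<noteq> 0" for t :: real
    using DERIV_inverse[OF that] by (simp add: numeral_2_eq_2)
  have "has_hhess (\<lambda>x. inverse (- mink x p) ^ 2) (\<lambda>x. (- 2 * inverse (- mink x p) ^ 3) *\<^sub>R lin_grad p x)
    (\<lambda>x u w. (- 2 * inverse (- mink x p) ^ 3) * (- mink x p * mink u w) +
      (6 * inverse (- mink x p) ^ 4) * (mink (lin_grad p x) u * mink (lin_grad p x) w))"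
  proof (rule has_hhess_compose[OF has_hhess_linear])
    fix x :: "'a \<times> real" assume x: "x \<in> hyp"
    define t where "t = - mink x p"
    have "t \<noteq> 0" using hyp_mink_ge_1[OF x assms] by (simp add: t_def)
    note i = i[OF this]
    have "((\<lambda>t. inverse t ^ 2) has_real_derivative - 2 * inverse t ^ 3) (at t)"
      using DERIV_power[OF i, of 2] by (simp add: power2_eq_square power3_eq_cube)
    then show "((\<lambda>t. inverse t ^ 2) has_real_derivative - 2 * inverse (- mink x p) ^ 3) (at (- mink x p))"
      unfolding t_def .
    have "((\<lambda>t. - 2 * inverse t ^ 3) has_real_derivative - 2 * (3 * (- (inverse t ^ 2) * inverse t ^ 2))) (at t)"
      using DERIV_cmult[OF DERIV_power[OF i, of 3], of "- 2"] by simp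
    moreover have "- 2 * (3 * (- (inverse t ^ 2) * inverse t ^ 2)) = 6 * inverse t ^ 4"
      by (simp add: power2_eq_square power4_eq_xxxx)
    ultimately show "((\<lambda>t. - 2 * inverse t ^ 3) has_real_derivative 6 * inverse (- mink x p) ^ 4) (at (- mink x p))"
      unfolding t_def by metis
  qed
  then show ?thesis by (simp add: chi_def[abs_def] chi_grad_def[abs_def] chi_hess_def[abs_def])
qed

text \<open>The derivatives are bounded by multiples of \<open>chi\<close> and not merely by
  constants, because they too must cancel the growth of the error that they multiply.\<close>

lemma chi_bounds:
  assumes "p \<in> hyp" "x \<in> hyp"
  shows "0 < chi p x" "chi p x \<le> 1" "chi p x * (- mink x p)\<^sup>2 = 1"
    "lform x (mink (chi_grad p x)) (2 * chi p x)" "bform x (chi_hess p x) (8 * chi p x)"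
proof -
  define c where "c = - mink x p"
  define i where "i = inverse c"
  have c: "c \<ge> 1" using hyp_mink_ge_1[OF assms(2,1)] by (simp add: c_def)
  have i: "0 < i" "i \<le> 1" "i * c = 1" using c by (simp_all add: i_def inverse_le_1_iff)
  have chi: "chi p x = i ^ 2" by (simp add: chi_def c_def i_def)
  have ic: "i ^ 3 * c = i ^ 2" "i ^ 4 * (c * c) = i ^ 2"
  proof -
    have "i ^ 3 * c = i ^ 2 * (i * c)" by (simp only: power2_eq_square power3_eq_cube mult.assoc)
    then show "i ^ 3 * c = i ^ 2" by (simp add: i)
    have "i ^ 4 * (c * c) = i ^ 2 * (i * c) * (i * c)"
      by (simp only: power2_eq_square power4_eq_xxxx mult_ac)
    then show "i ^ 4 * (c * c) = i ^ 2" by (simp add: i)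
  qed
  show "0 < chi p x" "chi p x \<le> 1" using i by (simp_all add: chi power_le_one)
  show "chi p x * (- mink x p)\<^sup>2 = 1"
    using i(3) unfolding chi c_def[symmetric] power_mult_distrib[symmetric] by simp
  have l: "lform x (mink (lin_grad p x)) c" unfolding c_def by (rule lform_lin_grad) fact+
  show "lform x (mink (chi_grad p x)) (2 * chi p x)"
  proof (rule lform_mono[OF assms(2) lform_cong[OF lform_scale[OF l]]])
    show "mink (chi_grad p x) u = (- 2 * i ^ 3) * mink (lin_grad p x) u" for u
      by (simp add: chi_grad_def c_def i_def mink.scaleR_left mink.minus_left)
    show "\<bar>- 2 * i ^ 3\<bar> * c \<le> 2 * chi p x"
      using i ic(1) by (simp add: chi abs_mult)
  qed
  show "bform x (chi_hess p x) (8 * chi p x)"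
  proof (rule bform_mono[OF assms(2) bform_cong[OF bform_add[OF bform_scale[OF bform_mink[OF assms(2)]] bform_scale[OF bform_prod[OF l l]]]]])
    show "chi_hess p x u w = (- 2 * i ^ 3 * c) * mink u w +
        (6 * i ^ 4) * (mink (lin_grad p x) u * mink (lin_grad p x) w)" for u w
      by (simp add: chi_hess_def c_def i_def)
    show "\<bar>- 2 * i ^ 3 * c\<bar> * 1 + \<bar>6 * i ^ 4\<bar> * (c * c) \<le> 8 * chi p x"
      using i ic c by (simp add: chi abs_mult)
  qed
qed

lemma chi_at: "p \<in> hyp \<Longrightarrow> chi p p = 1" "p \<in> hyp \<Longrightarrow> chi_grad p p = 0"
  by (simp_all add: chi_def chi_grad_def lin_grad_def tproj_def hyp_def)

lemma C_infinity_chi: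
  assumes "p \<in> hyp"
  shows "C_infinity (chi p)"
proof -
  have "C_infinity (\<lambda>x. inverse (- mink x p))"
    by (rule C_infinity_inverse[OF C_infinity_minus[OF C_infinity_mink]])
       (use hyp_mink_ge_1[OF _ assms] in fastforce)
  from C_infinity_mult[OF this this] show ?thesis
    by (simp add: chi_def[abs_def] power2_eq_square)
qed

lemma lform_product:
  assumes "lform x (mink G) c" "lform x (mink G') c'"
  shows "lform x (mink (a *\<^sub>R G' + a' *\<^sub>R G)) (\<bar>a\<bar> * c' + \<bar>a'\<bar> * c)"
  by (rule lform_cong[OF lform_add[OF lform_scale[OF assms(2), of a] lform_scale[OF assms(1), of a']]])
     (simp add: mink_simps)

lemma bform_product:
  assumes "lform x (mink G) c" "lform x (mink G') c'" "bform x H h" "bform x H' h'"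
  shows "bform x (\<lambda>u w. a * H' u w + a' * H u w + mink G u * mink G' w + mink G' u * mink G w)
    (\<bar>a\<bar> * h' + \<bar>a'\<bar> * h + c * c' + c' * c)"
  by (intro bform_add bform_scale bform_prod assms)

lemma exp_3_le: "exp (3 :: real) \<le> 27"
proof -
  have "exp (3 :: real) = exp 1 ^ 3" by (simp flip: exp_of_nat_mult)
  also have "\<dots> \<le> 3 ^ 3" by (rule power_mono) (use exp_le in auto)
  finally show ?thesis by simp
qed

section \<open>Agreement to first order, sublevel sets\<close>

definition first_order_agree ::
  "('a::euclidean_space \<times> real \<Rightarrow> real) \<Rightarrow> ('a \<times> real \<Rightarrow> real) \<Rightarrow> 'a \<times> real \<Rightarrow> bool" where
  "first_order_agree f g x \<longleftrightarrow> f x = g x \<and> (\<exists>d. has_hgrad f d x \<and> has_hgrad g d x)"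

lemma first_order_agreeI:
  "f x = g x \<Longrightarrow> has_hgrad f d x \<Longrightarrow> has_hgrad g d x \<Longrightarrow> first_order_agree f g x"
  unfolding first_order_agree_def by blast

lemma first_order_agreeE:
  assumes "first_order_agree f g x"
  obtains d where "f x = g x" "has_hgrad f d x" "has_hgrad g d x"
  using assms unfolding first_order_agree_def by blast

lemma first_order_agree_refl: "has_hgrad f d x \<Longrightarrow> first_order_agree f f x"
  by (rule first_order_agreeI[OF refl])

lemma first_order_agree_add:
  assumes "first_order_agree f f' x" "first_order_agree g g' x"
  shows "first_order_agree (\<lambda>x. f x + g x) (\<lambda>x. f' x + g' x) x"
proof -
  obtain d where d: "f x = f' x" "has_hgrad f d x" "has_hgrad f' d x"
    using assms(1) by (rule first_order_agreeE)
  obtain e where e: "g x = g' x" "has_hgrad g e x" "has_hgrad g' e x"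
    using assms(2) by (rule first_order_agreeE)
  show ?thesis
    by (rule first_order_agreeI[OF _ has_hgrad_add[OF d(2) e(2)] has_hgrad_add[OF d(3) e(3)]])
       (simp add: d(1) e(1))
qed

lemma first_order_agree_mult:
  assumes "first_order_agree f f' x" "first_order_agree g g' x"
  shows "first_order_agree (\<lambda>x. f x * g x) (\<lambda>x. f' x * g' x) x"
proof -
  obtain d where d: "f x = f' x" "has_hgrad f d x" "has_hgrad f' d x"
    using assms(1) by (rule first_order_agreeE)
  obtain e where e: "g x = g' x" "has_hgrad g e x" "has_hgrad g' e x"
    using assms(2) by (rule first_order_agreeE)
  show ?thesis
    by (rule first_order_agreeI[OF _ has_hgrad_mult[OF d(2) e(2)] has_hgrad_mult[OF d(3) e(3), folded d(1) e(1)]])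
       (simp add: d(1) e(1))
qed

text \<open>Only the run on \<open>f\<close> is inspected: as long as the answers coincide, the run
  on \<open>g\<close> asks the same queries.\<close>

lemma run_history_agree:
  assumes "\<And>j. j < k \<Longrightarrow> iterate A f j \<in> hyp \<and> first_order_agree f g (iterate A f j)"
  shows "run_history A f k = run_history A g k"
  using assms
proof (induction k)
  case (Suc k)
  then have IH: "run_history A f k = run_history A g k" by simp
  define x where "x = iterate A f k"
  have "x \<in> hyp" "first_order_agree f g x" using Suc.prems[of k] by (auto simp: x_def)
  then have "f x = g x" "hgrad f x = hgrad g x"
    by (auto elim!: first_order_agreeE simp: hgrad_eq)
  then show ?case using IH by (simp add: x_def iterate_def Let_def)
qed simp

lemma run_in_hyp:
  assumes A: "first_order_algorithm A" and f: "\<And>x. x \<in> hyp \<Longrightarrow> \<exists>g. has_hgrad f g x"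
  shows "iterate A f k \<in> hyp"
proof -
  have "set (run_history A f k) \<subseteq> UNIV \<times> tangent_bundle"
  proof (induction k)
    case (Suc k)
    define x where "x = A (run_history A f k)"
    have x: "x \<in> hyp" using Suc A unfolding x_def first_order_algorithm_def by blast
    obtain g where g: "has_hgrad f g x" using f[OF x] by blast
    then have "hgrad f x \<in> tangent x" using hgrad_eq[OF x g] by (simp add: has_hgrad_def)
    then show ?case using Suc x by (simp add: x_def[symmetric] Let_def tangent_bundle_def)
  qed simp
  then show ?thesis using A unfolding iterate_def first_order_algorithm_def by blast
qed

lemma compact_hyp_sublevel:
  assumes "x0 \<in> hyp"
  shows "compact {x \<in> hyp. - mink x x0 \<le> C}"
  unfolding compact_eq_bounded_closed
proof
  have sq: "(snd p)\<^sup>2 = 1 + (norm (fst p))\<^sup>2" if "mink p p = -1" for p :: "'a \<times> real"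
    using that by (simp add: mink_self)
  \<comment> \<open>The sign condition on the time coordinate may be relaxed to a closed one, since
    \<open>mink p p = -1\<close> excludes the value 0.\<close>
  have "{x \<in> hyp. - mink x x0 \<le> C} = {x. mink x x = -1} \<inter> {x. 0 \<le> snd x} \<inter> {x. - mink x x0 \<le> C}"
  proof -
    have "snd p \<noteq> 0" if "mink p p = -1" for p :: "'a \<times> real"
      using sq[OF that] add_pos_nonneg[of 1 "(norm (fst p))\<^sup>2"] by auto
    then show ?thesis by (auto simp: hyp_def less_le)
  qed
  moreover have "continuous_on UNIV (\<lambda>x :: 'a \<times> real. mink x x)" "continuous_on UNIV (\<lambda>x :: 'a \<times> real. - mink x x0)"
    by (auto intro!: continuous_on_mink continuous_intros)
  ultimately show "closed {x \<in> hyp. - mink x x0 \<le> C}"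
    by (auto intro!: closed_Int closed_Collect_eq closed_Collect_le continuous_intros)
  define o' :: "'a \<times> real" where "o' = (0, 1)"
  have o': "o' \<in> hyp" by (simp add: o'_def hyp_def mink_def)
  show "bounded {x \<in> hyp. - mink x x0 \<le> C}"
    unfolding bounded_iff
  proof (intro exI ballI)
    fix x assume x: "x \<in> {x \<in> hyp. - mink x x0 \<le> C}"
    have m: "- mink x0 o' \<ge> 0" using hyp_mink_ge_1[OF assms o'] by simp
    have "snd x = - mink x o'" by (simp add: mink_def o'_def)
    also have "\<dots> \<le> 2 * (- mink x x0) * (- mink x0 o')" using hyp_triangle[OF _ assms o'] x by blast
    also have "\<dots> \<le> 2 * C * (- mink x0 o')"
      using x by (intro mult_right_mono[OF _ m]) auto
    finally have 1: "snd x \<le> 2 * C * (- mink x0 o')" .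
    have s: "snd x > 0" "(norm (fst x))\<^sup>2 \<le> (snd x)\<^sup>2" using x sq[of x] by (auto simp: hyp_def)
    then have "norm (fst x) \<le> snd x" using power2_le_imp_le by fastforce
    then have "norm x \<le> 2 * snd x"
      using norm_Pair_le[of "fst x" "snd x"] s(1) by simp
    then show "norm x \<le> 2 * (2 * C * (- mink x0 o'))" using 1 by linarith
  qed
qed

lemma has_hhess_continuous_on:
  assumes "has_hhess f G H" "S \<subseteq> hyp"
  shows "continuous_on S f"
proof -
  have "continuous (at x within hyp) f" if "x \<in> hyp" for x
    using has_hhess_grad[OF assms(1) that] has_derivative_continuous[of f _ x hyp]
    unfolding has_hgrad_def by blast
  then have "continuous_on hyp f" by (simp add: continuous_on_eq_continuous_within)
  then show ?thesis using assms(2) by (rule continuous_on_subset)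
qed

section \<open>The candidate minimizers\<close>

text \<open>
  The candidate minimizers \<open>pt s\<close>, \<open>0 \<le> s \<le> 1\<close>, lie on a horocycle: in the upper half-plane model they
  are the points \<open>(s, exp (- R))\<close>, and \<open>x0\<close> is \<open>(0, 1)\<close>.  In these coordinates \<open>foot x\<close> is the
  horizontal coordinate of \<open>x\<close> and \<open>1 / N x\<close> is its height.
\<close>

locale horocycle_family =
  fixes x0 e1 e2 :: "'a::euclidean_space \<times> real" and R :: real
  assumes x0: "x0 \<in> hyp"
    and e_tangent: "e1 \<in> tangent x0" "e2 \<in> tangent x0"
    and e_orthonormal: "mink e1 e1 = 1" "mink e2 e2 = 1" "mink e1 e2 = 0"
    and R: "R \<ge> 1"
begin

definition ht :: real where "ht = exp (- R)"

definition pt :: "real \<Rightarrow> 'a \<times> real" where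
  "pt s = ((s\<^sup>2 + ht\<^sup>2 + 1) / (2 * ht)) *\<^sub>R x0 + (s / ht) *\<^sub>R e1 + ((s\<^sup>2 + ht\<^sup>2 - 1) / (2 * ht)) *\<^sub>R e2"

definition F :: "'a \<times> real \<Rightarrow> real" where "F x = - mink x x0"
definition A :: "real \<Rightarrow> 'a \<times> real \<Rightarrow> real" where "A s x = - mink x (pt s)"
text \<open>\<open>x0 + e2\<close> is lightlike. It represents the ideal point at which the
  horocycle is centred, and \<open>ln (N x)\<close> is the Busemann function of that point.\<close>

definition N :: "'a \<times> real \<Rightarrow> real" where "N x = - mink x (x0 + e2)"
definition foot :: "'a \<times> real \<Rightarrow> real" where "foot x = mink x e1 / N x"

lemma ht: "0 < ht" "ht \<le> 1"
  using R by (simp_all add: ht_def)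

lemma frame_products:
  "mink x0 x0 = -1" "mink x0 e1 = 0" "mink e1 x0 = 0" "mink x0 e2 = 0" "mink e2 x0 = 0" "mink e2 e1 = 0"
  using x0 e_tangent e_orthonormal by (auto simp: hyp_def tangent_def mink_commute[of e1 x0]
      mink_commute[of e2 x0] mink_commute[of e2 e1])

lemma pt_product: "mink (pt s) (pt t) = - 1 - (s - t)\<^sup>2 / (2 * ht\<^sup>2)"
  using ht(1) by (simp add: pt_def mink_simps frame_products e_orthonormal field_simps power2_eq_square)

lemma F_pt: "F (pt s) = (s\<^sup>2 + ht\<^sup>2 + 1) / (2 * ht)"
  by (simp add: F_def pt_def mink_simps frame_products)

lemma pt_in_hyp: "pt s \<in> hyp"
proof (rule in_hyp_if_future[OF _ x0])
  show "mink (pt s) (pt s) = -1" by (simp add: pt_product)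
  have "F (pt s) > 0" using ht(1) by (simp add: F_pt add_nonneg_pos)
  then show "mink (pt s) x0 < 0" by (simp add: F_def)
qed

lemma F_pt_le: "s \<in> {0..1} \<Longrightarrow> F (pt s) \<le> 3 / (2 * ht)"
proof -
  assume s: "s \<in> {0..1}"
  have "s\<^sup>2 \<le> 1" "ht\<^sup>2 \<le> 1" using s ht by (simp_all add: power_le_one)
  then show ?thesis unfolding F_pt using ht(1) by (intro divide_right_mono) auto
qed

lemma F_ge_1: "x \<in> hyp \<Longrightarrow> F x \<ge> 1"
  using hyp_mink_ge_1[OF _ x0] by (simp add: F_def)

lemma A_ge_1: "x \<in> hyp \<Longrightarrow> A s x \<ge> 1"
  using hyp_mink_ge_1[OF _ pt_in_hyp] by (simp add: A_def)

text \<open>Bessel's inequality in the tangent space at \<open>x0\<close>; in dimension above 2 the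
  frame is incomplete and equality may fail.\<close>

lemma frame_bessel:
  assumes "x \<in> hyp"
  shows "(F x)\<^sup>2 \<ge> 1 + (mink x e1)\<^sup>2 + (mink x e2)\<^sup>2"
proof -
  define v where "v = tproj x0 x - mink x e1 *\<^sub>R e1 - mink x e2 *\<^sub>R e2"
  have t: "tproj x0 x \<in> tangent x0" by (rule tproj_in_tangent[OF x0])
  have "v \<in> tangent x0"
    unfolding v_def by (intro tangent_diff tangent_scaleR t e_tangent)
  then have "0 \<le> mink v v" using tangent_mink_nonneg(1)[OF x0] by blast
  also have "mink v v = mink (tproj x0 x) (tproj x0 x) - (mink x e1)\<^sup>2 - (mink x e2)\<^sup>2"
    by (simp add: v_def mink_simps mink_tproj e_tangent e_orthonormal frame_products
        mink_commute[of e1 "tproj x0 x"] mink_commute[of e2 "tproj x0 x"] power2_eq_square)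
  also have "mink (tproj x0 x) (tproj x0 x) = (F x)\<^sup>2 - 1"
    using assms by (simp add: mink_tproj_self[OF x0] F_def hyp_def mink_commute[of x0 x])
  finally show ?thesis by simp
qed

lemma N_pos:
  assumes "x \<in> hyp"
  shows "N x > 0" "N x * (F x + mink x e2) \<ge> 1 + (mink x e1)\<^sup>2"
proof -
  have "(mink x e2)\<^sup>2 < (F x)\<^sup>2" using frame_bessel[OF assms] zero_le_power2[of "mink x e1"] by linarith
  then have "\<bar>mink x e2\<bar> < F x" using F_ge_1[OF assms] power2_less_imp_less[of "\<bar>mink x e2\<bar>" "F x"] by simp
  moreover have N: "N x = F x - mink x e2" by (simp add: N_def F_def mink_simps)
  ultimately show "N x > 0" by simp
  show "N x * (F x + mink x e2) \<ge> 1 + (mink x e1)\<^sup>2"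
    using frame_bessel[OF assms] by (simp add: N algebra_simps power2_eq_square)
qed

text \<open>A version of the half-plane formula that expresses \<open>cosh\<close> of the distance
  by the squared Euclidean distance over twice the product of the heights. Only the first square
  contains \<open>s\<close>, so changing \<open>s\<close> produces a difference of two
  squares.\<close>

lemma A_complete_square:
  "2 * ht * N x * A s x = (s * N x - mink x e1)\<^sup>2 - (mink x e1)\<^sup>2 + ht\<^sup>2 * (N x)\<^sup>2 + N x * (F x + mink x e2)"
proof -
  have N: "N x = F x - mink x e2" by (simp add: N_def F_def mink_simps)
  have "2 * ht * A s x = (s\<^sup>2 + ht\<^sup>2 + 1) * F x - 2 * s * mink x e1 - (s\<^sup>2 + ht\<^sup>2 - 1) * mink x e2"
    using ht(1) by (simp add: A_def pt_def mink_simps F_def field_simps)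
  then have "2 * ht * N x * A s x =
      N x * ((s\<^sup>2 + ht\<^sup>2 + 1) * F x - 2 * s * mink x e1 - (s\<^sup>2 + ht\<^sup>2 - 1) * mink x e2)"
    by (metis mult.left_commute mult.assoc)
  also have "\<dots> = (s * N x - mink x e1)\<^sup>2 - (mink x e1)\<^sup>2 + ht\<^sup>2 * (N x)\<^sup>2 + N x * (F x + mink x e2)"
    unfolding N by (simp add: algebra_simps power2_eq_square)
  finally show ?thesis .
qed

lemma A_lower:
  assumes "x \<in> hyp"
  shows "2 * ht * N x * A s x \<ge> (s * N x - mink x e1)\<^sup>2 + 1"
  using N_pos(2)[OF assms] zero_le_power2[of "ht * N x"]
  unfolding A_complete_square power_mult_distrib by linarith

lemma foot_offset: "x \<in> hyp \<Longrightarrow> s * N x - mink x e1 = N x * (s - foot x)"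
  using N_pos(1)[of x] by (simp add: foot_def field_simps)

text \<open>The inequality \<open>2 * d \<le> d\<^sup>2 + 1\<close> eliminates the height of
  \<open>x\<close>: at any height, a point whose foot is far from \<open>s\<close> is far from
  \<open>pt s\<close>. The gap at the queries rests on this.\<close>

lemma A_ge_foot:
  assumes "x \<in> hyp"
  shows "\<bar>s - foot x\<bar> \<le> ht * A s x"
proof -
  define d where "d = \<bar>N x * (s - foot x)\<bar>"
  have "0 \<le> (d - 1)\<^sup>2" by simp
  then have "2 * d \<le> d\<^sup>2 + 1" by (simp add: power2_diff)
  also have "\<dots> \<le> 2 * ht * N x * A s x"
    using A_lower[OF assms, of s] by (simp add: d_def foot_offset[OF assms])
  finally have "N x * \<bar>s - foot x\<bar> \<le> N x * (ht * A s x)"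
    using N_pos(1)[OF assms] by (simp add: d_def abs_mult mult_ac)
  then show ?thesis using N_pos(1)[OF assms] by simp
qed

text \<open>The condition is symmetric in \<open>s\<close> and \<open>t\<close> because
  \<open>nu_difference\<close> divides by \<open>Q s\<close> as well as by
  \<open>Q t\<close>.\<close>

definition separated :: "'a \<times> real \<Rightarrow> real \<Rightarrow> real \<Rightarrow> real \<Rightarrow> bool" where
  "separated p s t k \<longleftrightarrow> \<bar>s - t\<bar> \<le> k * \<bar>s - foot p\<bar> \<and> \<bar>s - t\<bar> \<le> k * \<bar>t - foot p\<bar>"

lemma separated_commute: "separated p s t k \<Longrightarrow> separated p t s k"
  by (simp add: separated_def abs_minus_commute)

text \<open>With the scaled offsets \<open>d\<close> and \<open>e\<close>, the difference is a
  multiple of \<open>d\<^sup>2 - e\<^sup>2\<close>; of its two factors, one is small by separation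
  and the other is comparable to \<open>d\<close>. The second bound controls the Minkowski norm of
  \<open>pt s - pt t\<close>.\<close>

lemma A_difference:
  assumes p: "p \<in> hyp" and k: "0 \<le> k" "k \<le> 1" and sep: "separated p s t k"
  shows "\<bar>A s p - A t p\<bar> \<le> 3 * k * A s p" "\<bar>s - t\<bar> / ht \<le> k * A s p"
proof -
  define d e where "d = N p * (s - foot p)" and "e = N p * (t - foot p)"
  have n: "N p > 0" by (rule N_pos(1)[OF p])
  have st: "\<bar>s - t\<bar> \<le> k * \<bar>s - foot p\<bar>" using sep by (simp add: separated_def)
  have kd: "\<bar>d - e\<bar> \<le> k * \<bar>d\<bar>"
  proof -
    have "\<bar>d - e\<bar> = N p * \<bar>s - t\<bar>" using n by (simp add: d_def e_def abs_mult flip: right_diff_distrib)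
    also have "\<dots> \<le> N p * (k * \<bar>s - foot p\<bar>)" using st n by simp
    also have "\<dots> = k * \<bar>d\<bar>" using n by (simp add: d_def abs_mult)
    finally show ?thesis .
  qed
  also have "k * \<bar>d\<bar> \<le> 1 * \<bar>d\<bar>" using k(2) by (intro mult_right_mono) auto
  finally have "\<bar>d + e\<bar> \<le> 3 * \<bar>d\<bar>" by linarith
  then have "\<bar>d - e\<bar> * \<bar>d + e\<bar> \<le> (k * \<bar>d\<bar>) * (3 * \<bar>d\<bar>)"
    using kd by (intro mult_mono) auto
  also have "\<dots> = 3 * k * d\<^sup>2" by (simp add: power2_eq_square)
  also have "\<bar>d - e\<bar> * \<bar>d + e\<bar> = \<bar>d\<^sup>2 - e\<^sup>2\<bar>"
    by (simp add: abs_mult[symmetric] algebra_simps power2_eq_square)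
  finally have de: "\<bar>d\<^sup>2 - e\<^sup>2\<bar> \<le> 3 * k * d\<^sup>2" .
  have "2 * ht * N p * (A s p - A t p) = d\<^sup>2 - e\<^sup>2"
    using A_complete_square[of p s] A_complete_square[of p t]
    by (simp add: d_def e_def right_diff_distrib foot_offset[OF p])
  then have "2 * ht * N p * \<bar>A s p - A t p\<bar> = \<bar>d\<^sup>2 - e\<^sup>2\<bar>"
    using ht(1) n abs_mult[of "2 * ht * N p" "A s p - A t p"] by simp
  also have "\<dots> \<le> 3 * k * d\<^sup>2" by (rule de)
  also have "\<dots> \<le> 3 * k * (2 * ht * N p * A s p)"
    using A_lower[OF p, of s] k(1) by (intro mult_left_mono) (simp_all add: d_def foot_offset[OF p])
  finally have "(2 * ht * N p) * \<bar>A s p - A t p\<bar> \<le> (2 * ht * N p) * (3 * k * A s p)" by (simp add: mult_ac)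
  then show "\<bar>A s p - A t p\<bar> \<le> 3 * k * A s p" using ht(1) n by (simp add: mult_le_cancel_left)
  have "\<bar>s - t\<bar> \<le> k * (ht * A s p)"
    using st mult_left_mono[OF A_ge_foot[OF p, of s] k(1)] by linarith
  then show "\<bar>s - t\<bar> / ht \<le> k * A s p" using ht(1) by (simp add: field_simps)
qed

lemma pt_diff_square: "mink (pt s - pt t) (pt s - pt t) = (\<bar>s - t\<bar> / ht)\<^sup>2"
  using ht(1) by (simp add: mink_simps pt_product power_divide power2_commute[of t s])

text \<open>One factor \<open>- mink x p\<close> comes from transferring the form
  \<open>pt s - pt t\<close> from \<open>p\<close> to \<open>x\<close>, the other from replacing
  \<open>A s p\<close> by \<open>A s x\<close>.\<close>

lemma A_difference_transfer:
  assumes x: "x \<in> hyp" and p: "p \<in> hyp" and k: "0 \<le> k" "k \<le> 1" and sep: "separated p s t k"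
  shows "\<bar>s - t\<bar> / ht + \<bar>A s x - A t x\<bar> \<le> 16 * k * (- mink x p)\<^sup>2 * A s x"
proof -
  define c m where "c = - mink x p" and "m = \<bar>s - t\<bar> / ht"
  have c: "c \<ge> 1" using hyp_mink_ge_1[OF x p] by (simp add: c_def)
  have m: "m \<ge> 0" "m \<le> k * A s p"
    using A_difference(2)[OF p k sep] ht(1) by (simp_all add: m_def)
  have diff: "A s y - A t y = - mink y (pt s - pt t)" for y
    by (simp add: A_def mink_simps)
  have A0: "0 \<le> A s p" using A_ge_1[OF p, of s] by simp
  have "\<bar>mink p (pt s - pt t)\<bar> \<le> 3 * k * A s p"
    using A_difference(1)[OF p k sep] by (simp add: diff)
  then have "2 * \<bar>mink p (pt s - pt t)\<bar> + m \<le> 7 * (k * A s p)" using m by simp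
  have "\<bar>A s x - A t x\<bar> \<le> c * (2 * \<bar>mink p (pt s - pt t)\<bar> + m)"
    using spacelike_transfer[OF x p pt_diff_square, of s t] m(1) by (simp add: diff c_def m_def)
  also have "\<dots> \<le> c * (7 * (k * A s p))"
    by (rule mult_left_mono) (use \<open>2 * _ + m \<le> _\<close> c in auto)
  finally have 1: "\<bar>A s x - A t x\<bar> \<le> 7 * (c * (k * A s p))" by simp
  have "1 * (k * A s p) \<le> c * (k * A s p)"
    by (rule mult_right_mono) (use c k A0 in auto)
  then have "m + \<bar>A s x - A t x\<bar> \<le> 8 * (c * k * A s p)" using 1 m(2) by simp
  also have "A s p \<le> 2 * c * A s x"
    using hyp_triangle[OF p x pt_in_hyp, of s] by (simp add: A_def c_def mink_commute[of p x])
  then have "8 * (c * k * A s p) \<le> 8 * (c * k * (2 * c * A s x))"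
    using c k by (intro mult_left_mono) auto
  finally show ?thesis by (simp add: c_def m_def power2_eq_square mult_ac)
qed

subsection \<open>The hidden potential\<close>

text \<open>
  The second summand of \<open>Q\<close> is at most \<open>9 / 4\<close> at the candidates.  Far away it dominates, and makes the
  dependence of \<open>nu s\<close> on \<open>s\<close> decay at least as fast as \<open>E\<close>, hence as the Hessian of \<open>phi\<close> below.
\<close>

definition Q :: "real \<Rightarrow> 'a \<times> real \<Rightarrow> real" where "Q s x = A s x + ht\<^sup>2 * (F x)\<^sup>2"

definition Q_grad :: "real \<Rightarrow> 'a \<times> real \<Rightarrow> 'a \<times> real" where
  "Q_grad s x = lin_grad (pt s) x + (2 * ht\<^sup>2 * F x) *\<^sub>R lin_grad x0 x"

definition Q_hess :: "real \<Rightarrow> 'a \<times> real \<Rightarrow> 'a \<times> real \<Rightarrow> 'a \<times> real \<Rightarrow> real" where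
  "Q_hess s x u w = (A s x + 2 * ht\<^sup>2 * (F x)\<^sup>2) * mink u w +
     (2 * ht\<^sup>2) * (mink (lin_grad x0 x) u * mink (lin_grad x0 x) w)"

definition nu :: "real \<Rightarrow> 'a \<times> real \<Rightarrow> real" where "nu s x = ln (Q s x)"

definition nu_grad :: "real \<Rightarrow> 'a \<times> real \<Rightarrow> 'a \<times> real" where
  "nu_grad s x = inverse (Q s x) *\<^sub>R Q_grad s x"

definition nu_hess :: "real \<Rightarrow> 'a \<times> real \<Rightarrow> 'a \<times> real \<Rightarrow> 'a \<times> real \<Rightarrow> real" where
  "nu_hess s x u w = inverse (Q s x) * Q_hess s x u w - mink (nu_grad s x) u * mink (nu_grad s x) w"

definition E :: "'a \<times> real \<Rightarrow> real" where "E x = F x powr (- 1 / R)"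

lemma has_hhess_F: "has_hhess F (lin_grad x0) (\<lambda>x u w. F x * mink u w)"
  unfolding F_def[abs_def] by (rule has_hhess_linear)

lemma has_hhess_A: "has_hhess (A s) (lin_grad (pt s)) (\<lambda>x u w. A s x * mink u w)"
  unfolding A_def[abs_def] by (rule has_hhess_linear)

lemma has_hhess_Q: "has_hhess (Q s) (Q_grad s) (Q_hess s)"
proof -
  have "Q s = (\<lambda>x. A s x + ht\<^sup>2 * (F x * F x))" by (simp add: Q_def fun_eq_iff power2_eq_square)
  moreover have "Q_grad s = (\<lambda>x. lin_grad (pt s) x + ht\<^sup>2 *\<^sub>R (F x *\<^sub>R lin_grad x0 x + F x *\<^sub>R lin_grad x0 x))"
    by (simp add: Q_grad_def fun_eq_iff scaleR_add_right flip: scaleR_add_left)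
  moreover have "Q_hess s = (\<lambda>x u w. A s x * mink u w + ht\<^sup>2 * (F x * (F x * mink u w) + F x * (F x * mink u w) +
      mink (lin_grad x0 x) u * mink (lin_grad x0 x) w + mink (lin_grad x0 x) u * mink (lin_grad x0 x) w))"
    by (simp add: Q_hess_def fun_eq_iff power2_eq_square algebra_simps)
  ultimately show ?thesis
    using has_hhess_add[OF has_hhess_A has_hhess_cmult[OF has_hhess_mult[OF has_hhess_F has_hhess_F]]] by simp
qed

lemma Q_pos: "x \<in> hyp \<Longrightarrow> Q s x \<ge> 1"
  using A_ge_1[of x s] by (simp add: Q_def add_increasing2)

lemma has_hhess_nu: "has_hhess (nu s) (nu_grad s) (nu_hess s)"
proof -
  have "has_hhess (\<lambda>x. ln (Q s x)) (\<lambda>x. inverse (Q s x) *\<^sub>R Q_grad s x)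
      (\<lambda>x u w. inverse (Q s x) * Q_hess s x u w + (- (inverse (Q s x) ^ 2)) * (mink (Q_grad s x) u * mink (Q_grad s x) w))"
  proof (rule has_hhess_compose[OF has_hhess_Q])
    fix x :: "'a \<times> real" assume "x \<in> hyp"
    then have "Q s x > 0" using Q_pos[of x s] by simp
    then show "(ln has_real_derivative inverse (Q s x)) (at (Q s x))"
      "(inverse has_real_derivative - (inverse (Q s x) ^ 2)) (at (Q s x))"
      using DERIV_inverse[of "Q s x"] by (auto intro!: DERIV_ln simp: numeral_2_eq_2)
  qed
  moreover have "nu_hess s = (\<lambda>x u w. inverse (Q s x) * Q_hess s x u w +
      (- (inverse (Q s x) ^ 2)) * (mink (Q_grad s x) u * mink (Q_grad s x) w))"
    by (simp add: nu_hess_def nu_grad_def fun_eq_iff mink_simps power2_eq_square)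
  ultimately show ?thesis by (simp add: nu_def[abs_def] nu_grad_def[abs_def])
qed

lemma lform_F: "x \<in> hyp \<Longrightarrow> lform x (mink (lin_grad x0 x)) (F x)"
  unfolding F_def by (rule lform_lin_grad[OF _ x0])

lemma lform_A: "x \<in> hyp \<Longrightarrow> lform x (mink (lin_grad (pt s) x)) (A s x)"
  unfolding A_def by (rule lform_lin_grad[OF _ pt_in_hyp])

lemma lform_Q: assumes "x \<in> hyp" shows "lform x (mink (Q_grad s x)) (2 * Q s x)"
proof (rule lform_mono[OF assms lform_cong[OF lform_add[OF lform_A[OF assms] lform_scale[OF lform_F[OF assms]]]]])
  show "mink (Q_grad s x) u = mink (lin_grad (pt s) x) u + (2 * ht\<^sup>2 * F x) * mink (lin_grad x0 x) u" for u
    by (simp add: Q_grad_def mink_simps)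
  show "A s x + \<bar>2 * ht\<^sup>2 * F x\<bar> * F x \<le> 2 * Q s x"
    using F_ge_1[OF assms] A_ge_1[OF assms, of s] by (simp add: Q_def abs_mult power2_eq_square)
qed

lemma bform_Q: assumes "x \<in> hyp" shows "bform x (Q_hess s x) (4 * Q s x)"
proof (rule bform_mono[OF assms bform_cong[OF bform_add[OF bform_scale[OF bform_mink[OF assms]]
        bform_scale[OF bform_prod[OF lform_F[OF assms] lform_F[OF assms]]]]]])
  show "Q_hess s x u w = (A s x + 2 * ht\<^sup>2 * (F x)\<^sup>2) * mink u w +
     (2 * ht\<^sup>2) * (mink (lin_grad x0 x) u * mink (lin_grad x0 x) w)" for u w
    by (rule Q_hess_def)
  have "A s x + 2 * ht\<^sup>2 * (F x)\<^sup>2 \<ge> 0" using A_ge_1[OF assms, of s] by simp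
  then show "\<bar>A s x + 2 * ht\<^sup>2 * (F x)\<^sup>2\<bar> * 1 + \<bar>2 * ht\<^sup>2\<bar> * (F x * F x) \<le> 4 * Q s x"
    using A_ge_1[OF assms, of s] by (simp add: Q_def power2_eq_square[of "F x"])
qed

lemma lform_nu: assumes "x \<in> hyp" shows "lform x (mink (nu_grad s x)) 2"
proof (rule lform_mono[OF assms lform_cong[OF lform_scale[OF lform_Q[OF assms]]]])
  show "mink (nu_grad s x) u = inverse (Q s x) * mink (Q_grad s x) u" for u
    by (simp add: nu_grad_def mink_simps)
  show "\<bar>inverse (Q s x)\<bar> * (2 * Q s x) \<le> 2" using Q_pos[OF assms, of s] by simp
qed

lemma bform_nu: assumes "x \<in> hyp" shows "bform x (nu_hess s x) 8"
proof (rule bform_mono[OF assms bform_cong[OF bform_add[OF bform_scale[OF bform_Q[OF assms]]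
        bform_scale[OF bform_prod[OF lform_nu[OF assms] lform_nu[OF assms]], where k = "- 1"]]]])
  show "nu_hess s x u w = inverse (Q s x) * Q_hess s x u w + - 1 * (mink (nu_grad s x) u * mink (nu_grad s x) w)" for u w
    by (simp add: nu_hess_def)
  show "\<bar>inverse (Q s x)\<bar> * (4 * Q s x) + \<bar>- 1\<bar> * (2 * 2) \<le> (8 :: real)" using Q_pos[OF assms, of s] by simp
qed

text \<open>This is the inequality between the squared derivative of \<open>Q\<close> and
  \<open>Q\<close> times its Hessian, in scalars: \<open>a\<close> and \<open>f\<close> are the
  values of \<open>A\<close> and \<open>F\<close>, \<open>s\<close> and \<open>r\<close> their
  derivatives, \<open>e\<close> is \<open>ht\<^sup>2\<close> and \<open>U\<close> the length of the
  vector. Behind it is that a sum of log-convex functions is log-convex.\<close>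

lemma log_sum_convexity:
  fixes a q e f r s U :: real
  assumes "a \<ge> 0" "f \<ge> 0" "e \<ge> 0" "\<bar>s\<bar> \<le> a * U" "\<bar>r\<bar> \<le> f * U" "U \<ge> 0"
  shows "(s + 2 * e * f * r)\<^sup>2 \<le> ((a + 2 * e * f\<^sup>2) * U\<^sup>2 + 2 * e * r\<^sup>2) * (a + e * f\<^sup>2)"
proof -
  have s2: "s\<^sup>2 \<le> a\<^sup>2 * U\<^sup>2" using power_mono[OF assms(4) abs_ge_zero, of 2] by (simp add: power_mult_distrib)
  have r2: "r\<^sup>2 \<le> f\<^sup>2 * U\<^sup>2" using power_mono[OF assms(5) abs_ge_zero, of 2] by (simp add: power_mult_distrib)
  have "s * (2 * f * r) \<le> \<bar>s\<bar> * \<bar>2 * f * r\<bar>" by (metis abs_ge_self abs_mult)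
  also have "\<dots> \<le> (a * U) * \<bar>2 * f * r\<bar>" by (rule mult_right_mono[OF assms(4)]) simp
  also have "\<dots> = a * (2 * (f * U) * \<bar>r\<bar>)" using assms(2) by (simp add: abs_mult mult_ac)
  also have "\<dots> \<le> a * (f\<^sup>2 * U\<^sup>2 + r\<^sup>2)"
    using sum_squares_bound[of "f * U" "\<bar>r\<bar>"] assms(1) by (intro mult_left_mono) (simp_all add: power_mult_distrib)
  finally have cross: "2 * e * (s * (2 * f * r)) \<le> 2 * e * (a * (f\<^sup>2 * U\<^sup>2 + r\<^sup>2))"
    using assms(3) by (intro mult_left_mono) auto
  have er: "(2 * e\<^sup>2 * f\<^sup>2) * r\<^sup>2 \<le> (2 * e\<^sup>2 * f\<^sup>2) * (f\<^sup>2 * U\<^sup>2)"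
    by (rule mult_left_mono[OF r2]) (simp add: assms)
  have "0 \<le> a * e * f\<^sup>2 * U\<^sup>2" using assms by simp
  then show ?thesis using s2 cross er by (simp add: power2_eq_square algebra_simps)
qed

lemma nu_hess_nonneg:
  assumes x: "x \<in> hyp" and u: "u \<in> tangent x"
  shows "nu_hess s x u u \<ge> 0"
proof -
  define r t where "r = mink (lin_grad x0 x) u" and "t = mink (lin_grad (pt s) x) u"
  have Q: "Q s x > 0" using Q_pos[OF x, of s] by simp
  have "(t + 2 * ht\<^sup>2 * F x * r)\<^sup>2 \<le> ((A s x + 2 * ht\<^sup>2 * (F x)\<^sup>2) * (hnorm u)\<^sup>2 + 2 * ht\<^sup>2 * r\<^sup>2) * (A s x + ht\<^sup>2 * (F x)\<^sup>2)"
  proof (rule log_sum_convexity)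
    show "\<bar>t\<bar> \<le> A s x * hnorm u" "\<bar>r\<bar> \<le> F x * hnorm u"
      using lform_D[OF lform_A[OF x] u] lform_D[OF lform_F[OF x] u] by (simp_all add: r_def t_def)
  qed (use A_ge_1[OF x, of s] F_ge_1[OF x] hnorm_nonneg[OF x u] in auto)
  then have "(mink (Q_grad s x) u)\<^sup>2 \<le> Q_hess s x u u * Q s x"
    unfolding hnorm_square[OF x u]
    by (simp add: Q_grad_def Q_hess_def Q_def mink_simps r_def t_def power2_eq_square mult.assoc)
  then have "(inverse (Q s x))\<^sup>2 * (mink (Q_grad s x) u)\<^sup>2 \<le> (inverse (Q s x))\<^sup>2 * (Q_hess s x u u * Q s x)"
    by (rule mult_left_mono) simp
  also have "(inverse (Q s x))\<^sup>2 * (Q_hess s x u u * Q s x) = inverse (Q s x) * Q_hess s x u u"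
    using Q by (simp add: power2_eq_square)
  finally show ?thesis
    by (simp add: nu_hess_def nu_grad_def mink_simps power2_eq_square mult_ac)
qed

lemma E_exp: "x \<in> hyp \<Longrightarrow> E x = exp (- ln (F x) / R)"
  using F_ge_1[of x] by (simp add: E_def powr_def)

lemma E_bounds:
  assumes "x \<in> hyp"
  shows "0 < E x" "E x \<le> 1"
proof -
  have "ln (F x) \<ge> 0" using F_ge_1[OF assms] by simp
  then show "0 < E x" "E x \<le> 1" using R by (simp_all add: E_exp[OF assms])
qed

text \<open>Two bounds compete: \<open>A \<le> Q\<close>, and \<open>A \<le> exp g * Q\<close> from
  the second summand of \<open>Q\<close>, which is better once \<open>F\<close> exceeds
  \<open>3 * exp (3 * R)\<close>. As \<open>R \<ge> 1\<close>, the smaller of \<open>1\<close> and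
  \<open>exp g\<close> is at most \<open>exp (g / R)\<close>, and this is at most
  \<open>3 * 27 * E\<close>.\<close>

lemma A_le_E:
  assumes x: "x \<in> hyp" and s: "s \<in> {0..1}"
  shows "A s x \<le> 81 * E x * Q s x"
proof -
  define g where "g = ln 3 + 3 * R - ln (F x)"
  have F: "F x \<ge> 1" by (rule F_ge_1[OF x])
  have Q: "Q s x > 0" using Q_pos[OF x, of s] by simp
  have "A s x \<le> 2 * F x * F (pt s)"
    using hyp_triangle[OF x x0 pt_in_hyp, of s] by (simp add: A_def F_def mink_commute[of x0])
  also have "\<dots> \<le> 2 * F x * (3 / (2 * ht))"
    by (rule mult_left_mono[OF F_pt_le[OF s]]) (use F in auto)
  also have "\<dots> = 3 / (ht ^ 3 * F x) * (ht\<^sup>2 * (F x)\<^sup>2)"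
    using F ht(1) by (simp add: field_simps power2_eq_square power3_eq_cube)
  also have "3 / (ht ^ 3 * F x) = exp g"
    using F by (simp add: g_def exp_add exp_diff ht_def exp_minus field_simps flip: exp_of_nat_mult)
  also have "exp g * (ht\<^sup>2 * (F x)\<^sup>2) \<le> exp g * Q s x"
    using A_ge_1[OF x, of s] by (intro mult_left_mono) (auto simp: Q_def)
  finally have 1: "A s x \<le> exp g * Q s x" .
  have 2: "A s x \<le> 1 * Q s x" by (simp add: Q_def)
  have 3: "A s x \<le> exp (g / R) * Q s x"
  proof (cases "g \<ge> 0")
    case True
    have "1 * Q s x \<le> exp (g / R) * Q s x"
      by (rule mult_right_mono) (use True R Q in auto)
    then show ?thesis using 2 by linarith
  next
    case False
    then have "g * R \<le> g * 1" using R by (intro mult_left_mono_neg) auto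
    then have "g \<le> g / R" using R by (simp add: field_simps)
    then have "exp g * Q s x \<le> exp (g / R) * Q s x"
      by (intro mult_right_mono) (use Q in auto)
    then show ?thesis using 1 by linarith
  qed
  have "g / R = ln 3 / R + 3 + - ln (F x) / R" using R by (simp add: g_def add_divide_distrib diff_divide_distrib)
  then have "exp (g / R) = exp (ln 3 / R) * exp 3 * E x" by (simp only: exp_add E_exp[OF x])
  also have "\<dots> \<le> 3 * 27 * E x"
  proof (intro mult_right_mono mult_mono exp_3_le)
    have "ln 3 / R \<le> ln 3 / 1" using R by (intro divide_left_mono) auto
    then have "exp (ln 3 / R) \<le> exp (ln 3 / 1)" by (subst exp_le_cancel_iff)
    then show "exp (ln 3 / R) \<le> 3" by simp
  qed (use E_bounds[OF x] in auto)
  finally have "exp (g / R) * Q s x \<le> 81 * E x * Q s x"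
    by (intro mult_right_mono) (use Q in auto)
  then show ?thesis using 3 by linarith
qed

text \<open>The summand with \<open>F\<close> cancels in \<open>Q s - Q t\<close>, so all three
  estimates come from \<open>A s - A t\<close> and its gradient; division by \<open>Q\<close> brings
  in \<open>E\<close> through \<open>A_le_E\<close>. The constant is \<open>16 * 81\<close>.\<close>

lemma nu_difference:
  fixes s t k :: real and x p :: "'a \<times> real"
  defines "M \<equiv> 1296 * k * (- mink x p)\<^sup>2 * E x"
  assumes x: "x \<in> hyp" and p: "p \<in> hyp" and k: "0 \<le> k" "k \<le> 1" and sep: "separated p s t k"
    and st: "s \<in> {0..1}" "t \<in> {0..1}"
  shows "\<bar>nu s x - nu t x\<bar> \<le> M"
    and "lform x (mink (nu_grad s x - nu_grad t x)) (3 * M)"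
    and "bform x (\<lambda>u w. nu_hess s x u w - nu_hess t x u w) (17 * M)"
proof -
  define m d \<tau> where "m = \<bar>s - t\<bar> / ht" and "d = \<bar>A s x - A t x\<bar>" and "\<tau> = 16 * k * (- mink x p)\<^sup>2"
  have Q: "Q s x > 0" "Q t x > 0" using Q_pos[OF x, of s] Q_pos[OF x, of t] by auto
  have m: "m \<ge> 0" "d \<ge> 0" using ht(1) by (simp_all add: m_def d_def)
  have \<tau>: "\<tau> \<ge> 0" using k by (simp add: \<tau>_def)
  have M: "M = \<tau> * (81 * E x)" by (simp add: M_def \<tau>_def)
  have 1: "m + d \<le> M * Q s x"
    using A_difference_transfer[OF x p k sep] mult_left_mono[OF A_le_E[OF x st(1)] \<tau>]
    by (simp add: m_def d_def M) (simp add: \<tau>_def mult_ac)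
  have 2: "m + d \<le> M * Q t x"
    using A_difference_transfer[OF x p k separated_commute[OF sep]] mult_left_mono[OF A_le_E[OF x st(2)] \<tau>]
    by (simp add: m_def d_def M abs_minus_commute[of t s] abs_minus_commute[of "A t x"]) (simp add: \<tau>_def mult_ac)
  have r: "(m + d) / Q s x \<le> M" "(m + d) / Q t x \<le> M" using 1 2 Q by (simp_all add: divide_le_eq)
  have dr: "d / Q s x \<le> M" "d / Q t x \<le> M"
    using r m Q by (auto intro: order_trans[OF divide_right_mono, rotated])
  have QQ: "Q s x - Q t x = A s x - A t x" by (simp add: Q_def)
  have "ln (Q s x) - ln (Q t x) \<le> (Q s x - Q t x) / Q t x" "ln (Q t x) - ln (Q s x) \<le> (Q t x - Q s x) / Q s x"
    using Q by (simp_all add: ln_diff_le)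
  moreover have "(Q s x - Q t x) / Q t x \<le> d / Q t x" "(Q t x - Q s x) / Q s x \<le> d / Q s x"
    using Q QQ by (auto simp: d_def intro!: divide_right_mono)
  ultimately show "\<bar>nu s x - nu t x\<bar> \<le> M" using dr unfolding nu_def by linarith
  have w: "lform x (mink (pt s - pt t)) (m + d)"
    unfolding lform_def
  proof
    fix u assume u: "u \<in> tangent x"
    show "\<bar>mink (pt s - pt t) u\<bar> \<le> (m + d) * hnorm u"
      using spacelike_form_bound[OF x u pt_diff_square[of s t]] ht(1)
      by (simp add: m_def d_def A_def mink_simps abs_minus_commute)
  qed
  define dl where "dl = nu_grad s x - nu_grad t x"
  \<comment> \<open>Both the gradient and the Hessian are quotients by \<open>Q\<close>. First the
    numerator changes, then the denominator, and the latter change multiplies a quotient that is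
    already bounded.\<close>
  have inv: "inverse (Q s x) * a - inverse (Q t x) * b =
      inverse (Q s x) * (a - b) + (A t x - A s x) / Q s x * (inverse (Q t x) * b)" for a b
  proof -
    have AA: "A t x - A s x = Q t x - Q s x" using QQ by simp
    show ?thesis unfolding AA using Q by (simp add: field_simps)
  qed
  have ad: "\<bar>(A t x - A s x) / Q s x\<bar> \<le> M" "\<bar>(A s x - A t x) / Q s x\<bar> \<le> M"
    using dr(1) Q by (simp_all add: d_def abs_minus_commute)
  show l: "lform x (mink (nu_grad s x - nu_grad t x)) (3 * M)"
  proof (rule lform_mono[OF x lform_cong[OF lform_add[OF lform_scale[OF w] lform_scale[OF lform_nu[OF x]]]]])
    fix u assume u: "u \<in> tangent x"
    have "mink (Q_grad s x) u - mink (Q_grad t x) u = - mink (pt s - pt t) u"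
      by (simp add: Q_grad_def mink_simps mink_lin_grad[OF u])
    then show "mink (nu_grad s x - nu_grad t x) u =
        (- inverse (Q s x)) * mink (pt s - pt t) u + ((A t x - A s x) / Q s x) * mink (nu_grad t x) u"
      using inv[of "mink (Q_grad s x) u" "mink (Q_grad t x) u"]
      by (simp add: nu_grad_def mink_simps right_diff_distrib)
  next
    have "\<bar>- inverse (Q s x)\<bar> * (m + d) \<le> M" using r(1) Q by (simp add: divide_inverse mult.commute)
    then show "\<bar>- inverse (Q s x)\<bar> * (m + d) + \<bar>(A t x - A s x) / Q s x\<bar> * 2 \<le> 3 * M"
      by (rule order_trans[OF add_mono[OF _ mult_right_mono[OF ad(1), of 2]]]) simp_all
  qed
  show "bform x (\<lambda>u w. nu_hess s x u w - nu_hess t x u w) (17 * M)"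
  proof (rule bform_mono[OF x bform_cong[OF bform_add[OF bform_add[OF bform_scale[OF bform_mink[OF x]]
            bform_scale[OF bform_scale[OF bform_Q[OF x]]]]
          bform_add[OF bform_scale[OF bform_prod[OF l lform_nu[OF x, of s]], of "- 1"]
            bform_scale[OF bform_prod[OF lform_nu[OF x, of t] l], of "- 1"]]]]])
    fix u w
    have "Q_hess s x u w - Q_hess t x u w = (A s x - A t x) * mink u w"
      by (simp add: Q_hess_def algebra_simps)
    then have "inverse (Q s x) * Q_hess s x u w - inverse (Q t x) * Q_hess t x u w =
      ((A s x - A t x) / Q s x) * mink u w + ((A t x - A s x) / Q s x) * (inverse (Q t x) * Q_hess t x u w)"
      using inv[of "Q_hess s x u w" "Q_hess t x u w"] by (simp add: divide_inverse mult_ac)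
    then show "nu_hess s x u w - nu_hess t x u w =
      ((A s x - A t x) / Q s x) * mink u w + ((A t x - A s x) / Q s x) * (inverse (Q t x) * Q_hess t x u w) +
      (- 1 * (mink (nu_grad s x - nu_grad t x) u * mink (nu_grad s x) w) +
       - 1 * (mink (nu_grad t x) u * mink (nu_grad s x - nu_grad t x) w))"
      by (simp add: nu_hess_def mink.diff_left algebra_simps)
  next
    \<comment> \<open>\<open>17 = 1 + 4 + 6 + 6\<close>: the metric term, the change of the
      denominator, and the two mixed terms of the gradient products.\<close>
    have "\<bar>(A t x - A s x) / Q s x\<bar> * (\<bar>inverse (Q t x)\<bar> * (4 * Q t x)) \<le> M * 4"
      by (rule mult_mono[OF ad(1)]) (use Q order_trans[OF abs_ge_zero ad(1)] in auto)
    then show "\<bar>(A s x - A t x) / Q s x\<bar> * 1 + \<bar>(A t x - A s x) / Q s x\<bar> * (\<bar>inverse (Q t x)\<bar> * (4 * Q t x)) +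
        (\<bar>- 1\<bar> * (3 * M * 2) + \<bar>- 1\<bar> * (2 * (3 * M))) \<le> 17 * M"
      using ad(2) by (simp del: abs_divide)
  qed
qed

section \<open>Blending the answers\<close>

text \<open>The list is in the order of the queries, so the oldest is outermost, and appending a new
  one changes only the innermost function.\<close>

primrec blend :: "(('a \<times> real) \<times> real) list \<Rightarrow> ('a \<times> real \<Rightarrow> real) \<Rightarrow> 'a \<times> real \<Rightarrow> real" where
  "blend [] h = h"
| "blend (q # ps) h = (\<lambda>x. chi (fst q) x * nu (snd q) x + (1 - chi (fst q) x) * blend ps h x)"

text \<open>A layer averages the old error with \<open>nu t - nu s\<close>, so values grow linearly
  in the number of layers. A derivative that falls on the cut-off meets the error one order lower,
  and summing over the layers gives the square and the cube. The factor \<open>chi\<close> cancels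
  the growth in \<open>nu_difference\<close>, so that only \<open>E\<close> remains.\<close>

lemma blend_error:
  assumes k: "0 \<le> k" "k \<le> 1" and s: "s \<in> {0..1}"
    and ps: "\<forall>q\<in>set ps. fst q \<in> hyp \<and> snd q \<in> {0..1} \<and> separated (fst q) (snd q) s k"
  shows "\<exists>G H. has_hhess (\<lambda>x. blend ps (nu s) x - nu s x) G H \<and>
    (\<forall>x\<in>hyp. \<bar>blend ps (nu s) x - nu s x\<bar> \<le> real (length ps) * (2 ^ 16 * k * E x) \<and>
      lform x (mink (G x)) ((real (length ps))\<^sup>2 * (2 ^ 16 * k * E x)) \<and>
      bform x (H x) (4 * real (length ps) ^ 3 * (2 ^ 16 * k * E x)))"
  using ps
proof (induction ps)
  case Nil
  have "has_hhess (\<lambda>x. blend [] (nu s) x - nu s x) (\<lambda>x. 0) (\<lambda>x u w. 0)"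
    using has_hhess_const[of 0] by simp
  moreover have "\<forall>x\<in>hyp. \<bar>blend [] (nu s) x - nu s x\<bar> \<le> real (length []) * (2 ^ 16 * k * E x) \<and>
      lform x (mink 0) ((real (length []))\<^sup>2 * (2 ^ 16 * k * E x)) \<and>
      bform x (\<lambda>u w. 0) (4 * real (length []) ^ 3 * (2 ^ 16 * k * E x))"
    by (simp add: lform_def bform_def mink.zero_left)
  ultimately show ?case by (intro exI conjI)
next
  case (Cons q ps)
  obtain p t where q: "q = (p, t)" by (cases q)
  have p: "p \<in> hyp" and t: "t \<in> {0..1}" and sep: "separated p t s k" using Cons.prems by (simp_all add: q)
  define n where "n = real (length ps)"
  define e where "e = (\<lambda>x. blend ps (nu s) x - nu s x)"
  have "\<exists>G H. has_hhess e G H \<and>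
    (\<forall>x\<in>hyp. \<bar>e x\<bar> \<le> n * (2 ^ 16 * k * E x) \<and> lform x (mink (G x)) (n\<^sup>2 * (2 ^ 16 * k * E x)) \<and>
      bform x (H x) (4 * n ^ 3 * (2 ^ 16 * k * E x)))"
    unfolding e_def n_def by (rule Cons.IH) (use Cons.prems in simp)
  then obtain G H where GH: "has_hhess e G H"
    and b: "\<forall>x\<in>hyp. \<bar>e x\<bar> \<le> n * (2 ^ 16 * k * E x) \<and> lform x (mink (G x)) (n\<^sup>2 * (2 ^ 16 * k * E x)) \<and>
      bform x (H x) (4 * n ^ 3 * (2 ^ 16 * k * E x))"
    by (elim exE conjE)
  define d where "d = (\<lambda>x. nu t x - nu s x)"
  note hd = has_hhess_diff[OF has_hhess_nu[of t] has_hhess_nu[of s], folded d_def]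
  note h1 = has_hhess_mult[OF has_hhess_chi[OF p] hd]
  note h2 = has_hhess_mult[OF has_hhess_diff[OF has_hhess_const[of 1] has_hhess_chi[OF p]] GH]
  have eq: "blend (q # ps) (nu s) x - nu s x = chi p x * d x + (1 - chi p x) * e x" for x
    by (simp add: q d_def e_def algebra_simps)
  have bd: "\<bar>chi p x * d x + (1 - chi p x) * e x\<bar> \<le> (n + 1) * (2 ^ 16 * k * E x) \<and>
      lform x (mink (chi p x *\<^sub>R (nu_grad t x - nu_grad s x) + d x *\<^sub>R chi_grad p x +
        ((1 - chi p x) *\<^sub>R G x + e x *\<^sub>R (0 - chi_grad p x)))) ((n + 1)\<^sup>2 * (2 ^ 16 * k * E x)) \<and>
      bform x (\<lambda>u w. chi p x * (nu_hess t x u w - nu_hess s x u w) + d x * chi_hess p x u w +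
          mink (chi_grad p x) u * mink (nu_grad t x - nu_grad s x) w +
          mink (nu_grad t x - nu_grad s x) u * mink (chi_grad p x) w +
        ((1 - chi p x) * H x u w + e x * (0 - chi_hess p x u w) +
          mink (0 - chi_grad p x) u * mink (G x) w + mink (G x) u * mink (0 - chi_grad p x) w))
        (4 * (n + 1) ^ 3 * (2 ^ 16 * k * E x))" if x: "x \<in> hyp" for x
  proof -
    define \<beta> where "\<beta> = 2 ^ 16 * k * E x"
    define M where "M = 1296 * k * (- mink x p)\<^sup>2 * E x"
    define c where "c = chi p x"
    note D = nu_difference[OF x p k sep t s, folded M_def]
    note C = chi_bounds[OF p x, folded c_def]
    have \<beta>: "\<beta> \<ge> 0" using k E_bounds[OF x] by (simp add: \<beta>_def)
    have n: "n \<ge> 0" by (simp add: n_def)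
    have "c * M = 1296 * (k * E x) * (c * (- mink x p)\<^sup>2)" by (simp add: M_def)
    also have "\<dots> = 1296 * (k * E x)" unfolding C(3) by simp
    finally have cMe: "c * M = 1296 * (k * E x)" .
    have "0 \<le> k * E x" using k E_bounds[OF x] by simp
    \<comment> \<open>\<open>37 = 17 + 8 + 6 + 6\<close> collects the Hessian terms that one layer
      adds, and \<open>37 * 1296 \<le> 2 ^ 16\<close>.\<close>
    then have cM: "37 * (c * M) \<le> \<beta>" "0 \<le> c * M"
      unfolding cMe \<beta>_def by simp_all
    have "M \<ge> 0" using k E_bounds[OF x] by (simp add: M_def)
    have d: "\<bar>d x\<bar> \<le> M" using D(1) by (simp add: d_def)
    have cd: "c * \<bar>d x\<bar> \<le> c * M" using d C(1) by simp
    have c1: "\<bar>1 - c\<bar> \<le> 1" using C by simp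
    have e: "\<bar>e x\<bar> \<le> n * \<beta>" using bspec[OF b x] by (simp add: \<beta>_def)
    have lG: "lform x (mink (G x)) (n\<^sup>2 * \<beta>)" using bspec[OF b x] by (simp add: \<beta>_def)
    have bH: "bform x (H x) (4 * n ^ 3 * \<beta>)" using bspec[OF b x] by (simp add: \<beta>_def)
    have e1: "\<bar>1 - c\<bar> * \<bar>e x\<bar> \<le> 1 * (n * \<beta>)" by (rule mult_mono[OF c1 e]) auto
    have e2: "\<bar>1 - c\<bar> * (n\<^sup>2 * \<beta>) \<le> 1 * (n\<^sup>2 * \<beta>)" by (rule mult_right_mono[OF c1]) (use \<beta> in auto)
    have e3: "\<bar>1 - c\<bar> * (4 * n ^ 3 * \<beta>) \<le> 1 * (4 * n ^ 3 * \<beta>)" by (rule mult_right_mono[OF c1]) (use \<beta> n in auto)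
    have "\<bar>c * d x + (1 - c) * e x\<bar> \<le> c * \<bar>d x\<bar> + \<bar>1 - c\<bar> * \<bar>e x\<bar>"
      using abs_triangle_ineq[of "c * d x" "(1 - c) * e x"] C(1) by (simp add: abs_mult)
    also have "\<dots> \<le> (n + 1) * \<beta>" using cd e1 cM by (simp add: algebra_simps)
    finally have R1: "\<bar>c * d x + (1 - c) * e x\<bar> \<le> (n + 1) * \<beta>" .
    have lc: "lform x (mink (0 - chi_grad p x)) 2"
      by (rule lform_mono[OF x lform_cong[OF lform_scale[OF C(4), of "- 1"]]])
         (use C(1,2) in \<open>auto simp: mink_simps mink.zero_left\<close>)
    have bc: "bform x (\<lambda>u w. 0 - chi_hess p x u w) 8"
      by (rule bform_mono[OF x bform_cong[OF bform_scale[OF C(5), of "- 1"]]]) (use C(1,2) in auto)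
    have R2: "lform x (mink (c *\<^sub>R (nu_grad t x - nu_grad s x) + d x *\<^sub>R chi_grad p x +
        ((1 - c) *\<^sub>R G x + e x *\<^sub>R (0 - chi_grad p x)))) ((n + 1)\<^sup>2 * \<beta>)"
    proof (rule lform_mono[OF x lform_cong[OF lform_add[OF lform_product[OF C(4) D(2)] lform_product[OF lc lG]]]])
      show "\<bar>c\<bar> * (3 * M) + \<bar>d x\<bar> * (2 * c) + (\<bar>1 - c\<bar> * (n\<^sup>2 * \<beta>) + \<bar>e x\<bar> * 2) \<le> (n + 1)\<^sup>2 * \<beta>"
      proof -
        have "\<bar>c\<bar> * (3 * M) + \<bar>d x\<bar> * (2 * c) = 3 * (c * M) + 2 * (c * \<bar>d x\<bar>)" using C(1) by simp
        also have "\<dots> \<le> \<beta>" using cd cM by linarith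
        finally have "\<bar>c\<bar> * (3 * M) + \<bar>d x\<bar> * (2 * c) \<le> \<beta>" .
        moreover have "(n + 1)\<^sup>2 * \<beta> = n\<^sup>2 * \<beta> + 2 * (n * \<beta>) + \<beta>"
          by (simp add: algebra_simps power2_eq_square)
        ultimately show ?thesis using e2 e by linarith
      qed
    qed (rule mink.add_left)
    have R3: "bform x (\<lambda>u w. c * (nu_hess t x u w - nu_hess s x u w) + d x * chi_hess p x u w +
          mink (chi_grad p x) u * mink (nu_grad t x - nu_grad s x) w +
          mink (nu_grad t x - nu_grad s x) u * mink (chi_grad p x) w +
        ((1 - c) * H x u w + e x * (0 - chi_hess p x u w) +
          mink (0 - chi_grad p x) u * mink (G x) w + mink (G x) u * mink (0 - chi_grad p x) w))
        (4 * (n + 1) ^ 3 * \<beta>)"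
    proof (rule bform_mono[OF x bform_add[OF bform_product[OF C(4) D(2) C(5) D(3)] bform_product[OF lc lG bc bH]]])
      have "\<bar>c\<bar> * (17 * M) + \<bar>d x\<bar> * (8 * c) + 2 * c * (3 * M) + 3 * M * (2 * c) \<le> \<beta>"
      proof -
        have "\<bar>c\<bar> * (17 * M) + \<bar>d x\<bar> * (8 * c) + 2 * c * (3 * M) + 3 * M * (2 * c) = 29 * (c * M) + 8 * (c * \<bar>d x\<bar>)"
          using C(1) by simp
        then show ?thesis using cd cM by linarith
      qed
      moreover have "\<bar>1 - c\<bar> * (4 * n ^ 3 * \<beta>) + \<bar>e x\<bar> * 8 + 2 * (n\<^sup>2 * \<beta>) + n\<^sup>2 * \<beta> * 2
          \<le> 4 * n ^ 3 * \<beta> + n * \<beta> * 8 + 4 * (n\<^sup>2 * \<beta>)"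
        using e3 e by simp
      moreover have "\<beta> + (4 * n ^ 3 * \<beta> + n * \<beta> * 8 + 4 * (n\<^sup>2 * \<beta>)) \<le> 4 * (n + 1) ^ 3 * \<beta>"
      proof -
        have "1 + (4 * n ^ 3 + n * 8 + 4 * n\<^sup>2) \<le> 4 * (n + 1) ^ 3"
          using n by (simp add: power3_eq_cube power2_eq_square algebra_simps)
        then have "(1 + (4 * n ^ 3 + n * 8 + 4 * n\<^sup>2)) * \<beta> \<le> 4 * (n + 1) ^ 3 * \<beta>"
          by (rule mult_right_mono[OF _ \<beta>])
        then show ?thesis by (simp add: algebra_simps)
      qed
      ultimately show "\<bar>c\<bar> * (17 * M) + \<bar>d x\<bar> * (8 * c) + 2 * c * (3 * M) + 3 * M * (2 * c) +
        (\<bar>1 - c\<bar> * (4 * n ^ 3 * \<beta>) + \<bar>e x\<bar> * 8 + 2 * (n\<^sup>2 * \<beta>) + n\<^sup>2 * \<beta> * 2) \<le> 4 * (n + 1) ^ 3 * \<beta>"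
        by linarith
    qed
    show ?thesis using R1 R2 R3 unfolding \<beta>_def c_def by blast
  qed
  have len: "real (length (q # ps)) = n + 1" by (simp add: n_def)
  show ?case
    unfolding eq len by (intro exI) (rule conjI[OF has_hhess_add[OF h1 h2] ballI[OF bd]])
qed

section \<open>The radial function\<close>

text \<open>The radial Hessian of the logarithm alone decays like \<open>1 / F\<^sup>2\<close>, far
  too fast. The correction supplies \<open>E / R\<close> and lowers the slope by at most one
  half.\<close>

definition phi :: "'a \<times> real \<Rightarrow> real" where "phi x = 2 * ln (F x) + R * E x"

definition phi_grad :: "'a \<times> real \<Rightarrow> 'a \<times> real" where
  "phi_grad x = ((2 - E x) * inverse (F x)) *\<^sub>R lin_grad x0 x"

definition phi_hess :: "'a \<times> real \<Rightarrow> 'a \<times> real \<Rightarrow> 'a \<times> real \<Rightarrow> real" where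
  "phi_hess x u w = (2 - E x) * mink u w -
     (2 - (1 + 1 / R) * E x) * inverse (F x) ^ 2 * (mink (lin_grad x0 x) u * mink (lin_grad x0 x) w)"

lemma has_hhess_phi: "has_hhess phi phi_grad phi_hess"
proof -
  define a where "a = - 1 / R"
  have Ra: "R * a = - 1" using R by (simp add: a_def)
  have "has_hhess (\<lambda>x. 2 * ln (F x) + R * F x powr a)
     (\<lambda>x. ((2 - F x powr a) * inverse (F x)) *\<^sub>R lin_grad x0 x)
     (\<lambda>x u w. ((2 - F x powr a) * inverse (F x)) * (F x * mink u w) +
       (- (2 - (1 + 1 / R) * F x powr a) * inverse (F x) ^ 2) * (mink (lin_grad x0 x) u * mink (lin_grad x0 x) w))"
  proof (rule has_hhess_compose[OF has_hhess_F])
    fix x :: "'a \<times> real" assume "x \<in> hyp"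
    define t where "t = F x"
    have t: "t > 0" using F_ge_1[OF \<open>x \<in> hyp\<close>] by (simp add: t_def)
    have p: "((\<lambda>t. t powr a) has_real_derivative a * (t powr a * inverse t)) (at t)"
      using has_real_derivative_powr[OF t, of a] t by (simp add: powr_diff divide_inverse)
    have i: "(inverse has_real_derivative - (inverse t ^ 2)) (at t)"
      using DERIV_inverse[of t] t by (simp add: numeral_2_eq_2)
    have "((\<lambda>t. 2 * ln t + R * t powr a) has_real_derivative 2 * inverse t + R * (a * (t powr a * inverse t))) (at t)"
      by (intro DERIV_add DERIV_cmult DERIV_ln p t)
    moreover have "2 * inverse t + R * (a * (t powr a * inverse t)) = (2 - t powr a) * inverse t"
      unfolding mult.assoc[of R a, symmetric] Ra by (simp add: algebra_simps)
    ultimately show "((\<lambda>t. 2 * ln t + R * t powr a) has_real_derivative (2 - F x powr a) * inverse (F x)) (at (F x))"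
      by (simp add: t_def)
    have "((\<lambda>t. (2 - t powr a) * inverse t) has_real_derivative
        (0 - a * (t powr a * inverse t)) * inverse t + - (inverse t ^ 2) * (2 - t powr a)) (at t)"
      by (intro DERIV_mult DERIV_diff DERIV_const p i)
    moreover have "(0 - a * (t powr a * inverse t)) * inverse t + - (inverse t ^ 2) * (2 - t powr a) =
        - (2 - (1 + 1 / R) * t powr a) * inverse t ^ 2"
      by (simp add: a_def power2_eq_square algebra_simps)
    ultimately show "((\<lambda>t. (2 - t powr a) * inverse t) has_real_derivative
        - (2 - (1 + 1 / R) * F x powr a) * inverse (F x) ^ 2) (at (F x))"
      by (simp add: t_def)
  qed
  then have *: "has_hhess phi phi_grad (\<lambda>x u w. ((2 - E x) * inverse (F x)) * (F x * mink u w) +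
       (- (2 - (1 + 1 / R) * E x) * inverse (F x) ^ 2) * (mink (lin_grad x0 x) u * mink (lin_grad x0 x) w))"
    by (simp add: phi_def[abs_def] phi_grad_def[abs_def] E_def a_def)
  show ?thesis
  proof (rule has_hhessI)
    show "has_hgrad phi (phi_grad x) x" if "x \<in> hyp" for x by (rule has_hhess_grad[OF * that])
    fix c V :: "real \<Rightarrow> 'a \<times> real" and u t
    assume c: "\<And>s. c s \<in> hyp" and V: "\<And>s. V s \<in> tangent (c s)"
      and d: "(c has_vector_derivative u) (at t)" "(V has_vector_derivative mink u (V t) *\<^sub>R c t) (at t)"
    have "inverse (F (c t)) * F (c t) = 1" using F_ge_1[OF c[of t]] by simp
    then have eq: "(2 - E (c t)) * inverse (F (c t)) * (F (c t) * m) = (2 - E (c t)) * m" for m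
      by (metis mult.assoc mult_1)
    show "((\<lambda>s. mink (phi_grad (c s)) (V s)) has_real_derivative phi_hess (c t) u (V t)) (at t)"
      using has_hhess_deriv[OF * c V d]
      by (simp only: phi_hess_def eq mult_minus_left add_uminus_conv_diff)
  qed
qed

text \<open>The radial direction is the least favourable one: there the subtracted term reaches at
  most \<open>2 - (1 + 1 / R) * E x\<close>, which leaves \<open>E x / R\<close> of the metric
  coefficient \<open>2 - E x\<close>.\<close>

lemma phi_bounds:
  assumes x: "x \<in> hyp"
  shows "lform x (mink (phi_grad x)) 2" "bform x (phi_hess x) 4"
    "u \<in> tangent x \<Longrightarrow> E x / R * (hnorm u)\<^sup>2 \<le> phi_hess x u u"
proof -
  define b i where "b = 2 - (1 + 1 / R) * E x" and "i = inverse (F x)"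
  have F: "F x \<ge> 1" by (rule F_ge_1[OF x])
  then have i: "i * F x = 1" "0 < i" by (simp_all add: i_def)
  note E = E_bounds[OF x]
  have "(1 + 1 / R) * E x \<le> 2 * 1" by (rule mult_mono) (use E R in auto)
  moreover have "0 \<le> (1 + 1 / R) * E x" using E R by simp
  ultimately have b: "0 \<le> b" "b \<le> 2" by (simp_all add: b_def)
  note l = lform_scale[OF lform_F[OF x], of i]
  have l1: "lform x (\<lambda>u. i * mink (lin_grad x0 x) u) 1"
    by (rule lform_mono[OF x l]) (use i in auto)
  show "lform x (mink (phi_grad x)) 2"
  proof (rule lform_mono[OF x lform_cong[OF lform_scale[OF l1]]])
    show "mink (phi_grad x) u = (2 - E x) * (i * mink (lin_grad x0 x) u)" for u
      by (simp add: phi_grad_def i_def mink_simps)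
  qed (use E in auto)
  have ph: "phi_hess x u w = (2 - E x) * mink u w + (- b) * ((i * mink (lin_grad x0 x) u) * (i * mink (lin_grad x0 x) w))" for u w
    unfolding phi_hess_def b_def[symmetric] i_def[symmetric] by (simp add: power2_eq_square)
  show "bform x (phi_hess x) 4"
    by (rule bform_mono[OF x bform_cong[OF bform_add[OF bform_scale[OF bform_mink[OF x]]
            bform_scale[OF bform_prod[OF l1 l1]]] ph]]) (use b E in auto)
  assume u: "u \<in> tangent x"
  have "(i * mink (lin_grad x0 x) u)\<^sup>2 \<le> (hnorm u)\<^sup>2"
    using lform_D[OF l1 u] power_mono[of "\<bar>i * mink (lin_grad x0 x) u\<bar>" "hnorm u" 2] by simp
  then have "b * (i * mink (lin_grad x0 x) u)\<^sup>2 \<le> b * (hnorm u)\<^sup>2" using b by (intro mult_left_mono)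
  then have "(2 - E x) * (hnorm u)\<^sup>2 - b * (hnorm u)\<^sup>2 \<le> phi_hess x u u"
    unfolding ph hnorm_square[OF x u] by (simp add: power2_eq_square)
  then show "E x / R * (hnorm u)\<^sup>2 \<le> phi_hess x u u" by (simp add: b_def algebra_simps)
qed

text \<open>The weights keep the gradient below \<open>1 / 2\<close> and the Hessian below
  \<open>1\<close>. Their ratio 8 lets \<open>nu\<close> outweigh the amount of about
  \<open>2 * R\<close> by which \<open>phi\<close> may be larger at \<open>pt s\<close> than at a
  query.\<close>

definition pot :: "(('a \<times> real) \<times> real) list \<Rightarrow> real \<Rightarrow> 'a \<times> real \<Rightarrow> real" where
  "pot ps s x = 1 / 256 * phi x + 1 / 32 * blend ps (nu s) x"

lemma C_infinity_F: "C_infinity F"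
  unfolding F_def[abs_def] by (intro C_infinity_minus C_infinity_mink)

lemma C_infinity_nu: "C_infinity (nu s)"
proof -
  have "C_infinity (Q s)"
    unfolding Q_def[abs_def] A_def power2_eq_square
    by (intro C_infinity_add C_infinity_mult C_infinity_minus C_infinity_mink C_infinity_const C_infinity_F)
  then show ?thesis
    unfolding nu_def[abs_def] by (rule C_infinity_ln) (rule less_le_trans[OF zero_less_one Q_pos])
qed

lemma C_infinity_blend:
  "(\<And>q. q \<in> set ps \<Longrightarrow> fst q \<in> hyp) \<Longrightarrow> C_infinity h \<Longrightarrow> C_infinity (blend ps h)"
proof (induction ps)
  case (Cons q ps)
  have 1: "C_infinity (chi (fst q))" "C_infinity (blend ps h)"
    by (intro C_infinity_chi Cons; simp)+
  have "C_infinity (\<lambda>x. 1 - chi (fst q) x)" by (rule C_infinity_diff[OF C_infinity_const 1(1)])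
  then show ?case
    using C_infinity_add[OF C_infinity_mult[OF 1(1) C_infinity_nu] C_infinity_mult[OF _ 1(2)]] by simp
qed simp

lemma C_infinity_pot:
  assumes "\<And>q. q \<in> set ps \<Longrightarrow> fst q \<in> hyp"
  shows "C_infinity (pot ps s)"
proof -
  have pos: "0 < F x" if "x \<in> hyp" for x using F_ge_1[OF that] by simp
  have l: "C_infinity (\<lambda>x. ln (F x))" by (rule C_infinity_ln[OF C_infinity_F pos])
  have e: "C_infinity E" unfolding E_def[abs_def] by (rule C_infinity_powr[OF C_infinity_F pos])
  have "C_infinity phi"
    unfolding phi_def[abs_def]
    by (rule C_infinity_add[OF C_infinity_mult[OF C_infinity_const l] C_infinity_mult[OF C_infinity_const e]])
  then show ?thesis
    unfolding pot_def[abs_def]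
    by (rule C_infinity_add[OF C_infinity_mult[OF C_infinity_const]
          C_infinity_mult[OF C_infinity_const C_infinity_blend[OF assms C_infinity_nu]]])
qed

text \<open>With \<open>n\<close> queries, the last condition says that the Hessian error
  \<open>4 * n ^ 3 * (2 ^ 16 * k * E x)\<close>, weighted by \<open>1 / 32\<close>, stays below the
  Hessian bound \<open>E x / R\<close> of \<open>phi\<close>, weighted by \<open>1 / 256\<close>;
  the factor \<open>E x\<close> cancels.\<close>

definition admissible :: "real \<Rightarrow> (('a \<times> real) \<times> real) list \<Rightarrow> real \<Rightarrow> bool" where
  "admissible k ps s \<longleftrightarrow> 0 \<le> k \<and> k \<le> 1 \<and> s \<in> {0..1} \<and>
     (\<forall>q\<in>set ps. fst q \<in> hyp \<and> snd q \<in> {0..1} \<and> separated (fst q) (snd q) s k) \<and>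
     32 * real (length ps) ^ 3 * 2 ^ 16 * k * R < 1"

lemma pot_jet:
  assumes "admissible k ps s"
  obtains G H where "has_hhess (pot ps s) G H"
    "\<And>x. x \<in> hyp \<Longrightarrow> lform x (mink (G x)) (1 / 2)"
    "\<And>x. x \<in> hyp \<Longrightarrow> bform x (H x) 1"
    "\<And>x u. x \<in> hyp \<Longrightarrow> u \<in> tangent x \<Longrightarrow> u \<noteq> 0 \<Longrightarrow> H x u u > 0"
    "\<And>x. x \<in> hyp \<Longrightarrow> \<bar>pot ps s x - (phi x / 256 + nu s x / 32)\<bar> \<le> 1 / 256"
proof -
  define n where "n = real (length ps)"
  define \<beta> where "\<beta> = 2 ^ 16 * k"
  have k: "0 \<le> k" "k \<le> 1" "s \<in> {0..1}"
    and sep: "\<forall>q\<in>set ps. fst q \<in> hyp \<and> snd q \<in> {0..1} \<and> separated (fst q) (snd q) s k"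
    and small: "32 * n ^ 3 * \<beta> * R < 1"
    using assms by (auto simp: admissible_def n_def \<beta>_def mult_ac)
  have \<beta>: "0 \<le> \<beta>" using k by (simp add: \<beta>_def)
  have n: "0 \<le> n" by (simp add: n_def)
  have "1 * (n ^ 3 * \<beta>) \<le> R * (n ^ 3 * \<beta>)" by (rule mult_right_mono) (use R n \<beta> in auto)
  then have n3: "n ^ 3 * \<beta> < 1 / 32" using small by (simp add: mult_ac)
  have n12: "n \<le> n ^ 3" "n\<^sup>2 \<le> n ^ 3"
  proof -
    have "n = 0 \<or> 1 \<le> n" by (cases ps) (simp_all add: n_def)
    then show "n \<le> n ^ 3" "n\<^sup>2 \<le> n ^ 3"
      using power_increasing[of 1 3 n] power_increasing[of 2 3 n] by auto
  qed
  define e where "e = (\<lambda>x. blend ps (nu s) x - nu s x)"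
  obtain G H where GH: "has_hhess e G H"
    and b: "\<forall>x\<in>hyp. \<bar>e x\<bar> \<le> n * (\<beta> * E x) \<and> lform x (mink (G x)) (n\<^sup>2 * (\<beta> * E x)) \<and>
      bform x (H x) (4 * n ^ 3 * (\<beta> * E x))"
    using blend_error[OF k sep] unfolding e_def n_def \<beta>_def by (elim exE conjE)
  note h = has_hhess_add[OF has_hhess_cmult[OF has_hhess_phi, of "1 / 256"]
      has_hhess_cmult[OF has_hhess_add[OF has_hhess_nu[of s] GH], of "1 / 32"]]
  have pot: "pot ps s = (\<lambda>x. 1 / 256 * phi x + 1 / 32 * (nu s x + e x))"
    by (simp add: pot_def e_def fun_eq_iff)
  have \<beta>E: "m * (\<beta> * E x) < 1 / 32" if "x \<in> hyp" "m \<le> n ^ 3" "0 \<le> m" for m x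
  proof -
    have "m * (\<beta> * E x) \<le> n ^ 3 * (\<beta> * 1)"
      by (intro mult_mono) (use that E_bounds[OF that(1)] \<beta> n in auto)
    then show ?thesis using n3 by simp
  qed
  show ?thesis
  proof (rule that)
    show "has_hhess (pot ps s) (\<lambda>x. (1 / 256) *\<^sub>R phi_grad x + (1 / 32) *\<^sub>R (nu_grad s x + G x))
        (\<lambda>x u w. 1 / 256 * phi_hess x u w + 1 / 32 * (nu_hess s x u w + H x u w))"
      unfolding pot by (rule h)
    fix x :: "'a \<times> real" assume x: "x \<in> hyp"
    note bx = bspec[OF b x]
    show "lform x (mink ((1 / 256) *\<^sub>R phi_grad x + (1 / 32) *\<^sub>R (nu_grad s x + G x))) (1 / 2)"
    proof (rule lform_mono[OF x lform_cong[OF lform_add[OF lform_scale[OF phi_bounds(1)[OF x], of "1 / 256"]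
              lform_scale[OF lform_add[OF lform_nu[OF x, of s] bx[THEN conjunct2, THEN conjunct1]], of "1 / 32"]]]])
      show "\<bar>1 / 256\<bar> * 2 + \<bar>1 / 32\<bar> * (2 + n\<^sup>2 * (\<beta> * E x)) \<le> 1 / 2"
        using \<beta>E[OF x n12(2)] by (simp add: field_simps)
    qed (simp add: mink_simps)
    show "bform x (\<lambda>u w. 1 / 256 * phi_hess x u w + 1 / 32 * (nu_hess s x u w + H x u w)) 1"
    proof (rule bform_mono[OF x bform_add[OF bform_scale[OF phi_bounds(2)[OF x]]
              bform_scale[OF bform_add[OF bform_nu[OF x] bx[THEN conjunct2, THEN conjunct2]]]]])
      show "\<bar>1 / 256\<bar> * 4 + \<bar>1 / 32\<bar> * (8 + 4 * n ^ 3 * (\<beta> * E x)) \<le> 1"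
        using \<beta>E[OF x order_refl] n by (simp add: field_simps)
    qed
    have eq: "pot ps s x - (phi x / 256 + nu s x / 32) = e x / 32"
      by (simp add: pot field_simps)
    show "\<bar>pot ps s x - (phi x / 256 + nu s x / 32)\<bar> \<le> 1 / 256"
      unfolding eq using bx[THEN conjunct1] \<beta>E[OF x n12(1) n] by simp
  next
    fix x u :: "'a \<times> real" assume x: "x \<in> hyp" and u: "u \<in> tangent x" "u \<noteq> 0"
    have nu0: "(hnorm u)\<^sup>2 > 0" using hnorm_eq_0[OF x u(1)] u(2) by simp
    have "\<bar>H x u u\<bar> \<le> 4 * n ^ 3 * (\<beta> * E x) * hnorm u * hnorm u"
      by (rule bform_D[OF bspec[OF b x, THEN conjunct2, THEN conjunct2] u(1) u(1)])
    define W where "W = n ^ 3 * \<beta> * (E x * (hnorm u)\<^sup>2)"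
    have 1: "\<bar>H x u u\<bar> \<le> 4 * W"
      using \<open>\<bar>H x u u\<bar> \<le> _\<close> by (simp add: W_def power2_eq_square mult_ac)
    have "32 * n ^ 3 * \<beta> < 1 / R" using small R by (simp add: field_simps)
    then have "(32 * n ^ 3 * \<beta>) * (E x * (hnorm u)\<^sup>2) < 1 / R * (E x * (hnorm u)\<^sup>2)"
      by (rule mult_strict_right_mono) (use nu0 E_bounds[OF x] in simp)
    also have "\<dots> \<le> phi_hess x u u"
      using phi_bounds(3)[OF x u(1)] by simp
    finally have "32 * W < phi_hess x u u" by (simp add: W_def mult.assoc)
    then show "1 / 256 * phi_hess x u u + 1 / 32 * (nu_hess s x u u + H x u u) > 0"
      using 1 nu_hess_nonneg[OF x u(1), of s] unfolding distrib_left by linarith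
  qed
qed

section \<open>First-order data at the queries\<close>

lemma blend_has_hgrad:
  assumes "\<forall>q\<in>set ps. fst q \<in> hyp" "x \<in> hyp" "has_hgrad h d x"
  shows "\<exists>d'. has_hgrad (blend ps h) d' x"
  using assms(1)
proof (induction ps)
  case Nil
  show ?case unfolding blend.simps by (rule exI) (rule assms(3))
next
  case (Cons q ps)
  have p: "fst q \<in> hyp" using Cons.prems by simp
  have "\<exists>d'. has_hgrad (blend ps h) d' x" by (rule Cons.IH) (use Cons.prems in simp)
  then obtain d' where "has_hgrad (blend ps h) d' x" ..
  from has_hgrad_add[OF has_hgrad_mult[OF has_hhess_grad[OF has_hhess_chi[OF p] assms(2)] has_hhess_grad[OF has_hhess_nu assms(2)]]
      has_hgrad_mult[OF has_hhess_grad[OF has_hhess_diff[OF has_hhess_const has_hhess_chi[OF p]] assms(2)] this]]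
  show ?case unfolding blend.simps by blast
qed

text \<open>In the outermost layer centred at \<open>p\<close>, the weight \<open>1 - chi\<close>
  has value and gradient 0 at \<open>p\<close>, which hides everything inside; the layers around it
  are the same on both sides. If \<open>p\<close> occurs several times, the oldest answer
  counts.\<close>

lemma blend_agree_at_query:
  assumes "\<forall>q\<in>set ps. fst q \<in> hyp" "p \<in> fst ` set ps" "has_hgrad h d p" "has_hgrad h' d' p"
  shows "first_order_agree (blend ps h) (blend ps h') p"
  using assms(1,2)
proof (induction ps)
  case (Cons q ps)
  have q: "fst q \<in> hyp" and p: "p \<in> hyp" using Cons.prems by auto
  have c: "has_hgrad (\<lambda>x. 1 - chi (fst q) x) (0 - chi_grad (fst q) p) p"
    by (rule has_hhess_grad[OF has_hhess_diff[OF has_hhess_const has_hhess_chi[OF q]] p])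
  have n: "has_hgrad (\<lambda>x. chi (fst q) x * nu (snd q) x)
      (chi (fst q) p *\<^sub>R nu_grad (snd q) p + nu (snd q) p *\<^sub>R chi_grad (fst q) p) p"
    by (rule has_hgrad_mult[OF has_hhess_grad[OF has_hhess_chi[OF q] p] has_hhess_grad[OF has_hhess_nu p]])
  show ?case
  proof (cases "p = fst q")
    case True
    have ps: "\<forall>q\<in>set ps. fst q \<in> hyp" using Cons.prems by simp
    obtain g where g: "has_hgrad (blend ps h) g p" using blend_has_hgrad[OF ps p assms(3)] ..
    obtain g' where g': "has_hgrad (blend ps h') g' p" using blend_has_hgrad[OF ps p assms(4)] ..
    have gr: "has_hgrad (blend (q # ps) h) (nu_grad (snd q) p) p"
      "has_hgrad (blend (q # ps) h') (nu_grad (snd q) p) p"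
      using has_hgrad_add[OF n has_hgrad_mult[OF c g]] has_hgrad_add[OF n has_hgrad_mult[OF c g']]
      by (simp_all add: True[symmetric] chi_at[OF p])
    show ?thesis
      by (rule first_order_agreeI[OF _ gr]) (simp add: True[symmetric] chi_at[OF p])
  next
    case False
    then have "first_order_agree (blend ps h) (blend ps h') p" using Cons by auto
    then show ?thesis
      unfolding blend.simps
      by (intro first_order_agree_add first_order_agree_mult first_order_agree_refl[OF n] first_order_agree_refl[OF c])
  qed
qed simp

lemma blend_append:
  "blend (ps @ [(p, t)]) h = blend ps (\<lambda>x. chi p x * nu t x + (1 - chi p x) * h x)"
  by (induction ps) auto

subsection \<open>Minimizer, gap, and the resisting oracle\<close>

text \<open>For the second bound, \<open>exp y \<ge> 1 + y\<close> gives
  \<open>R * E x \<ge> R - ln (F x)\<close>, and the logarithmic part of \<open>phi\<close> covers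
  the loss.\<close>

lemma phi_lower:
  assumes "x \<in> hyp"
  shows "phi x \<ge> 2 * ln (F x)" "phi x \<ge> R"
proof -
  have l: "ln (F x) \<ge> 0" using F_ge_1[OF assms] by simp
  show "phi x \<ge> 2 * ln (F x)" using E_bounds[OF assms] R by (simp add: phi_def)
  have "1 + - ln (F x) / R \<le> E x" unfolding E_exp[OF assms] by (rule exp_ge_add_one_self)
  then have "R * (1 + - ln (F x) / R) \<le> R * E x" using R by (intro mult_left_mono) auto
  moreover have "R * (1 + - ln (F x) / R) = R - ln (F x)" using R by (simp add: field_simps)
  ultimately show "phi x \<ge> R" using l by (simp add: phi_def)
qed

lemma ln_divide_ht: "a > 0 \<Longrightarrow> ln (a / ht) = ln a + R"
  by (simp add: ht_def ln_div)

lemma phi_pt: "s \<in> {0..1} \<Longrightarrow> phi (pt s) \<le> 3 * R + 1"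
proof -
  assume s: "s \<in> {0..1}"
  have "ln (F (pt s)) \<le> ln (3 / (2 * ht))"
    using F_ge_1[OF pt_in_hyp, of s] F_pt_le[OF s] ht(1) by (subst ln_le_cancel_iff) auto
  also have "\<dots> = ln (3 / 2) + R" using ln_divide_ht[of "3 / 2"] by simp
  also have "\<dots> \<le> 1 / 2 + R" using ln_le_minus_one[of "3 / 2 :: real"] by simp
  finally have "2 * ln (F (pt s)) \<le> 1 + 2 * R" by simp
  moreover have "R * E (pt s) \<le> R * 1" by (rule mult_left_mono) (use E_bounds[OF pt_in_hyp] R in auto)
  ultimately show ?thesis by (simp add: phi_def)
qed

lemma nu_pt: "s \<in> {0..1} \<Longrightarrow> nu s (pt s) \<le> 9 / 4"
proof -
  assume s: "s \<in> {0..1}"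
  have "A s (pt s) = 1" by (simp add: A_def pt_product)
  moreover have "ht\<^sup>2 * (F (pt s))\<^sup>2 \<le> ht\<^sup>2 * (3 / (2 * ht))\<^sup>2"
    by (intro mult_left_mono power_mono F_pt_le[OF s]) (use F_ge_1[OF pt_in_hyp, of s] in auto)
  moreover have "ht\<^sup>2 * (3 / (2 * ht))\<^sup>2 = 9 / 4" using ht(1) by (simp add: power2_eq_square)
  ultimately have "Q s (pt s) \<le> 13 / 4" by (simp add: Q_def)
  moreover have "ln (Q s (pt s)) \<le> Q s (pt s) - 1"
    using Q_pos[OF pt_in_hyp, of s s] by (intro ln_le_minus_one) simp
  ultimately show ?thesis by (simp add: nu_def)
qed

lemma pot_pt:
  assumes "admissible k ps s"
  shows "256 * pot ps s (pt s) \<le> 3 * R + 20"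
proof -
  have s: "s \<in> {0..1}" using assms by (simp add: admissible_def)
  have "\<bar>pot ps s (pt s) - (phi (pt s) / 256 + nu s (pt s) / 32)\<bar> \<le> 1 / 256"
    using assms by (rule pot_jet) (use pt_in_hyp in blast)
  then show ?thesis using phi_pt[OF s] nu_pt[OF s] unfolding abs_le_iff by linarith
qed

lemma nu_nonneg: "x \<in> hyp \<Longrightarrow> nu s x \<ge> 0"
  using Q_pos[of x s] by (simp add: nu_def)

lemma pot_lower:
  assumes "admissible k ps s" "x \<in> hyp"
  shows "256 * pot ps s x \<ge> phi x + 8 * nu s x - 1"
proof -
  have "\<bar>pot ps s x - (phi x / 256 + nu s x / 32)\<bar> \<le> 1 / 256"
    using assms(1) by (rule pot_jet) (use assms(2) in blast)
  then show ?thesis unfolding abs_le_iff by linarith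
qed

text \<open>Beyond distance \<open>2 * R\<close>, \<open>phi\<close> alone is at least
  \<open>4 * R - 2\<close>, which beats the value of at most \<open>3 * R + 20\<close> at
  \<open>pt s\<close>. The slope 2 of \<open>phi\<close> is chosen for this comparison.\<close>

lemma pot_far:
  assumes "admissible k ps s" "x \<in> hyp" "F x > cosh (2 * R)" "R \<ge> 32"
  shows "pot ps s (pt s) < pot ps s x"
proof -
  have "exp (2 * R) / 2 \<le> cosh (2 * R)" by (simp add: cosh_def)
  then have "exp (2 * R) / 2 \<le> F x" using assms(3) by simp
  then have "ln (exp (2 * R) / 2) \<le> ln (F x)" by (subst ln_le_cancel_iff) (use F_ge_1[OF assms(2)] in auto)
  moreover have "ln (exp (2 * R) / 2) = 2 * R - ln 2" by (simp add: ln_div)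
  moreover have "ln 2 \<le> (1 :: real)" using ln_le_minus_one[of "2 :: real"] by simp
  ultimately have "2 * R - 1 \<le> ln (F x)" by linarith
  then have "4 * R - 2 \<le> phi x" using phi_lower(1)[OF assms(2)] by simp
  then show ?thesis
    using pot_pt[OF assms(1)] pot_lower[OF assms(1,2)] nu_nonneg[OF assms(2), of s] assms(4) by linarith
qed

lemma pot_minimizer:
  assumes "admissible k ps s" "R \<ge> 32"
  obtains x where "x \<in> hball x0 (2 * R)" "is_minimizer (pot ps s) x"
proof -
  define S where "S = {x \<in> hyp. F x \<le> cosh (2 * R)}"
  have "compact S" unfolding S_def F_def by (rule compact_hyp_sublevel[OF x0])
  moreover have pS: "pt s \<in> S"
    using pot_far[OF assms(1) pt_in_hyp _ assms(2), of s] pt_in_hyp[of s] by (force simp: S_def)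
  moreover have "continuous_on S (pot ps s)"
    using assms(1) by (rule pot_jet) (rule has_hhess_continuous_on; auto simp: S_def)
  ultimately obtain x where x: "x \<in> S" "\<forall>y\<in>S. pot ps s x \<le> pot ps s y"
    using continuous_attains_inf[of S "pot ps s"] by blast
  show ?thesis
  proof (rule that)
    have h: "x \<in> hyp" "F x \<le> cosh (2 * R)" using x(1) by (auto simp: S_def)
    have "hdist x0 x = arcosh (F x)"
      using hdist_eq_arcosh[OF x0 h(1)] by (simp add: F_def mink_commute[of x0])
    also have "\<dots> \<le> arcosh (cosh (2 * R))"
      using h(2) F_ge_1[OF h(1)] arcosh_real_strict_mono[of "F x" "cosh (2 * R)"] by (auto simp: order.order_iff_strict)
    also have "\<dots> = 2 * R" using R by (simp add: arcosh_cosh_real)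
    finally show "x \<in> hball x0 (2 * R)" using h(1) by (simp add: hball_def)
    show "is_minimizer (pot ps s) x"
      unfolding is_minimizer_def
    proof (intro conjI h(1) ballI)
      fix y :: "'a \<times> real" assume y: "y \<in> hyp"
      show "pot ps s x \<le> pot ps s y"
      proof (cases "y \<in> S")
        case False
        then have "pot ps s (pt s) < pot ps s y" using pot_far[OF assms(1) y _ assms(2)] y by (auto simp: S_def)
        then show ?thesis using bspec[OF x(2) pS] by linarith
      qed (use x in blast)
    qed
  qed
qed

text \<open>From \<open>nu s x \<ge> R + ln d\<close> and \<open>phi x \<ge> R\<close>, the left
  side is at least \<open>R + 8 * (R + ln d) - 1 - (3 * R + 20)\<close>.\<close>

lemma pot_gap:
  assumes adm: "admissible k ps s" and x: "x \<in> hyp" and d: "d > 0" "d \<le> \<bar>s - foot x\<bar>"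
  shows "256 * (pot ps s x - pot ps s (pt s)) \<ge> 6 * R + 8 * ln d - 21"
proof -
  have "d / ht \<le> A s x" using A_ge_foot[OF x, of s] d(2) ht(1) by (simp add: divide_le_eq mult.commute)
  also have "A s x \<le> Q s x" by (simp add: Q_def)
  finally have "ln (d / ht) \<le> nu s x"
    unfolding nu_def using d(1) ht(1) Q_pos[OF x, of s] by (subst ln_le_cancel_iff) auto
  then have "ln d + R \<le> nu s x" using ln_divide_ht[OF d(1)] by simp
  then show ?thesis
    using phi_lower(2)[OF x] pot_lower[OF adm x] pot_pt[OF adm] unfolding right_diff_distrib by linarith
qed

lemma pot_agree_at_query:
  assumes "\<forall>q\<in>set ps. fst q \<in> hyp" "p \<in> fst ` set ps" "has_hgrad h d p" "has_hgrad h' d' p"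
  shows "first_order_agree (\<lambda>x. c * (1 / 256 * phi x + 1 / 32 * blend ps h x))
    (\<lambda>x. c * (1 / 256 * phi x + 1 / 32 * blend ps h' x)) p"
proof -
  have p: "p \<in> hyp" using assms(1,2) by auto
  have k: "first_order_agree (\<lambda>x. a) (\<lambda>x. a) p" for a
    by (rule first_order_agree_refl[OF has_hhess_grad[OF has_hhess_const p]])
  have f: "first_order_agree phi phi p"
    by (rule first_order_agree_refl[OF has_hhess_grad[OF has_hhess_phi p]])
  show ?thesis
    by (intro first_order_agree_mult first_order_agree_add k f blend_agree_at_query[OF assms])
qed

lemma scaled_pot_has_hgrad:
  assumes "\<forall>q\<in>set ps. fst q \<in> hyp" "x \<in> hyp"
  shows "\<exists>g. has_hgrad (\<lambda>x. c * pot ps s x) g x"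
proof -
  obtain d where "has_hgrad (blend ps (nu s)) d x"
    using blend_has_hgrad[OF assms has_hhess_grad[OF has_hhess_nu assms(2)]] ..
  then show ?thesis
    unfolding pot_def
    using has_hgrad_mult[OF has_hhess_grad[OF has_hhess_const assms(2)]
        has_hgrad_add[OF has_hgrad_mult[OF has_hhess_grad[OF has_hhess_const assms(2)] has_hhess_grad[OF has_hhess_phi assms(2)]]
          has_hgrad_mult[OF has_hhess_grad[OF has_hhess_const assms(2)]]]]
    by blast
qed

text \<open>The invariant concerns all \<open>s\<close> of the current interval at once, so
  shrinking the interval preserves it. An interval of length \<open>\<kappa> * l\<close> that keeps
  distance \<open>l / 4\<close> from the foot of the query has separation
  \<open>4 * \<kappa>\<close>.\<close>

lemma resisting_oracle:
  assumes alg: "first_order_algorithm alg" and \<kappa>: "0 < \<kappa>" "\<kappa> \<le> 1 / 4"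
  shows "\<exists>ps t. length ps = k \<and> 0 \<le> t \<and> t + \<kappa> ^ k \<le> 1 \<and>
    (\<forall>s\<in>{t..t + \<kappa> ^ k}.
      (\<forall>q\<in>set ps. fst q \<in> hyp \<and> snd q \<in> {0..1} \<and> separated (fst q) (snd q) s (4 * \<kappa>) \<and>
        \<kappa> ^ k / 4 \<le> \<bar>s - foot (fst q)\<bar>) \<and>
      (\<forall>j<k. iterate alg (\<lambda>x. c * pot ps s x) j = fst (ps ! j)))"
proof (induction k)
  case 0
  show ?case by (intro exI[of _ "[]"] exI[of _ 0]) simp
next
  case (Suc k)
  define l where "l = \<kappa> ^ k"
  have l: "0 < l" using \<kappa> by (simp add: l_def)
  obtain ps t where len: "length ps = k" and t: "0 \<le> t" "t + l \<le> 1"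
    and q: "\<And>s q. s \<in> {t..t + l} \<Longrightarrow> q \<in> set ps \<Longrightarrow> fst q \<in> hyp \<and> snd q \<in> {0..1} \<and>
        separated (fst q) (snd q) s (4 * \<kappa>) \<and> l / 4 \<le> \<bar>s - foot (fst q)\<bar>"
    and it: "\<And>s j. s \<in> {t..t + l} \<Longrightarrow> j < k \<Longrightarrow> iterate alg (\<lambda>x. c * pot ps s x) j = fst (ps ! j)"
    using Suc.IH unfolding l_def by blast
  have ps: "\<forall>q\<in>set ps. fst q \<in> hyp" using q[of t] l by simp
  have mem: "fst (ps ! j) \<in> fst ` set ps" if "j < k" for j using that len by simp
  \<comment> \<open>The left end \<open>t\<close> stands for the whole interval; \<open>eq\<close>
    below shows that the refined functions have the same history up to here.\<close>
  define x where "x = iterate alg (\<lambda>x. c * pot ps t x) k"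
  have x: "x \<in> hyp" unfolding x_def by (rule run_in_hyp[OF alg scaled_pot_has_hgrad[OF ps]])
  \<comment> \<open>The piece is taken in the half away from the foot;
    \<open>\<kappa> \<le> 1 / 4\<close> makes it fit behind the three-quarter point.\<close>
  define t' where "t' = (if foot x \<le> t + l / 2 then t + 3 / 4 * l else t)"
  define ps' where "ps' = ps @ [(x, t')]"
  have kl: "0 < \<kappa> * l" "\<kappa> * l \<le> l / 4" using \<kappa> l mult_right_mono[of \<kappa> "1 / 4" l] by simp_all
  have sub: "t \<le> t'" "t' + \<kappa> * l \<le> t + l"
    unfolding t'_def using kl l by (cases "foot x \<le> t + l / 2"; simp only: if_True if_False; linarith)+
  have far: "l / 4 \<le> \<bar>s - foot x\<bar>" if "s \<in> {t'..t' + \<kappa> * l}" for s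
  proof (cases "foot x \<le> t + l / 2")
    case True
    then have "t + 3 / 4 * l \<le> s" using that by (simp add: t'_def)
    then show ?thesis using True by linarith
  next
    case False
    then have "s \<le> t + \<kappa> * l" using that by (simp add: t'_def)
    then show ?thesis using False kl by linarith
  qed
  have props: "fst q \<in> hyp \<and> snd q \<in> {0..1} \<and> separated (fst q) (snd q) s (4 * \<kappa>) \<and>
      \<kappa> * l / 4 \<le> \<bar>s - foot (fst q)\<bar>" if s: "s \<in> {t'..t' + \<kappa> * l}" and qq: "q \<in> set ps'" for s q
  proof (cases "q \<in> set ps")
    case True
    then show ?thesis using q[of s q] s sub kl l by auto
  next
    case False
    then have qx: "q = (x, t')" using qq by (auto simp: ps'_def)
    have "\<bar>t' - s\<bar> \<le> (4 * \<kappa>) * (l / 4)" using s by auto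
    moreover have "(4 * \<kappa>) * (l / 4) \<le> (4 * \<kappa>) * \<bar>t' - foot x\<bar>" "(4 * \<kappa>) * (l / 4) \<le> (4 * \<kappa>) * \<bar>s - foot x\<bar>"
      using far[of t'] far[OF s] \<kappa> kl by (auto intro!: mult_left_mono)
    ultimately have "separated x t' s (4 * \<kappa>)" by (simp add: separated_def)
    then show ?thesis using x sub t kl l far[OF s] by (auto simp: qx)
  qed
  have its: "iterate alg (\<lambda>x. c * pot ps' s x) j = fst (ps' ! j)" if s: "s \<in> {t'..t' + \<kappa> * l}" and j: "j < Suc k" for s j
  proof -
    have s': "s \<in> {t..t + l}" using s sub by auto
    \<comment> \<open>Seen from the old queries, passing from \<open>pot ps t\<close> to
      \<open>pot ps' s\<close> only replaces the innermost function \<open>nu t\<close> by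
      \<open>h\<close>.\<close>
    define h where "h = (\<lambda>y. chi x y * nu t' y + (1 - chi x y) * nu s y)"
    have pot': "(\<lambda>y. c * pot ps' s y) = (\<lambda>y. c * (1 / 256 * phi y + 1 / 32 * blend ps h y))"
      by (simp add: pot_def ps'_def blend_append h_def)
    have grad_h: "\<exists>d. has_hgrad h d p" if "p \<in> hyp" for p
      using has_hgrad_add[OF has_hgrad_mult[OF has_hhess_grad[OF has_hhess_chi[OF x] that] has_hhess_grad[OF has_hhess_nu that]]
          has_hgrad_mult[OF has_hhess_grad[OF has_hhess_diff[OF has_hhess_const has_hhess_chi[OF x]] that] has_hhess_grad[OF has_hhess_nu that]]]
      unfolding h_def by blast
    have agree: "first_order_agree (\<lambda>y. c * pot ps t y) (\<lambda>y. c * pot ps' s y) (fst (ps ! i))" if "i < k" for i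
    proof -
      have p: "fst (ps ! i) \<in> hyp" using ps mem[OF that] by auto
      obtain d where "has_hgrad h d (fst (ps ! i))" using grad_h[OF p] ..
      from pot_agree_at_query[OF ps mem[OF that] has_hhess_grad[OF has_hhess_nu p] this]
      show ?thesis unfolding pot' unfolding pot_def .
    qed
    \<comment> \<open>Agreement at queries \<open>0\<close> to \<open>k - 1\<close> fixes the
      history of length \<open>k\<close>, and with it the query number \<open>k\<close>.\<close>
    have eq: "run_history alg (\<lambda>y. c * pot ps t y) i = run_history alg (\<lambda>y. c * pot ps' s y) i" if "i \<le> k" for i
    proof (rule run_history_agree)
      fix m assume "m < i"
      then have "m < k" using that by simp
      then show "iterate alg (\<lambda>y. c * pot ps t y) m \<in> hyp \<and>
          first_order_agree (\<lambda>y. c * pot ps t y) (\<lambda>y. c * pot ps' s y) (iterate alg (\<lambda>y. c * pot ps t y) m)"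
        using it[of t m] agree[of m] ps mem[of m] l by auto
    qed
    then have "iterate alg (\<lambda>y. c * pot ps' s y) j = iterate alg (\<lambda>y. c * pot ps t y) j"
      using j by (simp add: iterate_def)
    also have "\<dots> = fst (ps' ! j)"
    proof (cases "j < k")
      case True
      then show ?thesis using it[of t j] l len by (simp add: ps'_def nth_append)
    next
      case False
      then show ?thesis using j len by (simp add: ps'_def x_def nth_append less_Suc_eq)
    qed
    finally show ?thesis .
  qed
  have "length ps' = Suc k" using len by (simp add: ps'_def)
  moreover have "0 \<le> t'" "t' + \<kappa> ^ Suc k \<le> 1" using sub t by (simp_all add: l_def)
  moreover have "\<forall>s\<in>{t'..t' + \<kappa> ^ Suc k}.
      (\<forall>q\<in>set ps'. fst q \<in> hyp \<and> snd q \<in> {0..1} \<and> separated (fst q) (snd q) s (4 * \<kappa>) \<and>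
        \<kappa> ^ Suc k / 4 \<le> \<bar>s - foot (fst q)\<bar>) \<and>
      (\<forall>j<Suc k. iterate alg (\<lambda>x. c * pot ps' s x) j = fst (ps' ! j))"
    unfolding power_Suc l_def[symmetric] using props its by simp
  ultimately show ?case by blast
qed

end

section \<open>The lower bound\<close>

text \<open>\<open>e b\<close> is the closed formula for the parallel transport of
  \<open>(b, 0)\<close> from \<open>(0, 1)\<close> to \<open>x0\<close>, hence isometric in
  \<open>b\<close>.\<close>

lemma tangent_orthonormal_pair:
  fixes x0 :: "'a::euclidean_space \<times> real"
  assumes x0: "x0 \<in> hyp" and dim: "DIM('a) \<ge> 2"
  obtains e1 e2 where "e1 \<in> tangent x0" "e2 \<in> tangent x0"
    "mink e1 e1 = 1" "mink e2 e2 = 1" "mink e1 e2 = 0"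
proof -
  obtain b1 b2 :: 'a where b: "b1 \<in> Basis" "b2 \<in> Basis" "b1 \<noteq> b2"
    using dim card_le_Suc0_iff_eq[of "Basis :: 'a set"] by force
  define o' :: "'a \<times> real" where "o' = (0, 1)"
  have o': "o' \<in> hyp" by (simp add: o'_def hyp_def mink_def)
  define c where "c = 1 - mink o' x0"
  have c: "c \<noteq> 0" using mink_hyp_le(1)[OF o' x0] by (simp add: c_def)
  define m where "m = o' + x0"
  define g where "g = (\<lambda>b :: 'a. mink x0 (b, 0))"
  define e where "e = (\<lambda>b. (b, 0) + (g b / c) *\<^sub>R m)"
  have m: "mink m m = - 2 * c" "mink x0 m = - c" "mink m (b, 0) = g b" "mink (b, 0) m = g b" for b
    using o' x0
    by (simp_all add: m_def g_def c_def mink_simps hyp_def mink_commute[of x0 o'] mink_commute[of "(b, 0)"])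
       (simp_all add: o'_def mink_def)
  have prod: "mink (e b) (e b') = b \<bullet> b'" for b b'
  proof -
    have "mink (b, 0) (b', 0) = b \<bullet> b'" by (simp add: mink_def)
    then have "mink (e b) (e b') = b \<bullet> b' + g b' / c * g b + g b / c * g b' + g b / c * (g b' / c) * (- 2 * c)"
      unfolding e_def mink.add_left mink.add_right mink.scaleR_left mink.scaleR_right m by simp
    also have "\<dots> = b \<bullet> b'" using c by (simp add: field_simps)
    finally show ?thesis .
  qed
  have tan: "e b \<in> tangent x0" for b
    using c unfolding tangent_def mem_Collect_eq e_def mink.add_right mink.scaleR_right m
    by (simp add: g_def)
  show ?thesis
    by (rule that[of "e b1" "e b2"]) (use tan prod b in \<open>auto simp: inner_Basis\<close>)
qed

lemma has_hhess_scaled_in_fclass0: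
  assumes f: "has_hhess f G H" and c: "c > 0"
    and G: "\<And>x. x \<in> hyp \<Longrightarrow> lform x (mink (G x)) M"
    and H: "\<And>x. x \<in> hyp \<Longrightarrow> bform x (H x) L"
    and pos: "\<And>x u. x \<in> hyp \<Longrightarrow> u \<in> tangent x \<Longrightarrow> u \<noteq> 0 \<Longrightarrow> H x u u > 0"
    and x: "x \<in> hball xref r" "is_minimizer f x"
  shows "(\<lambda>x. c * f x) \<in> fclass0 xref r (c * M) (c * L)"
    and "is_minimizer (\<lambda>x. c * f x) x" "\<And>y. is_minimizer (\<lambda>x. c * f x) y \<Longrightarrow> y = x"
proof -
  note cf = has_hhess_cmult[OF f, of c]
  show m: "is_minimizer (\<lambda>x. c * f x) x" using x(2) c by (simp add: is_minimizer_def)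
  have pos': "c * H y u u > 0" if "y \<in> hyp" "u \<in> tangent y" "u \<noteq> 0" for y u
    using pos[OF that] c by simp
  show "y = x" if "is_minimizer (\<lambda>x. c * f x) y" for y
    by (rule unique_minimizer_if_hess_pos[OF cf _ m that]) (rule pos')
  have "glipschitz_on (c * M) hyp (\<lambda>x. c * f x)"
  proof (rule glipschitz_on_if_grad_bound[OF cf])
    fix y u :: "'a \<times> real" assume y: "y \<in> hyp" "u \<in> tangent y"
    show "\<bar>mink (c *\<^sub>R G y) u\<bar> \<le> c * M * hnorm u"
      using lform_D[OF G[OF y(1)] y(2)] c by (simp add: mink_simps abs_mult mult.assoc)
  qed
  moreover have "gsmooth_on (c * L) hyp (\<lambda>x. c * f x)"
  proof (rule gsmooth_on_if_hess_bound[OF cf])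
    fix y u w :: "'a \<times> real" assume y: "y \<in> hyp" "u \<in> tangent y" "w \<in> tangent y"
    show "\<bar>c * H y u w\<bar> \<le> c * L * hnorm u * hnorm w"
      using bform_D[OF H[OF y(1)] y(2,3)] c by (simp add: abs_mult mult.assoc)
  qed
  moreover have "strongly_gconvex_on 0 hyp (\<lambda>x. c * f x)"
  proof (rule strongly_gconvex_on_if_hess_nonneg[OF cf])
    fix y u :: "'a \<times> real" assume y: "y \<in> hyp" "u \<in> tangent y"
    have "H y 0 0 = 0" using bform_D[OF H[OF y(1)] zero_in_tangent zero_in_tangent] by simp
    then show "c * H y u u \<ge> 0" using pos'[OF y] by (cases "u = 0") auto
  qed
  ultimately show "(\<lambda>x. c * f x) \<in> fclass0 xref r (c * M) (c * L)"
    using x(1) m by (auto simp: fclass0_def)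
qed

lemma zeta_bounds:
  assumes "r \<ge> 64"
  shows "r \<le> zeta r" "zeta r \<le> 5 / 4 * r"
proof -
  have t: "0 < tanh r" "tanh r < 1" using assms by (simp_all add: tanh_real_lt_1)
  have "1 + 2 * r \<le> exp (2 * r)" by (rule exp_ge_add_one_self)
  then have "9 \<le> exp (2 * r)" using assms by linarith
  then have "exp (- (2 * r)) \<le> 1 / 9" by (simp add: exp_minus field_simps)
  moreover have "tanh r = (1 - exp (- (2 * r))) / (1 + exp (- (2 * r)))" by (simp add: tanh_real_altdef)
  ultimately have "4 / 5 \<le> tanh r" by (simp add: field_simps add_pos_pos)
  then show "zeta r \<le> 5 / 4 * r" using t assms by (simp add: zeta_def field_simps)
  show "r \<le> zeta r" using t assms by (simp add: zeta_def field_simps)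
qed

theorem theorem7:
  fixes xref :: "(real ^ 'n) \<times> real"
    and Lt r eps_hat eps eps' L :: real
    and T :: nat
    and A :: "(real ^ 'n) history \<Rightarrow> (real ^ 'n) \<times> real"
  assumes "CARD('n) \<ge> 2"
    and "xref \<in> hyp"
    and "Lt > 0"
    and "r \<ge> 64"
    and "eps_hat = 1 / (2 ^ 10 * r)"
    and "eps = 1 / (2 ^ 18 * zeta r * (ln (zeta r))\<^sup>2)"
    and "eps' = 1 / (2 ^ 18 * (ln (zeta r))\<^sup>2)"
    and "L = Lt / (2 ^ 10 * (ln r)\<^sup>2)"
    and "T = nat \<lfloor>zeta r / (50 * ln (64 * zeta r))\<rfloor>"
    and "first_order_algorithm A"
  shows "\<exists>f xstar. C_infinity f \<and> f \<in> fclass0 xref r (Lt / 2) Lt \<and>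
           is_minimizer f xstar \<and> (\<forall>y. is_minimizer f y \<longrightarrow> y = xstar) \<and>
           (\<forall>k<T. f (iterate A f k) - f xstar \<ge> 2 * eps_hat * L * r\<^sup>2) \<and>
           2 * eps_hat * L * r\<^sup>2 \<ge> eps' * (Lt / 2) * r \<and>
           eps' * (Lt / 2) * r \<ge> eps * (1 / 2) * Lt * r\<^sup>2"
proof -
  define z where "z = zeta r"
  have r: "r \<ge> 64" and Lt: "Lt > 0" by fact+
  have z: "r \<le> z" "z \<le> 5 / 4 * r" using zeta_bounds[OF r] by (simp_all add: z_def)
  have "exp 1 \<le> r" using exp_le r by linarith
  then have lnr: "1 \<le> ln r" using r by (subst ln_ge_iff) auto
  have lnz: "ln r \<le> ln z" using z r by (subst ln_le_cancel_iff) auto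
  have ln2: "(ln r)\<^sup>2 \<le> (ln z)\<^sup>2" by (rule power_mono[OF lnz]) (use lnr in simp)
  have gap: "2 * eps_hat * L * r\<^sup>2 = Lt * r / (2 ^ 19 * (ln r)\<^sup>2)"
    unfolding assms(5,8) using r by (simp add: field_simps power2_eq_square)
  have mid: "eps' * (Lt / 2) * r = Lt * r / (2 ^ 19 * (ln z)\<^sup>2)"
    using assms(7) by (simp add: z_def)
  have low: "eps * (1 / 2) * Lt * r\<^sup>2 = Lt * r / (2 ^ 19 * (ln z)\<^sup>2) * (r / z)"
    unfolding assms(6) by (simp add: z_def power2_eq_square mult_ac)
  have "Lt * r / (2 ^ 19 * (ln z)\<^sup>2) \<le> Lt * r / (2 ^ 19 * (ln r)\<^sup>2)"
    by (rule divide_left_mono) (use ln2 Lt r lnr lnz in auto)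
  then have ineq1: "2 * eps_hat * L * r\<^sup>2 \<ge> eps' * (Lt / 2) * r" by (simp only: gap mid)
  have "Lt * r / (2 ^ 19 * (ln z)\<^sup>2) * (r / z) \<le> Lt * r / (2 ^ 19 * (ln z)\<^sup>2) * 1"
    by (rule mult_left_mono) (use z r Lt in auto)
  then have ineq2: "eps' * (Lt / 2) * r \<ge> eps * (1 / 2) * Lt * r\<^sup>2" by (simp only: low mid mult_1_right)
  have "1 \<le> (ln r)\<^sup>2" using lnr by simp
  \<comment> \<open>The logarithm in the required gap is discarded, since the gap obtained below is
    a constant multiple of \<open>r\<close>.\<close>
  then have gap_le: "2 * eps_hat * L * r\<^sup>2 \<le> Lt * (r / 2 ^ 19)"
    unfolding gap using Lt r by (simp add: field_simps mult_left_mono)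

  define R where "R = r / 2"
  \<comment> \<open>\<open>admissible\<close> needs \<kappa> below order \<open>1 / z ^ 4\<close>.
    The exponent 10 against the 50 in \<open>T\<close> yields
    \<open>\<kappa> ^ T \<ge> exp (- z / 5)\<close>, and this is at least
    \<open>exp (- R / 2)\<close> because \<open>z \<le> 5 / 4 * r\<close>.\<close>
  define \<kappa> where "\<kappa> = 1 / (64 * z) ^ 10"
  have zpos: "64 \<le> z" using z r by simp
  have dim: "DIM(real ^ 'n) \<ge> 2" using assms(1) by simp
  obtain e1 e2 where e: "e1 \<in> tangent xref" "e2 \<in> tangent xref"
    "mink e1 e1 = 1" "mink e2 e2 = 1" "mink e1 e2 = 0"
    by (rule tangent_orthonormal_pair[OF \<open>xref \<in> hyp\<close> dim]) (rule that)
  interpret horocycle_family xref e1 e2 R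
    by unfold_locales (use e \<open>xref \<in> hyp\<close> r in \<open>auto simp: R_def\<close>)
  have "64 * z \<ge> 4" using zpos by simp
  then have "4 ^ 1 \<le> (64 * z) ^ 10" using power_mono[of 4 "64 * z" 10] by simp
  then have \<kappa>: "0 < \<kappa>" "\<kappa> \<le> 1 / 4" using zpos by (simp_all add: \<kappa>_def field_simps)
  obtain ps t where len: "length ps = T" and t: "0 \<le> t" "t + \<kappa> ^ T \<le> 1"
    and ps: "\<And>s. s \<in> {t..t + \<kappa> ^ T} \<Longrightarrow>
      (\<forall>q\<in>set ps. fst q \<in> hyp \<and> snd q \<in> {0..1} \<and> separated (fst q) (snd q) s (4 * \<kappa>) \<and>
        \<kappa> ^ T / 4 \<le> \<bar>s - foot (fst q)\<bar>) \<and>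
      (\<forall>j<T. iterate A (\<lambda>x. Lt * pot ps s x) j = fst (ps ! j))"
    using resisting_oracle[OF \<open>first_order_algorithm A\<close> \<kappa>, of T Lt] by blast
  have \<kappa>T: "0 < \<kappa> ^ T" using \<kappa> by simp
  then have t1: "t \<le> 1" using t by linarith
  have q: "\<And>q. q \<in> set ps \<Longrightarrow> fst q \<in> hyp \<and> snd q \<in> {0..1} \<and> separated (fst q) (snd q) t (4 * \<kappa>) \<and>
        \<kappa> ^ T / 4 \<le> \<bar>t - foot (fst q)\<bar>"
    and it: "\<And>j. j < T \<Longrightarrow> iterate A (\<lambda>x. Lt * pot ps t x) j = fst (ps ! j)"
    using ps[of t] \<kappa>T by auto
  have "1 \<le> ln (64 * z)" using lnr lnz zpos ln_le_cancel_iff[of z "64 * z"] by linarith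
  have Tz: "real T * ln (64 * z) \<le> z / 50"
  proof -
    have "0 \<le> z / (50 * ln (64 * z))" using zpos \<open>1 \<le> ln (64 * z)\<close> by simp
    then have "real T \<le> z / (50 * ln (64 * z))" unfolding assms(9) z_def[symmetric] by simp
    then show ?thesis using \<open>1 \<le> ln (64 * z)\<close> by (simp add: field_simps)
  qed
  have "real T * 1 \<le> real T * ln (64 * z)" by (rule mult_left_mono) (use \<open>1 \<le> ln (64 * z)\<close> in auto)
  then have T_le: "real T \<le> z" using Tz zpos by linarith
  have adm: "admissible (4 * \<kappa>) ps t"
    unfolding admissible_def
  proof (intro conjI)
    have "real T ^ 3 * R \<le> z ^ 3 * z"
      by (rule mult_mono) (use T_le z r in \<open>auto simp: R_def intro!: power_mono\<close>)
    then have "32 * real (length ps) ^ 3 * 2 ^ 16 * (4 * \<kappa>) * R \<le> 2 ^ 23 * \<kappa> * (z ^ 3 * z)"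
      using \<kappa> by (simp add: len mult_ac mult_left_mono)
    also have "\<dots> < 1"
    proof -
      have "2 ^ 23 * (z ^ 3 * z) < (64 * z) ^ 10"
      proof -
        have "z ^ 4 * 1 \<le> z ^ 4 * z ^ 6" by (rule mult_left_mono) (use zpos in auto)
        then have "z ^ 4 \<le> z ^ 10" by (simp flip: power_add)
        then have "2 ^ 23 * z ^ 4 \<le> 2 ^ 23 * z ^ 10" by (rule mult_left_mono) simp
        also have "\<dots> < 64 ^ 10 * z ^ 10" by (rule mult_strict_right_mono) (use zpos in auto)
        finally show ?thesis by (simp add: power_mult_distrib power3_eq_cube power4_eq_xxxx)
      qed
      then show ?thesis using zpos by (simp add: \<kappa>_def field_simps)
    qed
    finally show "32 * real (length ps) ^ 3 * 2 ^ 16 * (4 * \<kappa>) * R < 1" .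
  qed (use \<kappa> t(1) t1 q in auto)
  have R32: "R \<ge> 32" using r by (simp add: R_def)
  obtain xs where xs: "xs \<in> hball xref (2 * R)" "is_minimizer (pot ps t) xs"
    using pot_minimizer[OF adm R32] .
  obtain G H where jet: "has_hhess (pot ps t) G H"
    "\<And>x. x \<in> hyp \<Longrightarrow> lform x (mink (G x)) (1 / 2)"
    "\<And>x. x \<in> hyp \<Longrightarrow> bform x (H x) 1"
    "\<And>x u. x \<in> hyp \<Longrightarrow> u \<in> tangent x \<Longrightarrow> u \<noteq> 0 \<Longrightarrow> H x u u > 0"
    using adm by (rule pot_jet) (rule that)
  have xs': "xs \<in> hball xref r" using xs(1) by (simp add: R_def)
  note cls = has_hhess_scaled_in_fclass0[OF jet(1) Lt jet(2-4) xs' xs(2)]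
  have "C_infinity (\<lambda>x. Lt * pot ps t x)"
    by (rule C_infinity_mult[OF C_infinity_const C_infinity_pot]) (use q in blast)
  moreover have "(\<lambda>x. Lt * pot ps t x) \<in> fclass0 xref r (Lt / 2) Lt" using cls(1) by simp
  moreover have "Lt * pot ps t (iterate A (\<lambda>x. Lt * pot ps t x) k) - Lt * pot ps t xs \<ge> 2 * eps_hat * L * r\<^sup>2"
    if k: "k < T" for k
  proof -
    define p where "p = fst (ps ! k)"
    have "ps ! k \<in> set ps" using k len by simp
    then have p: "p \<in> hyp" "\<kappa> ^ T / 4 \<le> \<bar>t - foot p\<bar>" using q[of "ps ! k"] by (auto simp: p_def)
    have "ln (\<kappa> ^ T / 4) = - 10 * (real T * ln (64 * z)) - 2 * ln 2"
    proof -
      have "ln (4 :: real) = 2 * ln 2" using ln_realpow[of 2 2] by simp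
      moreover have "ln (1 / a ^ 10) = - 10 * ln a" if "a > 0" for a :: real
        using that by (simp add: ln_div ln_realpow)
      from this[of "64 * z"] have "ln \<kappa> = - 10 * ln (64 * z)"
        using zpos unfolding \<kappa>_def by simp
      ultimately show ?thesis using \<kappa> by (simp add: ln_div ln_realpow)
    qed
    moreover have "ln 2 \<le> (1 :: real)" using ln_le_minus_one[of "2 :: real"] by simp
    ultimately have "ln (\<kappa> ^ T / 4) \<ge> - (R / 2) - 2" using Tz z(2) unfolding R_def by linarith
    \<comment> \<open>\<open>6 * R + 8 * (- R / 2 - 2) - 21 = 2 * R - 37\<close>, which is at least
      \<open>R - 5\<close> exactly when \<open>R \<ge> 32\<close>, that is,
      \<open>r \<ge> 64\<close>.\<close>
    then have "256 * (pot ps t p - pot ps t (pt t)) \<ge> R - 5"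
      using pot_gap[OF adm p(1) _ p(2)] \<kappa>T R32 by fastforce
    moreover have "pot ps t xs \<le> pot ps t (pt t)" using xs(2) pt_in_hyp by (auto simp: is_minimizer_def)
    ultimately have "r / 2 ^ 19 \<le> pot ps t p - pot ps t xs" using R32 unfolding R_def by (simp add: field_simps)
    then have "Lt * (r / 2 ^ 19) \<le> Lt * (pot ps t p - pot ps t xs)" using Lt by (intro mult_left_mono) auto
    then show ?thesis using gap_le by (simp add: it[OF k] p_def right_diff_distrib)
  qed
  ultimately show ?thesis using cls(2,3) ineq1 ineq2 by blast
qed

end
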